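(* Let $d\ge 1$ and let $1<\beta_1\le\cdots\le\beta_d$. Suppose that each $\beta_i$ is an integer. Let $\bm h=(h_1,\dots,h_d)$ be a $d$-tuple of Lipschitz functions on $[0,1)$ with Lipschitz constant $L\ge 0$, that is, $|h_i(x)-h_i(y)|\le L|x-y|$ for all $x,y\in[0,1)$ and $1\le i\le d$, and let $\Psi=(\psi_1,\dots,\psi_d)$ be a $d$-tuple of functions $\psi_i:\mathbb N\to\mathbb R^+$. Let $$W_d(\Psi,\bm h)=\big\{(x_1,\dots,x_d)\in[0,1)^d:\ |T_{\beta_i}^nx_i-h_i(x_i)|<\psi_i(n)\ \text{for all }1\le i\le d,\ \text{for infinitely many } n\in\mathbb N\big\}.$$ Let $f$ be a dimension function such that $f\preceq d$, and such that for each integer $1\le k\le d-1$, either $k\preceq f$ or $f\preceq k$. Then $$\mathcal H^f\big(W_d(\Psi,\bm h)\big)=\begin{cases}0&\text{if }\sum_{n=1}^\infty s_n(\Psi,f)\prod_{i=1}^d\beta_i^n<\infty,\\ \mathcal H^f([0,1]^d)&\text{if }\sum_{n=1}^\infty s_n(\Psi,f)\prod_{i=1}^d\beta_i^n=\infty,\end{cases}$$ where $$s_n(\Psi,f)=\min_{\tau\in\mathcal A_n}\Big\{f(\tau)\prod_{i\in\mathcal K_{n,1}(\tau)}\frac{\beta_i^{-n}}{\tau}\prod_{i\in\mathcal K_{n,2}(\tau)}\frac{\beta_i^{-n}\psi_i(n)}{\tau}\Big\},$$ and, in turn, $\mathcal A_n=\{\beta_1^{-n},\dots,\beta_d^{-n},\beta_1^{-n}\psi_1(n),\dots,\beta_d^{-n}\psi_d(n)\}$,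 $$\mathcal K_{n,1}(\tau)=\{1\le i\le d:\beta_i^{-n}\le\tau\},\qquad \mathcal K_{n,2}(\tau)=\{1\le i\le d:\beta_i^{-n}\psi_i(n)\ge\tau\}.$$
   Context: For $\beta>1$, $T_\beta:[0,1)\to[0,1)$ is the map $T_\beta x=\beta x\ (\mathrm{mod}\ 1)$, and $T_\beta^n$ is its $n$-th iterate. A dimension function is a continuous nondecreasing function $f$ defined on $\mathbb R_{\ge0}$ with $f(0)=0$. For dimension functions $f,g$, write $f\preceq g$ if $\frac{f(y)}{g(y)}\le\frac{f(x)}{g(x)}$ for all $0<x<y$. For a real number $s>0$, $f\preceq s$ (respectively $s\preceq f$) means $f\preceq g$ (respectively $g\preceq f$) with $g(r)=r^s$. The space carries the maximum norm. The Hausdorff $f$-measure of $A\subset\mathbb R^d$ is $\mathcal H^f(A)=\lim_{\eta\to0}\inf\{\sum_i f(|B_i|): A\subset\bigcup_i B_i,\ B_i \text{ balls with } |B_i|\le\eta\}$, where $|B|$ denotes the diameter of $B$. Empty products equal $1$.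
   Formalization: Two hypotheses are added: each h_i takes values in [0,1], and each ψ_i is bounded. Without them the claim fails for d=1, β=2: h=10, ψ=1/2, f(r)=r (empty set, divergent series); and h=0, ψ(n)=2^n n^4, f(r)=√r (convergent series, W=[0,1)). *)

theory Defs
  imports "HOL-Analysis.Analysis"
begin

section \<open>Dimension functions\<close>

text \<open>Functions on the nonnegative reals are total functions on \<open>real\<close>; only their values on
  \<open>{0..}\<close> matter.\<close>

definition dimension_function :: "(real \<Rightarrow> real) \<Rightarrow> bool" where
  "dimension_function f \<longleftrightarrow> continuous_on {0..} f \<and> mono_on {0..} f \<and> f 0 = 0"

text \<open>The quotients below involve division by zero only if a function vanishes at a positive point; a
  dimension function \<open>f\<close> with \<open>f \<preceq> (\<lambda>r. r powr s)\<close> does so only if it vanishes on all of \<open>{0..}\<close>.\<close>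

definition dim_le :: "(real \<Rightarrow> real) \<Rightarrow> (real \<Rightarrow> real) \<Rightarrow> bool" (infix "\<preceq>" 50) where
  "f \<preceq> g \<longleftrightarrow> (\<forall>x y. 0 < x \<and> x < y \<longrightarrow> f y / g y \<le> f x / g x)"

section \<open>Hausdorff measures for the maximum norm\<close>

text \<open>\<open>real ^ 'n\<close> carries the Euclidean metric, so \<open>cball\<close> and \<open>diameter\<close> are not the right notions;
  \<open>infnorm\<close> is the maximum norm.\<close>

definition max_cball :: "real ^ 'n \<Rightarrow> real \<Rightarrow> (real ^ 'n) set" where
  "max_cball x r = {y. infnorm (y - x) \<le> r}"

definition max_diameter :: "(real ^ 'n) set \<Rightarrow> real" where
  "max_diameter B = (SUP (x, y) \<in> B \<times> B. infnorm (x - y))"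

definition ball_covers :: "real \<Rightarrow> (real ^ 'n) set \<Rightarrow> (real ^ 'n) set set set" where
  "ball_covers \<eta> A =
     {\<B>. countable \<B> \<and> (\<forall>B\<in>\<B>. (\<exists>x r. 0 < r \<and> B = max_cball x r) \<and> max_diameter B \<le> \<eta>) \<and>
         A \<subseteq> \<Union>\<B>}"

definition hausdorff_content :: "(real \<Rightarrow> real) \<Rightarrow> real \<Rightarrow> (real ^ 'n) set \<Rightarrow> ennreal" where
  "hausdorff_content f \<eta> A =
     (INF \<B> \<in> ball_covers \<eta> A. \<Sum>\<^sub>\<infinity>B\<in>\<B>. ennreal (f (max_diameter B)))"

definition hausdorff_measure :: "(real \<Rightarrow> real) \<Rightarrow> (real ^ 'n) set \<Rightarrow> ennreal" where
  "hausdorff_measure f A = Lim (at_right 0) (\<lambda>\<eta>. hausdorff_content f \<eta> A)"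

lemma hausdorff_content_antimono:
  assumes "\<eta> \<le> \<eta>'"
  shows "hausdorff_content f \<eta>' A \<le> hausdorff_content f \<eta> A"
proof -
  have "ball_covers \<eta> A \<subseteq> ball_covers \<eta>' A"
    using assms by (auto simp: ball_covers_def intro: order_trans)
  then show ?thesis
    unfolding hausdorff_content_def by (rule INF_superset_mono) simp
qed

text \<open>The limit exists by monotonicity.\<close>

lemma hausdorff_measure_tendsto:
  "((\<lambda>\<eta>. hausdorff_content f \<eta> A) \<longlongrightarrow> hausdorff_measure f A) (at_right 0)"
  and hausdorff_measure_eq_SUP:
  "hausdorff_measure f A = (SUP \<eta>\<in>{0<..}. hausdorff_content f \<eta> A)"
proof -
  let ?S = "SUP \<eta>\<in>{0<..}. hausdorff_content f \<eta> A"
  have lim: "((\<lambda>\<eta>. hausdorff_content f \<eta> A) \<longlongrightarrow> ?S) (at_right 0)"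
  proof (rule order_tendstoI)
    fix a assume "a < ?S"
    then obtain e where e: "e > 0" "a < hausdorff_content f e A"
      by (auto simp: less_SUP_iff)
    have "eventually (\<lambda>\<eta>. \<eta> < e) (at_right 0)"
      using e(1) by (auto simp: eventually_at_right_field)
    then show "eventually (\<lambda>\<eta>. a < hausdorff_content f \<eta> A) (at_right 0)"
      by eventually_elim (use e(2) hausdorff_content_antimono in \<open>meson less_imp_le less_le_trans\<close>)
  next
    fix a assume a: "?S < a"
    have "hausdorff_content f \<eta> A < a" if "0 < \<eta>" for \<eta>
      using SUP_upper[of \<eta> "{0<..}" "\<lambda>\<eta>. hausdorff_content f \<eta> A"] that a
      by (meson greaterThan_iff le_less_trans)
    then show "eventually (\<lambda>\<eta>. hausdorff_content f \<eta> A < a) (at_right 0)"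
      by (simp add: eventually_at_filter)
  qed
  then have "hausdorff_measure f A = ?S"
    unfolding hausdorff_measure_def by (intro tendsto_Lim) auto
  with lim show "((\<lambda>\<eta>. hausdorff_content f \<eta> A) \<longlongrightarrow> hausdorff_measure f A) (at_right 0)"
    and "hausdorff_measure f A = ?S" by simp_all
qed

lemma max_diameter_max_cball:
  fixes x :: "real ^ 'n"
  assumes "0 \<le> r"
  shows "max_diameter (max_cball x r) = 2 * r"
proof -
  let ?v = "\<chi> i. r :: real ^ 'n"
  have inf_v: "infnorm ((\<chi> i. c) :: real ^ 'n) = \<bar>c\<bar>" for c
    by (simp add: infnorm_cart)
  show ?thesis
    unfolding max_diameter_def
  proof (rule cSup_eq_maximum)
    have "(x + ?v, x - ?v) \<in> max_cball x r \<times> max_cball x r"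
      using assms inf_v[of r] by (auto simp: max_cball_def infnorm_neg)
    moreover have "x + ?v - (x - ?v) = (\<chi> i. 2 * r)"
      by (simp add: vec_eq_iff)
    then have "infnorm (x + ?v - (x - ?v)) = 2 * r"
      using inf_v[of "2 * r"] assms by simp
    ultimately show "2 * r \<in> (\<lambda>(x, y). infnorm (x - y)) ` (max_cball x r \<times> max_cball x r)"
      by (metis (no_types, lifting) case_prod_conv rev_image_eqI)
  next
    fix t assume "t \<in> (\<lambda>(x, y). infnorm (x - y)) ` (max_cball x r \<times> max_cball x r)"
    then obtain y z where "t = infnorm (y - z)" "infnorm (y - x) \<le> r" "infnorm (z - x) \<le> r"
      by (auto simp: max_cball_def)
    moreover have "infnorm (y - z) \<le> infnorm (y - x) + infnorm (x - z)"
      using infnorm_triangle[of "y - x" "x - z"] by simp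
    ultimately show "t \<le> 2 * r"
      by (simp add: infnorm_sub)
  qed
qed

section \<open>The limsup set and the critical series\<close>

definition beta_map :: "real \<Rightarrow> real \<Rightarrow> real" where
  "beta_map \<beta> x = frac (\<beta> * x)"

definition W_set ::
  "('n \<Rightarrow> real) \<Rightarrow> ('n \<Rightarrow> nat \<Rightarrow> real) \<Rightarrow> ('n \<Rightarrow> real \<Rightarrow> real) \<Rightarrow> (real ^ 'n) set" where
  "W_set \<beta> \<psi> h =
     {x. (\<forall>i. x $ i \<in> {0..<1}) \<and>
         infinite {n. 1 \<le> n \<and>
           (\<forall>i. \<bar>(beta_map (\<beta> i) ^^ n) (x $ i) - h i (x $ i)\<bar> < \<psi> i n)}}"

definition scales :: "('n \<Rightarrow> real) \<Rightarrow> ('n \<Rightarrow> nat \<Rightarrow> real) \<Rightarrow> nat \<Rightarrow> real set" where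
  "scales \<beta> \<psi> n = range (\<lambda>i. 1 / \<beta> i ^ n) \<union> range (\<lambda>i. \<psi> i n / \<beta> i ^ n)"

definition K1 :: "('n \<Rightarrow> real) \<Rightarrow> nat \<Rightarrow> real \<Rightarrow> 'n set" where
  "K1 \<beta> n \<tau> = {i. 1 / \<beta> i ^ n \<le> \<tau>}"

definition K2 :: "('n \<Rightarrow> real) \<Rightarrow> ('n \<Rightarrow> nat \<Rightarrow> real) \<Rightarrow> nat \<Rightarrow> real \<Rightarrow> 'n set" where
  "K2 \<beta> \<psi> n \<tau> = {i. \<tau> \<le> \<psi> i n / \<beta> i ^ n}"

definition s_seq ::
  "('n :: finite \<Rightarrow> real) \<Rightarrow> ('n \<Rightarrow> nat \<Rightarrow> real) \<Rightarrow> (real \<Rightarrow> real) \<Rightarrow> nat \<Rightarrow> real" where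
  "s_seq \<beta> \<psi> f n =
     (MIN \<tau> \<in> scales \<beta> \<psi> n.
        f \<tau> * (\<Prod>i\<in>K1 \<beta> n \<tau>. (1 / \<beta> i ^ n) / \<tau>) * (\<Prod>i\<in>K2 \<beta> \<psi> n \<tau>. (\<psi> i n / \<beta> i ^ n) / \<tau>))"

text \<open>The terms are nonnegative when \<open>\<beta> i > 0\<close>, \<open>\<psi> i n > 0\<close> and \<open>f\<close> is a dimension function, so
  \<open>ennreal\<close> does not truncate.\<close>

definition critical_series ::
  "('n :: finite \<Rightarrow> real) \<Rightarrow> ('n \<Rightarrow> nat \<Rightarrow> real) \<Rightarrow> (real \<Rightarrow> real) \<Rightarrow> ennreal" where
  "critical_series \<beta> \<psi> f =
     (\<Sum>n. ennreal (s_seq \<beta> \<psi> f (Suc n) * (\<Prod>i\<in>UNIV. \<beta> i ^ Suc n)))"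

end

theory Submission
  imports Defs
begin

text \<open>
  Write \<open>p\<^sub>i = \<beta>\<^sub>i\<^sup>-\<^sup>n\<close> and \<open>q\<^sub>i = min 1 (\<psi>\<^sub>i n) \<beta>\<^sub>i\<^sup>-\<^sup>n\<close>. As the \<open>\<beta>\<^sub>i\<close> are integers, the points that
  satisfy the conditions at time \<open>n\<close> are comparable to a union of boxes with sides \<open>q\<^sub>i\<close>, one in each
  cell with sides \<open>p\<^sub>i\<close>. If the critical series converges, the boxes are covered by cubes of side \<open>\<tau>\<close>,
  where \<open>\<tau>\<close> realises the minimum in \<open>s\<^sub>n\<close>.

  If the series diverges, let \<open>\<epsilon> > 0\<close> and put on the boxes of level \<open>n\<close> the uniform measure whose
  total mass is the volume \<open>\<rho>\<^sub>n\<close> of the neighbourhood of width \<open>a\<^sub>n\<close> of their union. By the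
  comparability of \<open>f\<close> with the powers \<open>r\<^sup>k\<close>, the widths can be chosen such that \<open>\<Sum> \<rho>\<^sub>n\<close> diverges
  while a cube of side \<open>r\<close> has mass at most a constant times \<open>r\<^sup>d + \<epsilon> f r\<close>. The neighbourhoods are
  quasi-independent. Therefore the sum over finitely many late levels, trimmed where the
  neighbourhoods overlap, is a density that satisfies a bound of the same kind, and the mass of every
  cube that is not too small is at least a fixed fraction of its volume. The fraction does not depend
  on \<open>\<epsilon>\<close>.

  If \<open>f r / r\<^sup>d\<close> is bounded, it follows that the limsup set has full Lebesgue measure, which suffices
  since Lebesgue null sets are then \<open>f\<close>-null. Otherwise \<open>r\<^sup>d\<close> is negligible against \<open>f r\<close>, and
  iterating the construction inside the support of the previous density yields densities of mass
  bounded below on nested compact sets shrinking into the limsup set, such that small cubes of side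
  \<open>r\<close> have mass at most \<open>\<epsilon> f r\<close>. By the mass distribution principle the \<open>f\<close>-measure is infinite.
\<close>

section \<open>Boxes and maximum-norm balls\<close>

text \<open>What ties the widths to the critical series is one inequality. A cube of side
  \<open>r\<close> gets from level \<open>n\<close> at most about
  \<open>r ^ d * volume n (a n) / volume n r\<close>, so
  \<open>volume n (a n) \<le> \<Theta> r * volume n r\<close> is required at all scales
  \<open>r\<close> at once. Up to a constant, \<open>s_n\<close> is a lower bound for
  \<open>f r / r ^ d * volume n r\<close> for every \<open>r\<close> up to the largest cell side,
  not only at the finitely many scales; so \<open>volume n (a n)\<close> may be a multiple of
  \<open>\<epsilon> * s_n\<close>, clamped between the volumes of a box and of a cell. Shrinking
  \<open>\<epsilon>\<close> only rescales a divergent series: more levels are taken, until the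
  proportions add up to a threshold \<open>kappa\<close> that depends on the dimension and the
  Lipschitz constant only. Hence the mass is independent of \<open>\<epsilon>\<close>. The obstacle
  is that boxes may be far thinner in some coordinates than in others, so no single radius describes
  them; averaging the density of level \<open>n\<close> over balls of radius \<open>a n\<close>
  makes it bounded and turns mass estimates into volume estimates. No limit measure is formed: each
  cover is tested against one density of the sequence.\<close>

definition box_product :: "('n \<Rightarrow> real set) \<Rightarrow> (real ^ 'n) set" where
  "box_product A = {x. \<forall>i. x $ i \<in> A i}"

lemma mem_box_product [simp]: "x \<in> box_product A \<longleftrightarrow> (\<forall>i. x $ i \<in> A i)"
  by (simp add: box_product_def)

lemma box_product_eq_INT: "box_product A = (\<Inter>i. (\<lambda>x. x $ i) -` A i)"
  by auto

lemma closed_box_product: "(\<And>i. closed (A i)) \<Longrightarrow> closed (box_product A)"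
  unfolding box_product_eq_INT
  by (intro closed_INT ballI closed_vimage continuous_intros) auto

lemma open_box_product: "(\<And>i. open (A i)) \<Longrightarrow> open (box_product A)"
  unfolding box_product_eq_INT
  by (intro open_INT ballI open_vimage continuous_intros) auto

lemma box_product_sets [measurable]:
  assumes "\<And>i. A i \<in> sets borel"
  shows "box_product A \<in> sets borel"
proof -
  have "(\<lambda>x. x $ i) -` A i \<inter> space borel \<in> sets borel" for i
    by (rule measurable_sets[OF _ assms])
        (auto intro!: borel_measurable_continuous_onI continuous_intros)
  then show ?thesis
    unfolding box_product_eq_INT by (intro sets.finite_INT) auto
qed

lemma prod_Basis_vec:
  fixes g :: "real ^ 'n \<Rightarrow> 'b :: comm_monoid_mult"
  shows "(\<Prod>b\<in>Basis. g b) = (\<Prod>i\<in>UNIV. g (axis i 1))"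
proof -
  have "bij_betw (\<lambda>i :: 'n. axis i (1 :: real)) UNIV Basis"
    by (auto simp: bij_betw_def Basis_vec_def inj_on_def axis_eq_axis)
  from prod.reindex_bij_betw[OF this, of g] show ?thesis by simp
qed

text \<open>Lebesgue measure is a product over \<open>Basis\<close>; \<open>axis_index\<close> names
  the coordinate of a basis vector, so the factors may differ by coordinate and need not be
  intervals.\<close>

lemma emeasure_box_product:
  fixes A :: "'n :: finite \<Rightarrow> real set"
  assumes "\<And>i. A i \<in> sets borel"
  shows "emeasure lborel (box_product A) = (\<Prod>i\<in>UNIV. emeasure lborel (A i))"
proof -
  let ?f = "\<lambda>b :: real ^ 'n. indicator (A (axis_index b)) :: real \<Rightarrow> ennreal"
  have "indicator (box_product A) x = (\<Prod>b\<in>Basis. ?f b (x \<bullet> b))" for x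
    by (auto simp: prod_Basis_vec axis_index_axis cart_eq_inner_axis[symmetric] indicator_def)
  then have "emeasure lborel (box_product A) = (\<integral>\<^sup>+x. (\<Prod>b\<in>Basis. ?f b (x \<bullet> b)) \<partial>lborel)"
    using assms by (simp flip: nn_integral_indicator)
  also have "\<dots> = (\<Prod>b\<in>Basis. \<integral>\<^sup>+x. ?f b x \<partial>lborel)"
    by (rule nn_integral_lborel_prod) (use assms in auto)
  also have "\<dots> = (\<Prod>i\<in>UNIV. emeasure lborel (A i))"
    using assms by (simp add: prod_Basis_vec axis_index_axis)
  finally show ?thesis .
qed

lemma infnorm_le_iff: "infnorm (x :: real ^ 'n) \<le> r \<longleftrightarrow> (\<forall>i. \<bar>x $ i\<bar> \<le> r)"
proof
  show "infnorm x \<le> r \<Longrightarrow> \<forall>i. \<bar>x $ i\<bar> \<le> r"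
    using component_le_infnorm_cart order_trans by blast
  show "\<forall>i. \<bar>x $ i\<bar> \<le> r \<Longrightarrow> infnorm x \<le> r"
    unfolding infnorm_cart by (rule cSup_least) auto
qed

lemma mem_max_cball: "y \<in> max_cball x r \<longleftrightarrow> (\<forall>i. \<bar>y $ i - x $ i\<bar> \<le> r)"
  by (simp add: max_cball_def infnorm_le_iff)

lemma max_cball_eq: "max_cball x r = box_product (\<lambda>i. {x $ i - r..x $ i + r})"
  by (auto simp: mem_max_cball abs_le_iff algebra_simps)

lemma max_cball_sym: "y \<in> max_cball x r \<longleftrightarrow> x \<in> max_cball y r"
  by (simp add: mem_max_cball abs_minus_commute)

lemma max_cball_sets [measurable]: "max_cball x r \<in> sets borel"
  by (simp add: max_cball_eq)

lemma emeasure_box_interval: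
  fixes a b :: "'n :: finite \<Rightarrow> real"
  assumes "\<And>i. a i \<le> b i"
  shows "emeasure lborel (box_product (\<lambda>i. {a i..b i})) = ennreal (\<Prod>i\<in>UNIV. b i - a i)"
  using assms by (simp add: emeasure_box_product prod_ennreal)

lemma emeasure_max_cball:
  fixes x :: "real ^ 'n"
  assumes "0 \<le> r"
  shows "emeasure lborel (max_cball x r) = ennreal ((2 * r) ^ CARD('n))"
  unfolding max_cball_eq using assms
  by (subst emeasure_box_interval) (auto simp: )

text \<open>The pairs at maximum-norm distance at most \<open>r\<close> form a closed set; this
  joint measurability is what Tonelli requires below.\<close>

lemma max_cball_measurable_pair [measurable]:
  "(\<lambda>(x :: real ^ 'n, y). indicator (max_cball x r) y :: ennreal) \<in> borel_measurable
      (borel \<Otimes>\<^sub>M borel)"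
proof -
  have "closed {z :: (real ^ 'n) \<times> (real ^ 'n). \<forall>i. \<bar>snd z $ i - fst z $ i\<bar> \<le> r}"
    by (intro closed_Collect_all closed_Collect_le continuous_intros)
  then have "indicator {z. \<forall>i. \<bar>snd z $ i - fst z $ i\<bar> \<le>
      r} \<in> borel_measurable (borel :: ((real ^ 'n) \<times> (real ^ 'n)) measure)"
    by (intro borel_measurable_indicator borel_closed)
  moreover have "(\<lambda>(x :: real ^ 'n, y). indicator (max_cball x r) y :: ennreal) =
      indicator {z. \<forall>i. \<bar>snd z $ i - fst z $ i\<bar> \<le> r}"
    by (auto simp: fun_eq_iff indicator_def mem_max_cball)
  ultimately show ?thesis
    by (simp only: borel_prod)
qed

text \<open>By Tonelli and the symmetry of \<open>max_cball\<close>, every \<open>z\<close> is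
  counted with the volume of its own ball of radius \<open>a\<close>.\<close>

lemma nn_integral_average:
  fixes g :: "real ^ 'n \<Rightarrow> ennreal"
  assumes [measurable]: "g \<in> borel_measurable borel" and "0 < a"
  shows "(\<integral>\<^sup>+z. g z \<partial>lborel) * ennreal ((2 * a) ^ CARD('n)) =
         (\<integral>\<^sup>+y. \<integral>\<^sup>+z. g z * indicator (max_cball y a) z \<partial>lborel \<partial>lborel)"
proof -
  have m: "(\<lambda>(y, z). g z * indicator (max_cball y a) z) \<in> borel_measurable (lborel \<Otimes>\<^sub>M lborel)"
    using max_cball_measurable_pair[of a]
        by (simp add: split_beta' borel_prod[symmetric] cong: measurable_cong_sets)
  have "(\<integral>\<^sup>+y. \<integral>\<^sup>+z. g z * indicator (max_cball y a) z \<partial>lborel \<partial>lborel) =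
        (\<integral>\<^sup>+z. \<integral>\<^sup>+y. g z * indicator (max_cball y a) z \<partial>lborel \<partial>lborel)"
    using lborel_pair.Fubini'[OF m] by simp
  also have "\<dots> = (\<integral>\<^sup>+z. g z * (\<integral>\<^sup>+y. indicator (max_cball z a) y \<partial>lborel) \<partial>lborel)"
    by (intro nn_integral_cong, subst nn_integral_cmult[symmetric])
      (auto simp: indicator_def max_cball_sym[of _ _ a] intro!: nn_integral_cong)
  also have "\<dots> = (\<integral>\<^sup>+z. g z * ennreal ((2 * a) ^ CARD('n)) \<partial>lborel)"
    using \<open>0 < a\<close> by (simp add: emeasure_max_cball)
  also have "\<dots> = (\<integral>\<^sup>+z. g z \<partial>lborel) * ennreal ((2 * a) ^ CARD('n))"
    by (rule nn_integral_multc) simp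
  finally show ?thesis by simp
qed

text \<open>Cutoffs are continuous rather than indicators because \<open>refine_density\<close>
  needs uniform continuity of the density that it multiplies.\<close>

lemma continuous_bump:
  fixes S U :: "'a :: euclidean_space set"
  assumes "closed S" "open U" "S \<subseteq> U"
  obtains w :: "'a \<Rightarrow> real" where "continuous_on UNIV w" "\<And>x. 0 \<le> w x" "\<And>x. w x \<le> 1"
    "\<And>x. x \<in> S \<Longrightarrow> w x = 1" "\<And>x. x \<notin> U \<Longrightarrow> w x = 0"
proof -
  obtain w :: "'a \<Rightarrow> real" where w: "continuous_on UNIV w" "\<And>x. w x \<in> closed_segment 1 0"
    "\<And>x. x \<in> S \<Longrightarrow> w x = 1" "\<And>x. x \<in> - U \<Longrightarrow> w x = 0"
    using Urysohn[of S "- U" "1 :: real" 0] assms by auto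
  have "0 \<le> w x" "w x \<le> 1" for x
    using w(2)[of x] by (auto simp: closed_segment_eq_real_ivl)
  with w that show thesis by simp
qed

section \<open>Interval combs on the line\<close>

text \<open>A negative \<open>\<delta>\<close> shrinks the teeth; \<open>core\<close> uses this with
  a quarter of their length.\<close>

definition fat :: "(nat \<Rightarrow> real) \<Rightarrow> nat \<Rightarrow> real \<Rightarrow> real \<Rightarrow> real set" where
  "fat u M l \<delta> = (\<Union>k<M. {u k - \<delta>..u k + l + \<delta>})"

definition open_fat :: "(nat \<Rightarrow> real) \<Rightarrow> nat \<Rightarrow> real \<Rightarrow> real \<Rightarrow> real set" where
  "open_fat u M l \<delta> = (\<Union>k<M. {u k - \<delta><..<u k + l + \<delta>})"

lemma closed_fat [simp]: "closed (fat u M l \<delta>)"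
  by (auto simp: fat_def intro!: closed_UN)

lemma open_open_fat [simp]: "open (open_fat u M l \<delta>)"
  by (auto simp: open_fat_def)

lemma fat_sets [measurable, simp]: "fat u M l \<delta> \<in> sets borel"
  by (simp add: borel_closed)

lemma fat_mono: "\<delta> \<le> \<delta>' \<Longrightarrow> fat u M l \<delta> \<subseteq> fat u M l \<delta>'"
  unfolding fat_def by (intro UN_mono) auto

lemma fat_subset_open_fat: "\<delta> < \<delta>' \<Longrightarrow> fat u M l \<delta> \<subseteq> open_fat u M l \<delta>'"
  unfolding fat_def open_fat_def by (intro UN_mono) auto

lemma open_fat_subset_fat: "open_fat u M l \<delta> \<subseteq> fat u M l \<delta>"
  unfolding fat_def open_fat_def by (intro UN_mono) auto

lemma fat_shift: "x \<in> fat u M l \<delta> \<Longrightarrow> \<bar>y - x\<bar> \<le> \<epsilon> \<Longrightarrow> y \<in> fat u M l (\<delta> + \<epsilon>)"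
proof -
  assume "x \<in> fat u M l \<delta>" "\<bar>y - x\<bar> \<le> \<epsilon>"
  then obtain k where "k < M" "u k - \<delta> \<le> x" "x \<le> u k + l + \<delta>" by (auto simp: fat_def)
  moreover from this \<open>\<bar>y - x\<bar> \<le> \<epsilon>\<close> have "u k - (\<delta> + \<epsilon>) \<le> y" "y \<le> u k + l + (\<delta> + \<epsilon>)"
    by linarith+
  ultimately show ?thesis by (auto simp: fat_def)
qed

lemma nat_between_image:
  fixes a b :: real
  assumes "-1 < a"
  shows "int ` {k :: nat. a \<le> k \<and> k \<le> b} = {\<lceil>a\<rceil>..\<lfloor>b\<rfloor>}"
proof (intro equalityI subsetI)
  fix j assume j: "j \<in> {\<lceil>a\<rceil>..\<lfloor>b\<rfloor>}"
  with assms have "0 \<le> j" by (simp only: atLeastAtMost_iff) linarith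
  then obtain k where "j = int k" using nonneg_int_cases by blast
  with j show "j \<in> int ` {k :: nat. a \<le> k \<and> k \<le> b}"
    by (simp only: atLeastAtMost_iff ceiling_le_iff le_floor_iff of_int_of_nat_eq) blast
next
  fix j assume "j \<in> int ` {k :: nat. a \<le> k \<and> k \<le> b}"
  then obtain k :: nat where "j = int k" "a \<le> k" "k \<le> b" by blast
  then show "j \<in> {\<lceil>a\<rceil>..\<lfloor>b\<rfloor>}"
    by (simp only: atLeastAtMost_iff ceiling_le_iff le_floor_iff of_int_of_nat_eq)
qed

lemma finite_nat_between: "finite {k :: nat. a \<le> real k \<and> real k \<le> b}"
proof (rule finite_subset)
  show "{k :: nat. a \<le> real k \<and> real k \<le> b} \<subseteq> {..nat \<lfloor>b\<rfloor>}"
    by (auto simp: le_nat_floor)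
qed simp

text \<open>The condition \<open>a \<le> b + 1\<close> keeps the bound nonnegative, so that it also
  covers an empty range.\<close>

lemma card_nat_between:
  fixes a b :: real
  assumes "a \<le> b + 1"
  shows "real (card {k :: nat. a \<le> k \<and> k \<le> b}) \<le> b - a + 1"
proof (cases "b < 0")
  case True
  then have "{k :: nat. a \<le> k \<and> k \<le> b} = {}" by auto
  with assms show ?thesis by (simp only: card.empty)
next
  case False
  define a' where "a' = max a 0"
  have "{k :: nat. a \<le> k \<and> k \<le> b} = {k :: nat. a' \<le> k \<and> k \<le> b}" by (auto simp: a'_def)
  then have "card {k :: nat. a \<le> k \<and> k \<le> b} = card {\<lceil>a'\<rceil>..\<lfloor>b\<rfloor>}"
    using nat_between_image[of a' b] card_image[of int "{k :: nat. a' \<le> k \<and> k \<le> b}"]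
    by (simp add: a'_def)
  also have "\<dots> = nat (\<lfloor>b\<rfloor> - \<lceil>a'\<rceil> + 1)" by simp
  also have "real (nat (\<lfloor>b\<rfloor> - \<lceil>a'\<rceil> + 1)) \<le> b - a' + 1"
  proof (cases "0 \<le> \<lfloor>b\<rfloor> - \<lceil>a'\<rceil> + 1")
    case True
    then have "real (nat (\<lfloor>b\<rfloor> - \<lceil>a'\<rceil> + 1)) = of_int \<lfloor>b\<rfloor> - of_int \<lceil>a'\<rceil> + 1" by simp
    then show ?thesis by linarith
  next
    case c: False
    have "0 \<le> b - a' + 1" using assms False unfolding a'_def by linarith
    with c show ?thesis by simp
  qed
  finally show ?thesis unfolding a'_def by linarith
qed

lemma card_nat_between_ge:
  fixes a b :: real
  assumes "0 \<le> a"
  shows "b - a - 1 \<le> real (card {k :: nat. a \<le> k \<and> k \<le> b})"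
proof -
  have "card {k :: nat. a \<le> k \<and> k \<le> b} = card {\<lceil>a\<rceil>..\<lfloor>b\<rfloor>}"
    using nat_between_image[of a b] card_image[of int "{k :: nat. a \<le> k \<and> k \<le> b}"] assms by simp
  also have "\<dots> = nat (\<lfloor>b\<rfloor> - \<lceil>a\<rceil> + 1)" by simp
  also have "b - a - 1 \<le> real (nat (\<lfloor>b\<rfloor> - \<lceil>a\<rceil> + 1))" by linarith
  finally show ?thesis .
qed

text \<open>One tooth of length \<open>l\<close> sits in each of the \<open>M\<close> cells of
  length \<open>p\<close>. Upper bounds are stated with \<open>q\<close>, whereas
  \<open>emeasure_core_ge\<close> uses the true length \<open>l\<close>, in applications a fixed
  fraction of \<open>q\<close>.\<close>

locale comb =
  fixes u :: "nat \<Rightarrow> real" and M :: nat and p l q :: real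
  assumes M_pos: "0 < M" and p_eq: "p = 1 / M" and l_pos: "0 < l" and l_le: "l \<le> q" and q_le:
      "q \<le> p"
    and cell: "k < M \<Longrightarrow> k / M \<le> u k \<and> u k + l \<le> (k + 1) / M"
begin

lemma p_pos: "0 < p" and q_pos: "0 < q"
  using M_pos l_pos l_le by (auto simp: p_eq)

lemma p_mult_M: "p * M = 1"
  using M_pos by (simp add: p_eq)

text \<open>Counting: a tooth fattened by \<open>\<delta> \<le> 4 * p\<close> stays within
  \<open>\<delta>\<close> of its own cell, so at most \<open>10 * (t - s + p) / p\<close> of them
  meet \<open>{s..t}\<close>, and each contributes at most \<open>c\<close>.\<close>

lemma emeasure_fat_Int_le:
  assumes "s \<le> t" "0 \<le> \<delta>" "\<delta> \<le> 4 * p" "S \<in> sets borel" "0 \<le> c"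
    and c: "\<And>k. k < M \<Longrightarrow> emeasure lborel ({u k - \<delta>..u k + l + \<delta>} \<inter> S) \<le> ennreal c"
  shows "emeasure lborel ({s..t} \<inter> fat u M l \<delta> \<inter> S) \<le> ennreal (10 * (t - s + p) / p * c)"
proof -
  define I where "I = {k. k < M \<and> {u k - \<delta>..u k + l + \<delta>} \<inter> {s..t} \<noteq> {}}"
  have fin: "finite I" by (simp add: I_def)
  \<comment> \<open>A necessary condition for the cell of \<open>k\<close> to come within
    \<open>\<delta>\<close> of \<open>{s..t}\<close>; the additional \<open>p\<close> on the left is
    the length of the cell.\<close>
  define J where "J = {k :: nat. (s - \<delta> - p) * M \<le> k \<and> k \<le> (t + \<delta>) * M}"
  have "I \<subseteq> J"
  proof
    fix k assume "k \<in> I"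
    then have k: "k < M" "{u k - \<delta>..u k + l + \<delta>} \<inter> {s..t} \<noteq> {}" by (auto simp: I_def)
    then obtain x where "x \<in> {u k - \<delta>..u k + l + \<delta>} \<inter> {s..t}" by blast
    then have x: "u k - \<delta> \<le> x" "x \<le> u k + l + \<delta>" "s \<le> x" "x \<le> t" by auto
    then have "k / M \<le> t + \<delta>" "s - \<delta> \<le> (real k + 1) / M" using cell[OF k(1)] by linarith+
    then have "real k \<le> (t + \<delta>) * M" "(s - \<delta>) * M \<le> real k + 1"
      using M_pos by (simp_all add: pos_divide_le_eq pos_le_divide_eq)
    moreover have "(s - \<delta> - p) * M = (s - \<delta>) * M - 1"
      using p_mult_M by (simp add: left_diff_distrib)
    ultimately show "k \<in> J" by (simp add: J_def)
  qed
  moreover have le: "(s - \<delta> - p) * M \<le> (t + \<delta>) * M + 1"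
  proof -
    have "(s - \<delta> - p) * M \<le> (t + \<delta>) * M"
      using assms p_pos by (intro mult_right_mono) auto
    then show ?thesis by simp
  qed
  moreover have "finite J" unfolding J_def by (rule finite_nat_between)
  ultimately have "card I \<le> card J" by (intro card_mono)
  also have "real (card J) \<le> (t + \<delta>) * M - (s - \<delta> - p) * M + 1"
    unfolding J_def by (rule card_nat_between[OF le])
  also have "\<dots> = (t - s + 2 * \<delta>) * M + 2" using p_mult_M by (simp add: algebra_simps)
  also have "\<dots> \<le> (t - s + 8 * p) * M + 2" using assms(3)
      by (intro add_right_mono mult_right_mono) auto
  also have "\<dots> = (t - s) * M + 10" using p_mult_M by (simp add: distrib_right)
  also have "\<dots> \<le> 10 * ((t - s) * M + 1)" using assms(1) by (simp add: algebra_simps mult_right_mono)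
  also have "\<dots> = 10 * (t - s + p) / p" using M_pos by (simp add: p_eq field_simps)
  finally have card: "real (card I) \<le> 10 * (t - s + p) / p" by simp
  have "emeasure lborel ({s..t} \<inter> fat u M l \<delta> \<inter> S) \<le>
        emeasure lborel (\<Union>k\<in>I. {u k - \<delta>..u k + l + \<delta>} \<inter> S)"
    by (rule emeasure_mono) (use \<open>S \<in> sets borel\<close> fin in \<open>auto simp: fat_def I_def\<close>)
  also have "\<dots> \<le> (\<Sum>k\<in>I. emeasure lborel ({u k - \<delta>..u k + l + \<delta>} \<inter> S))"
    using fin \<open>S \<in> sets borel\<close> by (intro emeasure_subadditive_finite) auto
  also have "\<dots> \<le> (\<Sum>k\<in>I. ennreal c)"
    using c by (intro sum_mono) (auto simp: I_def)
  also have "\<dots> = ennreal (real (card I) * c)"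
    using \<open>0 \<le> c\<close> by (simp add: ennreal_mult ennreal_of_nat_eq_real_of_nat)
  also have "\<dots> \<le> ennreal (10 * (t - s + p) / p * c)"
    using card \<open>0 \<le> c\<close> by (intro ennreal_leI mult_right_mono)
  finally show ?thesis .
qed

text \<open>Up to constants, the length of the part of one cell within distance \<open>r\<close> of
  the teeth: that of a tooth for small \<open>r\<close>, the whole cell for large
  \<open>r\<close>.\<close>

abbreviation "v r \<equiv> min p (max r q)"

text \<open>For \<open>a \<le> p\<close> a fattened tooth has length at most
  \<open>l + 8 * a \<le> 9 * v a\<close>, which with the factor 10 of the count gives 90; for larger
  \<open>a\<close> the bound by \<open>t - s\<close> suffices, as \<open>v a = p\<close>.\<close>

lemma emeasure_fat_le:
  assumes "s \<le> t" "0 \<le> a"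
  shows "emeasure lborel ({s..t} \<inter> fat u M l (4 * a)) \<le> ennreal (90 * (t - s + p) * (v a / p))"
proof (cases "a \<le> p")
  case True
  have v: "v a = max a q" using True q_le by auto
  have *: "emeasure lborel ({u k - 4 * a..u k + l + 4 * a} \<inter> UNIV) \<le> ennreal (9 * v a)" for k
  proof -
    have "(u k + l + 4 * a) - (u k - 4 * a) \<le> 9 * v a" "u k - 4 * a \<le> u k + l + 4 * a"
      using l_pos l_le assms unfolding v by linarith+
    then show ?thesis by (simp only: Int_UNIV_right emeasure_lborel_Icc ennreal_leI)
  qed
  have "emeasure lborel ({s..t} \<inter> fat u M l (4 * a) \<inter> UNIV) \<le>
      ennreal (10 * (t - s + p) / p * (9 * v a))"
    by (rule emeasure_fat_Int_le[OF _ _ _ _ _ *]) (use assms True p_pos q_pos in auto)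
  also have "10 * (t - s + p) / p * (9 * v a) = 90 * (t - s + p) * (v a / p)"
    by (simp only: times_divide_eq_left times_divide_eq_right)
  finally show ?thesis by simp
next
  case False
  then have v: "v a = p" by auto
  have "emeasure lborel ({s..t} \<inter> fat u M l (4 * a)) \<le> emeasure lborel {s..t}"
    by (rule emeasure_mono) auto
  also have "\<dots> = ennreal (t - s)" using assms by simp
  also have "\<dots> \<le> ennreal (90 * (t - s + p) * (v a / p))"
    unfolding v using p_pos assms by (intro ennreal_leI) auto
  finally show ?thesis .
qed

text \<open>Quasi-independence in one coordinate. In each coarse tooth the fine comb has its
  expected share; the summand \<open>p' / p\<close> is the boundary error, since a coarse tooth
  shorter than a fine cell can still meet a whole fine tooth. The constant is
  \<open>10 * 9 * 90\<close>.\<close>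

lemma emeasure_fat_pair_le:
  assumes "comb u' M' p' l' q'" "M \<le> M'" "s \<le> t" "0 \<le> a" "0 \<le> a'"
  shows "emeasure lborel ({s..t} \<inter> fat u M l (4 * a) \<inter> fat u' M' l' (4 * a')) \<le>
    ennreal (8100 * (t - s + p) * (v a / p + p' / p) * (min p' (max a' q') / p'))"
proof -
  interpret f: comb u' M' p' l' q' by fact
  have pp: "p' \<le> p" using \<open>M \<le> M'\<close> M_pos by (simp add: p_eq f.p_eq field_simps)
  have z: "0 \<le> f.v a' / p'" using f.p_pos f.q_pos by (intro divide_nonneg_nonneg) auto
  have va: "0 \<le> v a" using p_pos q_pos by auto
  show ?thesis
  proof (cases "a \<le> p")
    case True
    have v: "v a = max a q" using True q_le by auto
    have *: "emeasure lborel ({u k - 4 * a..u k + l + 4 * a} \<inter> fat u' M' l' (4 * a')) \<le>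
        ennreal (810 * (v a + p') * (f.v a' / p'))" (is "_ \<le> ennreal ?c") for k
    proof -
      have "emeasure lborel ({u k - 4 * a..u k + l + 4 * a} \<inter> fat u' M' l' (4 * a')) \<le>
        ennreal (90 * ((u k + l + 4 * a) - (u k - 4 * a) + p') * (f.v a' / p'))"
        by (rule f.emeasure_fat_le) (use assms l_pos in auto)
      also have "\<dots> \<le> ennreal ?c"
      proof (rule ennreal_leI, rule mult_right_mono[OF _ z])
        have "l + 8 * a \<le> 9 * v a" using l_le assms unfolding v by linarith
        then have "(u k + l + 4 * a) - (u k - 4 * a) + p' \<le> 9 * v a + 9 * p'"
          using f.p_pos by linarith
        then have "(u k + l + 4 * a) - (u k - 4 * a) + p' \<le> 9 * (v a + p')"
          by (simp only: distrib_left)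
        from mult_left_mono[OF this, of 90]
        show "90 * ((u k + l + 4 * a) - (u k - 4 * a) + p') \<le> 810 * (v a + p')"
          by (simp only: mult.assoc[symmetric]) simp
      qed
      finally show ?thesis .
    qed
    have "emeasure lborel ({s..t} \<inter> fat u M l (4 * a) \<inter> fat u' M' l' (4 * a')) \<le>
        ennreal (10 * (t - s + p) / p * (810 * (v a + p') * (f.v a' / p')))"
    proof (rule emeasure_fat_Int_le[OF _ _ _ _ _ *])
      have "0 \<le> v a + p'" using va f.p_pos by simp
      then show "0 \<le> 810 * (v a + p') * (f.v a' / p')"
        using z by (intro mult_nonneg_nonneg) simp_all
    qed (use assms True in simp_all)
    also have "10 * (t - s + p) / p * (810 * (v a + p') * (f.v a' / p')) =
        8100 * (t - s + p) * (v a / p + p' / p) * (f.v a' / p')"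
    proof -
      have "10 * A / p * (810 * B * z) = 8100 * A * (B / p) * z" for A B z :: real by simp
      then show ?thesis by (simp only: add_divide_distrib[symmetric])
    qed
    finally show ?thesis .
  next
    case False
    then have v: "v a / p = 1" using p_pos by auto
    have "emeasure lborel ({s..t} \<inter> fat u M l (4 * a) \<inter> fat u' M' l' (4 * a')) \<le>
       emeasure lborel ({s..t} \<inter> fat u' M' l' (4 * a'))"
      by (rule emeasure_mono) auto
    also have "\<dots> \<le> ennreal (90 * (t - s + p') * (f.v a' / p'))"
      by (rule f.emeasure_fat_le) (use assms in auto)
    also have "\<dots> \<le> ennreal (8100 * (t - s + p) * (v a / p + p' / p) * (f.v a' / p'))"
    proof (rule ennreal_leI, rule mult_right_mono[OF _ z])
      have "90 * (t - s + p') \<le> 8100 * (t - s + p) * 1"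
      proof -
        have "90 * (t - s + p') \<le> 90 * (t - s + p)" using pp by simp
        also have "\<dots> \<le> 8100 * (t - s + p)" using assms(3) p_pos by (intro mult_right_mono) simp_all
        finally show ?thesis by simp
      qed
      also have "\<dots> \<le> 8100 * (t - s + p) * (v a / p + p' / p)"
        unfolding v using assms p_pos f.p_pos by (intro mult_left_mono) auto
      finally show "90 * (t - s + p') \<le> 8100 * (t - s + p) * (v a / p + p' / p)" .
    qed
    finally show ?thesis .
  qed
qed

text \<open>An interval spanning at least four cells contains at least half of the expected number
  of complete cells, and the core keeps half of each tooth; hence the factor 1/4.\<close>

lemma emeasure_core_ge:
  assumes "0 \<le> s" "t \<le> 1" "4 * p \<le> t - s"
  shows "ennreal ((t - s) * (l / p) / 4) \<le> emeasure lborel ({s..t} \<inter> fat u M l (- l / 4))"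
proof -
  \<comment> \<open>The \<open>- 1\<close> selects cells whose right end is still at most
    \<open>t\<close>.\<close>
  define J where "J = {k :: nat. s * M \<le> k \<and> k \<le> t * M - 1}"
  have kM: "k < M" if "k \<in> J" for k
  proof -
    have "t * M \<le> 1 * real M" using assms by (intro mult_right_mono) auto
    moreover have "real k \<le> t * M - 1" using that by (simp add: J_def)
    ultimately have "real k < real M" by linarith
    then show ?thesis by simp
  qed
  have fin: "finite J" using kM by (auto intro: finite_subset[of _ "{..<M}"])
  have sub: "k / M < x" "x < (real k + 1) / M" if "k \<in> J" "x \<in> {u k + l / 4..u k + 3 * l / 4}"
      for k x
    using cell[OF kM[OF that(1)]] that(2) l_pos by (simp_all only: atLeastAtMost_iff) linarith+
  have sub': "s \<le> k / M" "(real k + 1) / M \<le> t" if "k \<in> J" for k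
    using that M_pos by (simp_all add: J_def pos_le_divide_eq pos_divide_le_eq)
  have less: False if "j \<in> J" "k \<in> J" "j < k"
    "x \<in> {u j + l / 4..u j + 3 * l / 4}" "x \<in> {u k + l / 4..u k + 3 * l / 4}" for j k x
  proof -
    have "(real j + 1) / M \<le> k / M" using \<open>j < k\<close> by (intro divide_right_mono) auto
    with sub(2)[OF that(1,4)] sub(1)[OF that(2,5)] show False by linarith
  qed
  have disj: "disjoint_family_on (\<lambda>k. {u k + l / 4..u k + 3 * l / 4}) J"
    unfolding disjoint_family_on_def using less by (meson disjoint_iff linorder_neqE_nat)
  have "(t - s) * M / 2 \<le> t * M - 1 - s * M - 1"
  proof -
    have "4 * (p * M) \<le> (t - s) * M"
      using mult_right_mono[OF assms(3), of "real M"] by (simp add: mult.assoc)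
    then have "4 \<le> (t - s) * M" by (simp add: p_mult_M)
    moreover have "t * M - 1 - s * M - 1 = (t - s) * M - 2" by (simp add: left_diff_distrib)
    ultimately show ?thesis by linarith
  qed
  also have "\<dots> \<le> card J"
    unfolding J_def by (rule card_nat_between_ge) (use assms in auto)
  finally have card: "(t - s) * M / 2 \<le> card J" .
  have "(t - s) * (l / p) / 4 \<le> card J * (l / 2)"
    using mult_right_mono[OF card, of "l / 2"] l_pos M_pos by (simp add: p_eq field_simps)
  then have "ennreal ((t - s) * (l / p) / 4) \<le> ennreal (card J * (l / 2))" by (rule ennreal_leI)
  also have "\<dots> = (\<Sum>k\<in>J. emeasure lborel {u k + l / 4..u k + 3 * l / 4})"
  proof -
    have "emeasure lborel {u k + l / 4..u k + 3 * l / 4} = ennreal (l / 2)" for k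
      using l_pos by simp
    then show ?thesis
      using l_pos by (simp only: sum_constant ennreal_of_nat_eq_real_of_nat)
          (simp flip: ennreal_mult)
  qed
  also have "\<dots> = emeasure lborel (\<Union>k\<in>J. {u k + l / 4..u k + 3 * l / 4})"
    using fin disj by (intro sum_emeasure) auto
  also have "\<dots> \<le> emeasure lborel ({s..t} \<inter> fat u M l (- l / 4))"
  proof (rule emeasure_mono)
    show "(\<Union>k\<in>J. {u k + l / 4..u k + 3 * l / 4}) \<subseteq> {s..t} \<inter> fat u M l (- l / 4)"
    proof
      fix x assume "x \<in> (\<Union>k\<in>J. {u k + l / 4..u k + 3 * l / 4})"
      then obtain k where k: "k \<in> J" "x \<in> {u k + l / 4..u k + 3 * l / 4}" by blast
      have "x \<in> {s..t}" using sub[OF k] sub'[OF k(1)] by (simp only: atLeastAtMost_iff) linarith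
      moreover have "u k - (- l / 4) \<le> x" "x \<le> u k + l + (- l / 4)"
        using k(2) by (simp_all only: atLeastAtMost_iff) linarith+
      then have "x \<in> fat u M l (- l / 4)" using kM[OF k(1)] unfolding fat_def by force
      ultimately show "x \<in> {s..t} \<inter> fat u M l (- l / 4)" by simp
    qed
  qed simp
  finally show ?thesis .
qed

text \<open>The better of the trivial bound \<open>2 * r\<close> and \<open>emeasure_fat_le\<close>,
  in the regimes \<open>r \<le> q\<close>, \<open>q < r \<le> p\<close> and \<open>p < r\<close>; in
  the last two, \<open>2 * r + p\<close> is at most three times the larger of \<open>r\<close> and
  \<open>p\<close>, whence \<open>270 = 3 * 90\<close>.\<close>

lemma emeasure_fat_ball_le:
  assumes "0 < r"
  shows "emeasure lborel ({x - r..x + r} \<inter> fat u M l 0) \<le> ennreal (270 * r * (q / v r))"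
proof -
  have 1: "emeasure lborel ({x - r..x + r} \<inter> fat u M l 0) \<le> ennreal (90 * (2 * r + p) * (q / p))"
  proof -
    have eq: "v 0 = q" "x + r - (x - r) = 2 * r" "4 * 0 = (0 :: real)" using q_pos q_le by simp_all
    have "x - r \<le> x + r" using assms by simp
    from emeasure_fat_le[OF this order_refl] show ?thesis unfolding eq .
  qed
  have 2: "emeasure lborel ({x - r..x + r} \<inter> fat u M l 0) \<le> ennreal (2 * r)"
  proof -
    have "emeasure lborel ({x - r..x + r} \<inter> fat u M l 0) \<le> emeasure lborel {x - r..x + r}"
      by (rule emeasure_mono) auto
    then show ?thesis using assms by simp
  qed
  define z where "z = q / p"
  have z: "0 \<le> z" using p_pos q_pos by (simp add: z_def)
  have mono: "c * z \<le> c' * z" if "c \<le> c'" for c c' by (rule mult_right_mono[OF that z])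
  consider "r \<le> q" | "q < r" "r \<le> p" | "p < r" by linarith
  then show ?thesis
  proof cases
    case 1
    then have v: "v r = q" using q_le by simp
    have "2 * r \<le> 270 * r * (q / v r)" unfolding v using q_pos assms by simp
    then show ?thesis by (rule order_trans[OF 2 ennreal_leI])
  next
    case 2
    then have v: "v r = r" by simp
    have "90 * (2 * r + p) * z \<le> 270 * p * z" using \<open>r \<le> p\<close> by (intro mono) simp
    also have "\<dots> = 270 * r * (q / v r)" unfolding v z_def using assms p_pos by simp
    finally show ?thesis unfolding z_def by (rule order_trans[OF 1 ennreal_leI])
  next
    case 3
    then have v: "v r = p" by simp
    have "90 * (2 * r + p) * z \<le> 270 * r * z" using \<open>p < r\<close> by (intro mono) simp
    then show ?thesis unfolding v z_def by (rule order_trans[OF 1 ennreal_leI])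
  qed
qed

end

section \<open>Products of combs\<close>

lemma prod_mono_ennreal:
  fixes g h :: "'a \<Rightarrow> ennreal"
  assumes "\<And>i. i \<in> A \<Longrightarrow> g i \<le> h i"
  shows "(\<Prod>i\<in>A. g i) \<le> (\<Prod>i\<in>A. h i)"
proof (cases "finite A")
  case True
  then show ?thesis using assms by (induction A rule: finite_induct) (auto intro!: mult_mono)
qed simp

text \<open>Multiplying out, every term other than the product of the \<open>x i\<close> contains a
  factor \<open>y i \<le> Y\<close>, and there are \<open>2 ^ card A - 1\<close> such terms.\<close>

lemma prod_add_le:
  fixes x y :: "'a \<Rightarrow> real"
  assumes "finite A" "\<And>i. i \<in> A \<Longrightarrow> 0 \<le> x i \<and> x i \<le> 1" "\<And>i. i \<in> A \<Longrightarrow> 0 \<le> y i \<and> y i \<le> Y" "Y \<le> 1" "0 \<le> Y"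
  shows "(\<Prod>i\<in>A. x i + y i) \<le> (\<Prod>i\<in>A. x i) + (2 ^ card A - 1) * Y"
  using assms(1-3)
proof (induction rule: finite_induct)
  case empty
  then show ?case by simp
next
  case (insert j A)
  let ?P = "\<Prod>i\<in>A. x i" and ?k = "(2 ^ card A - 1) * Y"
  have x: "0 \<le> x j" "x j \<le> 1" and y: "0 \<le> y j" "y j \<le> Y" using insert.prems by auto
  have P: "0 \<le> ?P" "?P \<le> 1" using insert.prems by (auto intro!: prod_nonneg prod_le_1)
  have k: "0 \<le> ?k" using \<open>0 \<le> Y\<close> by (intro mult_nonneg_nonneg) auto
  have "(\<Prod>i\<in>insert j A. x i + y i) = (x j + y j) * (\<Prod>i\<in>A. x i + y i)"
    using insert.hyps by simp
  also have "\<dots> \<le> (x j + y j) * (?P + ?k)"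
    using insert x y by (intro mult_left_mono) auto
  also have "\<dots> = x j * ?P + (x j * ?k + y j * ?P + y j * ?k)" by (simp add: algebra_simps)
  also have "\<dots> \<le> x j * ?P + (1 * ?k + Y * 1 + 1 * ?k)"
    using x y P k \<open>Y \<le> 1\<close> \<open>0 \<le> Y\<close> by (intro add_mono mult_mono) auto
  also have "1 * ?k + Y * 1 + 1 * ?k = (2 ^ card (insert j A) - 1) * Y"
    using insert.hyps by (simp add: algebra_simps)
  finally show ?case using insert.hyps by simp
qed

text \<open>In the cell with index \<open>k\<close>, the \<open>i\<close>-th coordinate of the target of level \<open>n\<close> is confined to an
  interval with left endpoint \<open>u i n k\<close> and length \<open>c * q i n\<close>. The factor \<open>c\<close> makes room for the
  Lipschitz constant. Nothing is known about level \<open>0\<close>, where \<open>\<psi>\<close> is unrestricted.\<close>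

locale comb_system =
  fixes u :: "'n :: finite \<Rightarrow> nat \<Rightarrow> nat \<Rightarrow> real" and M :: "'n \<Rightarrow> nat \<Rightarrow> nat"
    and p q :: "'n \<Rightarrow> nat \<Rightarrow> real" and c :: real
  assumes comb: "1 \<le> n \<Longrightarrow> comb (u i n) (M i n) (p i n) (c * q i n) (q i n)"
    and refine: "1 \<le> m \<Longrightarrow> m \<le> n \<Longrightarrow> p i n \<le> p i m / 2 ^ (n - m)"
begin

definition fatten :: "nat \<Rightarrow> real \<Rightarrow> (real ^ 'n) set" where
  "fatten n \<delta> = box_product (\<lambda>i. fat (u i n) (M i n) (c * q i n) \<delta>)"

text \<open>\<open>fatten\<close> takes one \<open>\<delta>\<close> for all coordinates, whereas the
  cores shrink by an amount that depends on the coordinate.\<close>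

definition core :: "nat \<Rightarrow> (real ^ 'n) set" where
  "core n = box_product (\<lambda>i. fat (u i n) (M i n) (c * q i n) (- (c * q i n) / 4))"

text \<open>Up to constants, the measure of the \<open>r\<close>-neighbourhood of the target inside
  one cell; \<open>proportion\<close> is its share of the cell.\<close>

definition volume :: "nat \<Rightarrow> real \<Rightarrow> real" where
  "volume n r = (\<Prod>i\<in>UNIV. min (p i n) (max r (q i n)))"

definition proportion :: "nat \<Rightarrow> real \<Rightarrow> real" where
  "proportion n r = (\<Prod>i\<in>UNIV. min (p i n) (max r (q i n)) / p i n)"

text \<open>The height of a uniform density that gives mass \<open>volume n r\<close> to a box with
  sides \<open>q i n\<close>.\<close>

definition weight :: "nat \<Rightarrow> real \<Rightarrow> real" where
  "weight n r = volume n r / (\<Prod>i\<in>UNIV. q i n)"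

abbreviation "target n \<equiv> fatten n 0"

lemma p_pos: "1 \<le> n \<Longrightarrow> 0 < p i n" and q_pos: "1 \<le> n \<Longrightarrow> 0 < q i n" and q_le: "1 \<le> n \<Longrightarrow> q i n \<le> p i n"
  using comb.p_pos[OF comb] comb.q_pos[OF comb] comb.q_le[OF comb] by blast+

lemma cq_pos: "1 \<le> n \<Longrightarrow> 0 < c * q i n" using comb.l_pos[OF comb] .

lemma c_pos: "0 < c"
  using cq_pos[of 1 undefined] q_pos[of 1 undefined] by (simp add: zero_less_mult_iff)

lemma fatten_sets [measurable, simp]: "fatten n \<delta> \<in> sets borel"
  and core_sets [measurable, simp]: "core n \<in> sets borel"
  by (simp_all add: fatten_def core_def)

lemma closed_fatten [simp]: "closed (fatten n \<delta>)"
  by (simp add: fatten_def closed_box_product)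

lemma fatten_mono: "\<delta> \<le> \<delta>' \<Longrightarrow> fatten n \<delta> \<subseteq> fatten n \<delta>'"
  unfolding fatten_def using fat_mono by fastforce

lemma core_subset: "1 \<le> n \<Longrightarrow> core n \<subseteq> target n"
  unfolding fatten_def core_def
  using fat_mono[of "- (c * q _ n) / 4" 0] cq_pos[of n] by (fastforce simp: less_imp_le)

lemma fatten_shift:
  assumes "x \<in> fatten n \<delta>" "y \<in> max_cball x \<epsilon>"
  shows "y \<in> fatten n (\<delta> + \<epsilon>)"
  using assms fat_shift unfolding fatten_def mem_max_cball by fastforce

lemma volume_pos: "1 \<le> n \<Longrightarrow> 0 < volume n r"
  unfolding volume_def using p_pos q_pos by (intro prod_pos) (simp add: less_max_iff_disj)

lemma proportion_eq: "proportion n r = volume n r / (\<Prod>i\<in>UNIV. p i n)"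
  by (simp add: proportion_def volume_def prod_dividef)

lemma proportion_bounds: "1 \<le> n \<Longrightarrow> 0 < proportion n r" "1 \<le> n \<Longrightarrow> proportion n r \<le> 1"
  unfolding proportion_def using p_pos q_pos
  by (auto intro!: prod_pos prod_le_1 divide_pos_pos simp: less_max_iff_disj less_imp_le
      le_max_iff_disj)

lemma weight_pos: "1 \<le> n \<Longrightarrow> 0 < weight n r"
  unfolding weight_def using volume_pos q_pos by (intro divide_pos_pos prod_pos) auto

lemma emeasure_target_ball_le:
  assumes "1 \<le> n" "0 < r"
  shows "emeasure lborel (max_cball x r \<inter> target n) \<le>
    ennreal (270 ^ CARD('n) * r ^ CARD('n) * ((\<Prod>i\<in>UNIV. q i n) / volume n r))"
proof -
  let ?v = "\<lambda>i. min (p i n) (max r (q i n))"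
  have v: "0 < ?v i" for i using p_pos q_pos assms by (simp add: less_max_iff_disj)
  have eq: "max_cball x r \<inter> target n =
      box_product (\<lambda>i. {x $ i - r..x $ i + r} \<inter> fat (u i n) (M i n) (c * q i n) 0)"
    unfolding max_cball_eq fatten_def by auto
  have "emeasure lborel (max_cball x r \<inter> target n) =
      (\<Prod>i\<in>UNIV. emeasure lborel ({x $ i - r..x $ i + r} \<inter> fat (u i n) (M i n) (c * q i n) 0))"
    unfolding eq by (rule emeasure_box_product) simp
  also have "\<dots> \<le> (\<Prod>i\<in>UNIV. ennreal (270 * r * (q i n / ?v i)))"
    by (intro prod_mono_ennreal comb.emeasure_fat_ball_le[OF comb] assms)
  also have "\<dots> = ennreal (\<Prod>i\<in>UNIV. 270 * r * (q i n / ?v i))"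
    using assms q_pos[OF assms(1)] v
    by (intro prod_ennreal mult_nonneg_nonneg divide_nonneg_nonneg) (simp_all add: less_imp_le)
  also have "(\<Prod>i\<in>UNIV. 270 * r * (q i n / ?v i)) =
      270 ^ CARD('n) * r ^ CARD('n) * ((\<Prod>i\<in>UNIV. q i n) / volume n r)"
    unfolding volume_def by (simp only: prod.distrib prod_dividef prod_constant)
  finally show ?thesis .
qed

lemma emeasure_core_cube_ge:
  assumes "1 \<le> n" "\<And>i. 0 \<le> s i" "\<And>i. s i + \<delta> \<le> 1" "\<And>i. 4 * p i n \<le> \<delta>"
  shows "ennreal ((c * \<delta> / 4) ^ CARD('n) * (\<Prod>i\<in>UNIV. q i n / p i n)) \<le>
    emeasure lborel (box_product (\<lambda>i. {s i..s i + \<delta>}) \<inter> core n)"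
proof -
  have \<delta>: "0 < \<delta>" using assms(4)[of undefined] p_pos[OF assms(1), of undefined] by simp
  have eq: "box_product (\<lambda>i. {s i..s i + \<delta>}) \<inter> core n =
      box_product (\<lambda>i. {s i..s i + \<delta>} \<inter> fat (u i n) (M i n) (c * q i n) (- (c * q i n) / 4))"
    unfolding core_def by auto
  have "(c * \<delta> / 4) ^ CARD('n) * (\<Prod>i\<in>UNIV. q i n / p i n) =
      (\<Prod>i\<in>UNIV. (s i + \<delta> - s i) * (c * q i n / p i n) / 4)"
    by (simp add: prod.distrib prod_dividef power_divide power_mult_distrib mult_ac)
  also have "ennreal \<dots> = (\<Prod>i\<in>UNIV. ennreal ((s i + \<delta> - s i) * (c * q i n / p i n) / 4))"
    using \<delta> cq_pos[OF assms(1)] p_pos[OF assms(1)]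
        by (intro prod_ennreal[symmetric]) (simp add: less_imp_le)
  also have "\<dots> \<le> (\<Prod>i\<in>UNIV. emeasure lborel ({s i..s i + \<delta>} \<inter> fat (u i n) (M i n) (c *
      q i n) (- (c * q i n) / 4)))"
    by (intro prod_mono_ennreal comb.emeasure_core_ge[OF comb]) (use assms in simp_all)
  also have "\<dots> = emeasure lborel (box_product (\<lambda>i. {s i..s i + \<delta>}) \<inter> core n)"
    unfolding eq by (rule emeasure_box_product[symmetric]) simp
  finally show ?thesis .
qed

text \<open>The product of the bounds \<open>emeasure_fat_pair_le\<close>. By \<open>refine\<close>
  the boundary errors are at most \<open>1 / 2 ^ (n - m)\<close>, and \<open>prod_add_le\<close>
  collects them into one error that decays exponentially in the gap. The condition
  \<open>p i m \<le> \<delta>\<close> doubles 8100 to 16200.\<close>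

lemma emeasure_pair_le:
  assumes "1 \<le> m" "m \<le> n" "0 \<le> a" "0 \<le> a'" "\<And>i. p i m \<le> \<delta>"
  shows "emeasure lborel (box_product (\<lambda>i. {s i..s i + \<delta>}) \<inter> fatten m (4 * a) \<inter> fatten n (4 * a')) \<le>
    ennreal ((16200 * \<delta>) ^ CARD('n) *
        ((proportion m a + 2 ^ CARD('n) / 2 ^ (n - m)) * proportion n a'))"
proof -
  have n: "1 \<le> n" using assms by simp
  have \<delta>: "0 < \<delta>" using assms(5)[of undefined] p_pos[OF assms(1), of undefined] by simp
  let ?x = "\<lambda>i. min (p i m) (max a (q i m)) / p i m" and ?y = "\<lambda>i. p i n / p i m"
    and ?z = "\<lambda>i. min (p i n) (max a' (q i n)) / p i n"
  have x: "0 \<le> ?x i" "?x i \<le> 1" for i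
    using p_pos[OF assms(1)] q_pos[OF assms(1)] by (auto simp: less_imp_le le_max_iff_disj)
  have z: "0 \<le> ?z i" for i
    using p_pos[OF n] q_pos[OF n] by (auto simp: less_imp_le le_max_iff_disj)
  have y: "0 \<le> ?y i" "?y i \<le> 1 / 2 ^ (n - m)" for i
    using p_pos[OF n, of i] p_pos[OF assms(1), of i] refine[OF assms(1,2), of i]
    by (auto simp: less_imp_le divide_simps mult_ac)
  have M: "M i m \<le> M i n" for i
  proof -
    have "p i m / 2 ^ (n - m) \<le> p i m / 1"
      using p_pos[OF assms(1), of i] by (intro divide_left_mono) (simp_all add: less_imp_le)
    with refine[OF assms(1,2), of i] have "p i n \<le> p i m" by simp
    then show ?thesis
      using comb.p_eq[OF comb[OF n]] comb.p_eq[OF comb[OF assms(1)]]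
        comb.M_pos[OF comb[OF n]] comb.M_pos[OF comb[OF assms(1)]] by (simp add: field_simps)
  qed
  have eq: "box_product (\<lambda>i. {s i..s i + \<delta>}) \<inter> fatten m (4 * a) \<inter> fatten n (4 * a') =
      box_product (\<lambda>i. {s i..s i + \<delta>} \<inter> fat (u i m) (M i m) (c * q i m) (4 * a) \<inter> fat (u i n)
          (M i n) (c * q i n) (4 * a'))"
    unfolding fatten_def by auto
  have "emeasure lborel (box_product (\<lambda>i. {s i..s i + \<delta>}) \<inter> fatten m (4 * a) \<inter> fatten n (4 * a')) =
      (\<Prod>i\<in>UNIV. emeasure lborel
          ({s i..s i + \<delta>} \<inter> fat (u i m) (M i m) (c * q i m) (4 * a) \<inter> fat (u i n) (M i n)
          (c * q i n) (4 * a')))"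
    unfolding eq by (rule emeasure_box_product) simp
  also have "\<dots> \<le> (\<Prod>i\<in>UNIV. ennreal (16200 * \<delta> * (?x i + ?y i) * ?z i))"
  proof (rule prod_mono_ennreal)
    fix i :: 'n
    have "emeasure lborel ({s i..s i + \<delta>} \<inter> fat (u i m) (M i m) (c * q i m) (4 *
        a) \<inter> fat (u i n) (M i n) (c * q i n) (4 * a'))
      \<le> ennreal (8100 * (s i + \<delta> - s i + p i m) * (?x i + ?y i) * ?z i)"
      by (rule comb.emeasure_fat_pair_le[OF comb comb]) (use assms n M \<delta> in auto)
    also have "\<dots> \<le> ennreal (16200 * \<delta> * (?x i + ?y i) * ?z i)"
    proof (intro ennreal_leI mult_right_mono add_nonneg_nonneg x y z)
      show "8100 * (s i + \<delta> - s i + p i m) \<le> 16200 * \<delta>" using assms(5)[of i] by simp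
    qed
    finally show "emeasure lborel ({s i..s i + \<delta>} \<inter> fat (u i m) (M i m) (c * q i m) (4 *
        a) \<inter> fat (u i n) (M i n) (c * q i n) (4 * a'))
      \<le> ennreal (16200 * \<delta> * (?x i + ?y i) * ?z i)" .
  qed
  also have "\<dots> = ennreal (\<Prod>i\<in>UNIV. 16200 * \<delta> * (?x i + ?y i) * ?z i)"
    using \<delta> by (intro prod_ennreal mult_nonneg_nonneg add_nonneg_nonneg x y z)
        (simp_all add: less_imp_le)
  also have "(\<Prod>i\<in>UNIV. 16200 * \<delta> * (?x i + ?y i) * ?z i) =
      (16200 * \<delta>) ^ CARD('n) * ((\<Prod>i\<in>UNIV. ?x i + ?y i) * proportion n a')"
    unfolding proportion_def by
        (simp only: prod.distrib prod_constant mult.assoc power_mult_distrib)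
  also have "ennreal \<dots> \<le> ennreal ((16200 * \<delta>) ^ CARD('n) *
      ((proportion m a + 2 ^ CARD('n) / 2 ^ (n - m)) * proportion n a'))"
  proof (intro ennreal_leI mult_left_mono mult_right_mono)
    have "(\<Prod>i\<in>UNIV. ?x i + ?y i) \<le> (\<Prod>i\<in>UNIV. ?x i) + (2 ^ CARD('n) - 1) * (1 / 2 ^ (n - m))"
      by (rule prod_add_le) (use x y in auto)
    also have "\<dots> \<le> proportion m a + 2 ^ CARD('n) / 2 ^ (n - m)"
      unfolding proportion_def by (simp add: divide_right_mono)
    finally show "(\<Prod>i\<in>UNIV. ?x i + ?y i) \<le> proportion m a + 2 ^ CARD('n) / 2 ^ (n - m)" .
    show "0 \<le> proportion n a'" using proportion_bounds[OF n] by (simp add: less_imp_le)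
    show "0 \<le> (16200 * \<delta>) ^ CARD('n)" using \<delta> by simp
  qed
  finally show ?thesis .
qed

end

section \<open>Averaging, and sums over well-separated levels\<close>

lemma nn_integral_average_div:
  fixes g :: "real ^ 'n \<Rightarrow> ennreal"
  assumes [measurable]: "g \<in> borel_measurable borel" and "0 < a"
  shows "(\<integral>\<^sup>+z. g z \<partial>lborel) =
         (\<integral>\<^sup>+y. (\<integral>\<^sup>+z. g z * indicator (max_cball y a) z \<partial>lborel) / ennreal ((2 * a) ^ CARD('n))
             \<partial>lborel)"
proof -
  have m: "(\<lambda>(y, z). g z * indicator (max_cball y a) z) \<in> borel_measurable (lborel \<Otimes>\<^sub>M lborel)"
    using max_cball_measurable_pair[of a]
        by (simp add: split_beta' borel_prod[symmetric] cong: measurable_cong_sets)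
  have [measurable]: "(\<lambda>y. \<integral>\<^sup>+z. g z *
      indicator (max_cball y a) z \<partial>lborel) \<in> borel_measurable lborel"
    using lborel.borel_measurable_nn_integral_fst[OF m] by simp
  have "(\<integral>\<^sup>+y. (\<integral>\<^sup>+z. g z * indicator (max_cball y a) z \<partial>lborel) / ennreal ((2 * a) ^ CARD('n))
      \<partial>lborel) =
     (\<integral>\<^sup>+y. \<integral>\<^sup>+z. g z * indicator (max_cball y a) z \<partial>lborel \<partial>lborel) / ennreal ((2 * a) ^ CARD('n))"
    by (rule nn_integral_divide) simp
  also have "\<dots> = (\<integral>\<^sup>+z. g z \<partial>lborel) * ennreal ((2 * a) ^ CARD('n)) / ennreal ((2 * a) ^ CARD('n))"
    using nn_integral_average[OF assms] by simp
  also have "\<dots> = (\<integral>\<^sup>+z. g z \<partial>lborel)"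
    using \<open>0 < a\<close> by (intro ennreal_mult_divide_eq) auto
  finally show ?thesis by simp
qed

lemma sum_at_most_one_le:
  fixes g :: "'a \<Rightarrow> ennreal"
  assumes "finite I" "\<And>m. m \<in> I \<Longrightarrow> g m \<le> b" "\<And>m n. m \<in> I \<Longrightarrow> n \<in> I \<Longrightarrow> m \<noteq> n \<Longrightarrow> g m = 0 \<or> g n = 0"
  shows "sum g I \<le> b"
proof (cases "\<exists>m\<in>I. g m \<noteq> 0")
  case True
  then obtain m where m: "m \<in> I" "g m \<noteq> 0" by blast
  have "sum g I = g m + sum g (I - {m})" using assms(1) m(1) by (rule sum.remove)
  also have "sum g (I - {m}) = 0" using assms(3)[OF m(1)] m(2) by (intro sum.neutral) blast
  finally show ?thesis using assms(2)[OF m(1)] by simp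
qed (simp add: sum.neutral)

lemma sum_split_lt_gt:
  fixes I :: "nat set" and g :: "nat \<Rightarrow> real"
  assumes "finite I"
  shows "sum g (I - {m}) = sum g {n \<in> I. n < m} + sum g {n \<in> I. m < n}"
proof -
  have "I - {m} = {n \<in> I. n < m} \<union> {n \<in> I. m < n}" by auto
  moreover have "{n \<in> I. n < m} \<inter> {n \<in> I. m < n} = {}" by auto
  moreover have "finite {n \<in> I. n < m}" "finite {n \<in> I. m < n}" using assms by auto
  ultimately show ?thesis by (simp only: sum.union_disjoint)
qed

lemma sum_half_power_le: "finite K \<Longrightarrow> 0 \<notin> K \<Longrightarrow> (\<Sum>k\<in>K. (1 / 2 :: real) ^ k) \<le> 1"
proof -
  assume K: "finite K" "0 \<notin> K"
  then have "K \<subseteq> {1..Max (insert 0 K)}"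
      by (metis (no_types, lifting) Max_ge One_nat_def Suc_leI atLeastAtMost_iff finite_insert gr0I
      insertCI subsetI)
  then have "(\<Sum>k\<in>K. (1 / 2 :: real) ^ k) \<le> (\<Sum>k\<in>{1..Max (insert 0 K)}. (1 / 2) ^ k)"
    by (intro sum_mono2) auto
  also have "(\<Sum>k\<in>{1..n}. (1 / 2 :: real) ^ k) \<le> 1 - (1 / 2) ^ n" for n
    by (induction n) auto
  then have "(\<Sum>k\<in>{1..Max (insert 0 K)}. (1 / 2 :: real) ^ k) \<le> 1"
    by (rule order_trans) simp
  finally show ?thesis .
qed

text \<open>Within a residue class modulo \<open>G\<close> the distance to \<open>m\<close>, which
  is \<open>max n m - min n m\<close>, is \<open>G\<close> times a positive integer, taken at most
  once on each side. Hence each side is dominated by a geometric series of sum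
  \<open>2 / 2 ^ G\<close>.\<close>

lemma sum_gaps_le:
  fixes I :: "nat set"
  assumes "finite I" "\<And>n. n \<in> I \<Longrightarrow> n mod G = \<rho>" "m \<in> I" "0 < G"
  shows "(\<Sum>n\<in>I - {m}. 1 / 2 ^ (max n m - min n m)) \<le> (4 / 2 ^ G :: real)"
proof -
  \<comment> \<open>Trades \<open>1 / 2 ^ (G * (k + 1))\<close> for
    \<open>1 / 2 ^ G * 1 / 2 ^ k\<close>, which can be summed over distinct
    \<open>k\<close>.\<close>
  have gap: "G + k \<le> G * Suc k" for k using \<open>0 < G\<close> by (cases G) auto
  have aux: "(\<Sum>n\<in>J. 1 / 2 ^ (max n m - min n m)) \<le> (2 / 2 ^ G :: real)"
    if J: "J \<subseteq> I" "\<And>n. n \<in> J \<Longrightarrow> max n m - min n m = G * \<phi> n" "\<And>n. n \<in> J \<Longrightarrow> 0 < \<phi> n" "inj_on \<phi> J"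
        for J \<phi>
  proof -
    have finJ: "finite J" using J(1) assms(1) by (rule finite_subset)
    have J0: "0 \<notin> \<phi> ` J" using J(3) by (metis imageE less_irrefl)
    have "(\<Sum>n\<in>J. 1 / 2 ^ (max n m - min n m)) \<le> (\<Sum>n\<in>J. 2 / 2 ^ G * (1 / 2 :: real) ^ \<phi> n)"
    proof (rule sum_mono)
      fix n assume n: "n \<in> J"
      then obtain k where k: "\<phi> n = Suc k" using J(3) gr0_implies_Suc by blast
      have "(1 / 2 :: real) ^ (G * Suc k) \<le> (1 / 2) ^ (G + k)"
        by (rule power_decreasing[OF gap]) auto
      also have "\<dots> = 2 / 2 ^ G * (1 / 2 :: real) ^ \<phi> n"
        unfolding k by (simp add: power_add power_divide)
      finally show "1 / 2 ^ (max n m - min n m) \<le> 2 / 2 ^ G * (1 / 2 :: real) ^ \<phi> n"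
        unfolding J(2)[OF n] k by (simp only: power_one_over)
    qed
    also have "\<dots> = 2 / 2 ^ G * (\<Sum>k\<in>\<phi> ` J. (1 / 2 :: real) ^ k)"
      by (simp only: sum.reindex[OF J(4)] sum_distrib_left o_def)
    also have "2 / 2 ^ G * (\<Sum>k\<in>\<phi> ` J. (1 / 2 :: real) ^ k) \<le> 2 / 2 ^ G * 1"
      using finJ J0 by (intro mult_left_mono sum_half_power_le) simp_all
    finally show ?thesis by simp
  qed
  have dm: "G * (n div G) + \<rho> = n" if "n \<in> I" for n
    using assms(2)[OF that] mult_div_mod_eq[of G n] by simp
  have lt: "(\<Sum>n\<in>{n \<in> I. n < m}. 1 / 2 ^ (max n m - min n m)) \<le> (2 / 2 ^ G :: real)"
  proof (rule aux[where \<phi> = "\<lambda>n. m div G - n div G"])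
    fix n assume n: "n \<in> {n \<in> I. n < m}"
    then have "n \<in> I" "n < m" by auto
    have "G * (n div G) < G * (m div G)" using dm[OF \<open>n \<in> I\<close>] dm[OF assms(3)] \<open>n < m\<close> by linarith
    then show "0 < m div G - n div G" by simp
    have "max n m - min n m = G * (m div G) - G * (n div G)"
      using dm[OF \<open>n \<in> I\<close>] dm[OF assms(3)] \<open>n < m\<close> by linarith
    then show "max n m - min n m = G * (m div G - n div G)"
      by (simp only: diff_mult_distrib2)
  next
    show "inj_on (\<lambda>n. m div G - n div G) {n \<in> I. n < m}"
    proof (rule inj_onI)
      fix n n' assume n: "n \<in> {n \<in> I. n < m}" "n' \<in> {n \<in> I. n < m}" and eq:
          "m div G - n div G = m div G - n' div G"
      have "n div G \<le> m div G" "n' div G \<le> m div G" using n by (auto intro: div_le_mono)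
      with eq have "n div G = n' div G" by simp
      then show "n = n'" using dm[of n] dm[of n'] n by (metis (no_types, lifting) mem_Collect_eq)
    qed
  qed auto
  have gt: "(\<Sum>n\<in>{n \<in> I. m < n}. 1 / 2 ^ (max n m - min n m)) \<le> (2 / 2 ^ G :: real)"
  proof (rule aux[where \<phi> = "\<lambda>n. n div G - m div G"])
    fix n assume n: "n \<in> {n \<in> I. m < n}"
    then have "n \<in> I" "m < n" by auto
    have "G * (m div G) < G * (n div G)" using dm[OF \<open>n \<in> I\<close>] dm[OF assms(3)] \<open>m < n\<close> by linarith
    then show "0 < n div G - m div G" by simp
    have "max n m - min n m = G * (n div G) - G * (m div G)"
      using dm[OF \<open>n \<in> I\<close>] dm[OF assms(3)] \<open>m < n\<close> by linarith
    then show "max n m - min n m = G * (n div G - m div G)"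
      by (simp only: diff_mult_distrib2)
  next
    show "inj_on (\<lambda>n. n div G - m div G) {n \<in> I. m < n}"
    proof (rule inj_onI)
      fix n n' assume n: "n \<in> {n \<in> I. m < n}" "n' \<in> {n \<in> I. m < n}" and eq:
          "n div G - m div G = n' div G - m div G"
      have "m div G \<le> n div G" "m div G \<le> n' div G" using n by (auto intro: div_le_mono)
      with eq have "n div G = n' div G" by simp
      then show "n = n'" using dm[of n] dm[of n'] n by (metis (no_types, lifting) mem_Collect_eq)
    qed
  qed auto
  from lt gt show ?thesis unfolding sum_split_lt_gt[OF assms(1)] by simp
qed

text \<open>Omitting one index in the upper bound accounts for single terms that exceed \<open>\<kappa>\<close> by far.\<close>

lemma nonsummable_residue_class:
  fixes b :: "nat \<Rightarrow> real"
  assumes "\<not> summable b" "\<And>n. 0 \<le> b n" "0 < G" "0 < \<kappa>"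
  obtains I \<rho> where "finite I" "\<And>n. n \<in> I \<Longrightarrow> N \<le> n \<and> n mod G = \<rho>" "\<kappa> \<le> sum b I"
    "\<And>m. m \<in> I \<Longrightarrow> sum b (I - {m}) \<le> 2 * \<kappa>"
proof -
  define b' where "b' \<rho> n = (if N \<le> n \<and> n mod G = \<rho> then b n else 0)" for \<rho> n
  \<comment> \<open>Otherwise \<open>b\<close> would, from \<open>N\<close> on, be a finite sum of
    summable sequences.\<close>
  have "\<exists>\<rho><G. \<not> summable (b' \<rho>)"
  proof (rule ccontr)
    assume "\<not> (\<exists>\<rho><G. \<not> summable (b' \<rho>))"
    then have "summable (\<lambda>n. \<Sum>\<rho><G. b' \<rho> n)" by (intro summable_sum) auto
    moreover have "(\<Sum>\<rho><G. b' \<rho> n) = b n" if "N \<le> n" for n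
    proof -
      have "(\<Sum>\<rho><G. b' \<rho> n) = (\<Sum>\<rho><G. if \<rho> = n mod G then b n else 0)"
        using that by (intro sum.cong) (auto simp: b'_def)
      also have "\<dots> = b n" using \<open>0 < G\<close> by simp
      finally show ?thesis .
    qed
    then have "eventually (\<lambda>n. (\<Sum>\<rho><G. b' \<rho> n) = b n) sequentially"
      by (auto simp: eventually_sequentially)
    from summable_cong[OF this] assms(1) have neg: "\<not> summable (\<lambda>n. \<Sum>\<rho><G. b' \<rho> n)" by simp
    ultimately show False using neg by blast
  qed
  then obtain \<rho> where \<rho>: "\<not> summable (b' \<rho>)" by blast
  have b'0: "0 \<le> b' \<rho> n" for n using assms(2) by (simp add: b'_def)
  have ex: "\<exists>J. \<kappa> \<le> sum (b' \<rho>) {..<J}"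
  proof (rule ccontr)
    assume "\<not> (\<exists>J. \<kappa> \<le> sum (b' \<rho>) {..<J})"
    then have "sum (b' \<rho>) {..<J} \<le> \<kappa>" for J by (meson linear)
    with \<rho> b'0 show False using summableI_nonneg_bounded[of "b' \<rho>" \<kappa>] by blast
  qed
  define J where "J = (LEAST J. \<kappa> \<le> sum (b' \<rho>) {..<J})"
  have J: "\<kappa> \<le> sum (b' \<rho>) {..<J}" unfolding J_def using ex by (rule LeastI_ex)
  then obtain J' where J': "J = Suc J'" using \<open>0 < \<kappa>\<close> by (cases J) auto
  have less: "sum (b' \<rho>) {..<J'} < \<kappa>"
    using not_less_Least[of J' "\<lambda>J. \<kappa> \<le> sum (b' \<rho>) {..<J}"] J' unfolding J_def by force
  \<comment> \<open>\<open>J\<close> is the first length at which the partial sums reach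
    \<open>\<kappa>\<close>. A last term of at least \<open>\<kappa>\<close> is taken alone, so that
    the punctured sum is 0; a smaller last term overshoots to less than
    \<open>2 * \<kappa>\<close>.\<close>
  show thesis
  proof (cases "\<kappa> \<le> b' \<rho> J'")
    case True
    with \<open>0 < \<kappa>\<close> have "N \<le> J' \<and> J' mod G = \<rho>" by (auto simp: b'_def split: if_splits)
    with True show ?thesis using \<open>0 < \<kappa>\<close> by (intro that[of "{J'}" \<rho>]) (auto simp: b'_def)
  next
    case False
    define I where "I = {n. n < J \<and> N \<le> n \<and> n mod G = \<rho>}"
    have I: "sum b I = sum (b' \<rho>) {..<J}"
      unfolding I_def b'_def by (subst sum.inter_filter[symmetric]) (auto intro!: sum.cong)
    show ?thesis
    proof (rule that[of I \<rho>])
      show "finite I" by (simp add: I_def)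
      show "\<kappa> \<le> sum b I" using I J by simp
      show "sum b (I - {m}) \<le> 2 * \<kappa>" if "m \<in> I" for m
      proof -
        have "sum b (I - {m}) \<le> sum b I" using assms(2) \<open>finite I\<close> by (intro sum_mono2) auto
        also have "\<dots> \<le> 2 * \<kappa>" using I less False by (simp add: J')
        finally show ?thesis .
      qed
    qed (auto simp: I_def)
  qed
qed

text \<open>A union bound for cutoffs: if some factor can differ from 1, the count alone is already
  at least 1. It bounds the mass that trimming removes in \<open>exists_density\<close>.\<close>

lemma prod_one_minus_ge:
  fixes g :: "'a \<Rightarrow> real"
  assumes "finite A" "\<And>n. n \<in> A \<Longrightarrow> 0 \<le> g n \<and> g n \<le> 1" "\<And>n. n \<in> A \<Longrightarrow> n \<notin> B \<Longrightarrow> g n = 1"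
  shows "1 \<le> (\<Prod>n\<in>A. g n) + real (card (A \<inter> B))"
proof (cases "A \<inter> B = {}")
  case True
  then have "(\<Prod>n\<in>A. g n) = 1" using assms by (intro prod.neutral) blast
  then show ?thesis by simp
next
  case False
  then have "1 \<le> card (A \<inter> B)" using assms(1) by (simp add: card_gt_0_iff Suc_leI)
  moreover have "0 \<le> (\<Prod>n\<in>A. g n)" using assms by (intro prod_nonneg) blast
  ultimately show ?thesis by linarith
qed

section \<open>Densities on trimmed targets\<close>

lemma max_cball_mono: "r \<le> r' \<Longrightarrow> max_cball x r \<subseteq> max_cball x r'"
proof
  fix y assume "r \<le> r'" "y \<in> max_cball x r"
  then have "\<bar>y $ i - x $ i\<bar> \<le> r'" for i
    unfolding mem_max_cball using order_trans[of "\<bar>y $ i - x $ i\<bar>" r r'] by blast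
  then show "y \<in> max_cball x r'" by (simp add: mem_max_cball)
qed

context comb_system begin

text \<open>Origins: 270 comes from \<open>emeasure_fat_ball_le\<close>, 1080 is
  \<open>4 * 270\<close> from balls of radius \<open>2 * r\<close>, 16200 comes from
  \<open>emeasure_pair_le\<close>, and \<open>c / 8\<close> from cores in a cube of side
  \<open>\<delta> / 2\<close>. \<open>kappa\<close> makes \<open>pair_const * (2 * kappa)\<close> a
  quarter of \<open>core_const\<close>. All depend on \<open>c\<close> and the dimension only, not
  on \<open>a\<close> or \<open>\<Theta>\<close>.\<close>

definition "ball_const = (270 :: real) ^ CARD('n) + 1080 ^ CARD('n)"
definition "pair_const = (270 * 16200 :: real) ^ CARD('n)"
definition "core_const = (c / 8) ^ CARD('n)"
definition "kappa = core_const / (8 * pair_const)"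
definition "mass_const = core_const * kappa / 2"

lemma const_pos: "0 < ball_const" "0 < pair_const" "0 < core_const" "0 < kappa" "0 < mass_const"
  using c_pos by (auto simp: ball_const_def pair_const_def core_const_def kappa_def mass_const_def
      intro!: mult_pos_pos divide_pos_pos add_pos_pos)

end

text \<open>For the theorem, \<open>\<Theta> r = 1 + \<epsilon> * f r / r ^ d\<close>.\<close>

locale weighted_combs = comb_system u M p q c
  for u :: "'n :: finite \<Rightarrow> nat \<Rightarrow> nat \<Rightarrow> real" and M p q c +
  fixes a :: "nat \<Rightarrow> real" and \<Theta> :: "real \<Rightarrow> real"
  assumes a_pos: "1 \<le> n \<Longrightarrow> 0 < a n"
    and a_le: "1 \<le> n \<Longrightarrow> \<exists>i. a n \<le> p i n"
    and volume_le: "1 \<le> n \<Longrightarrow> 0 < r \<Longrightarrow> volume n (a n) \<le> \<Theta> r * volume n r"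
    and \<Theta>_ge_1: "0 < r \<Longrightarrow> 1 \<le> \<Theta> r"
    and divergent: "\<not> summable (\<lambda>n. proportion (Suc n) (a (Suc n)))"
begin

abbreviation "w n \<equiv> weight n (a n)"
abbreviation "\<rho> n \<equiv> proportion n (a n)"

lemma weight_ball_le:
  assumes "1 \<le> n" "0 < r"
  shows "ennreal (w n) * emeasure lborel (max_cball x r \<inter> target n) \<le>
    ennreal (270 ^ CARD('n) * r ^ CARD('n) * (volume n (a n) / volume n r))"
proof -
  have Q: "0 < (\<Prod>i\<in>UNIV. q i n)" using q_pos assms by (intro prod_pos) simp
  have "ennreal (w n) * emeasure lborel (max_cball x r \<inter> target n) \<le>
    ennreal (w n) * ennreal (270 ^ CARD('n) * r ^ CARD('n) * ((\<Prod>i\<in>UNIV. q i n) / volume n r))"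
    by (intro mult_left_mono emeasure_target_ball_le assms) simp
  also have "\<dots> = ennreal (w n * (270 ^ CARD('n) * r ^ CARD('n) * ((\<Prod>i\<in>UNIV. q i n) / volume n r)))"
    using weight_pos[OF assms(1)] by (intro ennreal_mult'[symmetric]) (simp add: less_imp_le)
  also have "w n * (270 ^ CARD('n) * r ^ CARD('n) * ((\<Prod>i\<in>UNIV. q i n) / volume n r)) =
      270 ^ CARD('n) * r ^ CARD('n) * (volume n (a n) / volume n r)"
  proof -
    have "V / Q * (A * (Q / W)) = A * (V / W)" if "Q \<noteq> 0" for V Q A W :: real using that by simp
    from this[OF less_imp_neq[OF Q, symmetric]] show ?thesis unfolding weight_def .
  qed
  finally show ?thesis .
qed

text \<open>This is the use of \<open>volume_le\<close>: it bounds the quotient of volumes at every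
  radius, not only near \<open>a n\<close>.\<close>

lemma weight_ball_le_\<Theta>:
  assumes "1 \<le> n" "0 < r"
  shows "ennreal (w n) * emeasure lborel (max_cball x r \<inter> target n) \<le>
    ennreal (270 ^ CARD('n) * (\<Theta> r * r ^ CARD('n)))"
proof -
  have "volume n (a n) / volume n r \<le> \<Theta> r"
    using volume_le[OF assms] volume_pos[OF assms(1), of r] by (simp add: pos_divide_le_eq)
  then have "270 ^ CARD('n) * r ^ CARD('n) * (volume n (a n) / volume n r) \<le>
      270 ^ CARD('n) * r ^ CARD('n) * \<Theta> r"
    using assms by (intro mult_left_mono) simp_all
  then have "ennreal (270 ^ CARD('n) * r ^ CARD('n) * (volume n (a n) / volume n r)) \<le>
      ennreal (270 ^ CARD('n) * r ^ CARD('n) * \<Theta> r)"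
    by (rule ennreal_leI)
  with weight_ball_le[OF assms, of x] show ?thesis
    by (simp add: mult_ac)
qed

text \<open>At radius \<open>a n\<close> the quotient of volumes is 1: seen at its own scale, the
  density of level \<open>n\<close> is bounded like Lebesgue measure.\<close>

lemma weight_ball_scale_le:
  assumes "1 \<le> n"
  shows "ennreal (w n) * emeasure lborel (max_cball x (a n) \<inter> target n) / ennreal ((2 *
      a n) ^ CARD('n)) \<le> ennreal (270 ^ CARD('n))"
proof -
  have A: "0 < a n" using a_pos assms by simp
  have "ennreal (w n) * emeasure lborel (max_cball x (a n) \<inter> target n) \<le>
      ennreal (270 ^ CARD('n) * a n ^ CARD('n))"
    using weight_ball_le[OF assms A, of x] volume_pos[OF assms, of "a n"] by simp
  also have "\<dots> \<le> ennreal (270 ^ CARD('n) * (2 * a n) ^ CARD('n))"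
    using A by (intro ennreal_leI mult_left_mono power_mono) simp_all
  finally have "ennreal (w n) *
      emeasure lborel (max_cball x (a n) \<inter> target n) / ennreal ((2 * a n) ^ CARD('n)) \<le>
     ennreal (270 ^ CARD('n) * (2 * a n) ^ CARD('n)) / ennreal ((2 * a n) ^ CARD('n))"
    by (rule divide_right_mono_ennreal)
  also have "\<dots> = ennreal (270 ^ CARD('n))"
    using A by (subst divide_ennreal) simp_all
  finally show ?thesis .
qed

text \<open>The mass that the uniform density of level \<open>n\<close> gives to \<open>A\<close>, averaged over balls of radius \<open>a n\<close>.
  It is bounded, and shadows of pieces that are far apart are disjoint.\<close>

definition "shadow n A y =
  ennreal (w n) * emeasure lborel (A \<inter> target n \<inter> max_cball y (a n)) / ennreal
      ((2 * a n) ^ CARD('n))"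

lemma shadow_le:
  assumes "1 \<le> n" "A \<in> sets borel"
  shows "shadow n A y \<le> ennreal (270 ^ CARD('n))"
proof -
  have "shadow n A y \<le> ennreal (w n) *
      emeasure lborel (max_cball y (a n) \<inter> target n) / ennreal ((2 * a n) ^ CARD('n))"
    unfolding shadow_def by (intro divide_right_mono_ennreal mult_left_mono emeasure_mono) auto
  also have "\<dots> \<le> ennreal (270 ^ CARD('n))" by (rule weight_ball_scale_le[OF assms(1)])
  finally show ?thesis .
qed

lemma shadow_nonzeroD:
  assumes "shadow n A y \<noteq> 0"
  obtains z where "z \<in> A" "z \<in> target n" "z \<in> max_cball y (a n)"
proof -
  have "A \<inter> target n \<inter> max_cball y (a n) \<noteq> {}"
    using assms unfolding shadow_def by (auto simp del: Int_iff)
  then show thesis using that by blast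
qed

text \<open>Averaging preserves mass, by \<open>nn_integral_average_div\<close>. Together with
  \<open>shadow_le\<close>, the mass of a piece is at most a constant times the volume of the region
  that its shadow occupies.\<close>

lemma
  assumes "1 \<le> n" and [measurable]: "A \<in> sets borel"
  shows shadow_measurable: "shadow n A \<in> borel_measurable lborel"
    and nn_integral_shadow: "(\<integral>\<^sup>+y. shadow n A y \<partial>lborel) =
        ennreal (w n) * emeasure lborel (A \<inter> target n)"
proof -
  let ?g = "\<lambda>z. ennreal (w n) * indicator (A \<inter> target n) z"
  have [measurable]: "?g \<in> borel_measurable borel" by measurable
  have eq: "shadow n A y = (\<integral>\<^sup>+z. ?g z *
      indicator (max_cball y (a n)) z \<partial>lborel) / ennreal ((2 * a n) ^ CARD('n))" for y
  proof -
    have "(\<integral>\<^sup>+z. ?g z * indicator (max_cball y (a n)) z \<partial>lborel) =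
      (\<integral>\<^sup>+z. ennreal (w n) * indicator (A \<inter> target n \<inter> max_cball y (a n)) z \<partial>lborel)"
      by (intro nn_integral_cong) (auto simp: indicator_def)
    also have "\<dots> = ennreal (w n) * emeasure lborel (A \<inter> target n \<inter> max_cball y (a n))"
      by (subst nn_integral_cmult) simp_all
    finally show ?thesis by (simp add: shadow_def)
  qed
  have m: "(\<lambda>(y, z). ?g z * indicator (max_cball y (a n)) z) \<in> borel_measurable (lborel \<Otimes>\<^sub>M lborel)"
    using max_cball_measurable_pair[of "a n"]
        by (simp add: split_beta' borel_prod[symmetric] cong: measurable_cong_sets)
  have [measurable]: "(\<lambda>y. \<integral>\<^sup>+z. ?g z *
      indicator (max_cball y (a n)) z \<partial>lborel) \<in> borel_measurable lborel"
    using lborel.borel_measurable_nn_integral_fst[OF m] by simp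
  show "shadow n A \<in> borel_measurable lborel"
    unfolding eq[abs_def] by measurable
  have "(\<integral>\<^sup>+y. shadow n A y \<partial>lborel) = (\<integral>\<^sup>+z. ?g z \<partial>lborel)"
    unfolding eq by (rule nn_integral_average_div[symmetric]) (use a_pos assms in auto)
  also have "\<dots> = ennreal (w n) * emeasure lborel (A \<inter> target n)"
    by (subst nn_integral_cmult) simp_all
  finally show "(\<integral>\<^sup>+y. shadow n A y \<partial>lborel) = ennreal (w n) * emeasure lborel (A \<inter> target n)" .
qed

text \<open>Larger scales come first; the index breaks ties so that the order is total.\<close>

definition prec :: "nat \<Rightarrow> nat \<Rightarrow> bool" where
  "prec n m \<longleftrightarrow> a m < a n \<or> a m = a n \<and> n < m"

lemma prec_total: "n \<noteq> m \<Longrightarrow> prec n m \<or> prec m n" by (auto simp: prec_def)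
lemma prec_le: "prec n m \<Longrightarrow> a m \<le> a n" by (auto simp: prec_def)
lemma prec_irrefl: "\<not> prec n n" by (simp add: prec_def)

definition "trimmed I m = target m - (\<Union>n\<in>{n \<in> I. prec n m}. fatten n (2 * a n))"

lemma trimmed_sets [measurable]: "finite I \<Longrightarrow> trimmed I m \<in> sets borel"
  unfolding trimmed_def by measurable auto

text \<open>If \<open>a m \<le> a n\<close> and the balls of radii \<open>a n\<close> and
  \<open>a m\<close> around \<open>y\<close> and \<open>z\<close> meet, then \<open>z\<close> lies
  within \<open>2 * a n\<close> of \<open>target n\<close>, which is exactly what
  \<open>trimmed\<close> removes.\<close>

lemma trimmed_separated:
  assumes "n \<in> I" "m \<in> I" "n \<noteq> m" "y \<in> trimmed I n" "z \<in> trimmed I m" "x \<in> max_cball y (a n)"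
      "x \<in> max_cball z (a m)"
  shows False
proof -
  have *: False if "prec n m" "n \<in> I" "y \<in> trimmed I n" "z \<in> trimmed I m" "x \<in> max_cball y (a n)"
      "x \<in> max_cball z (a m)" for n m y z
  proof -
    have "z \<in> max_cball y (2 * a n)"
      unfolding mem_max_cball
    proof
      fix i
      have "\<bar>x $ i - y $ i\<bar> \<le> a n" "\<bar>x $ i - z $ i\<bar> \<le> a m" using that by (auto simp: mem_max_cball)
      with prec_le[OF that(1)] show "\<bar>z $ i - y $ i\<bar> \<le> 2 * a n" by linarith
    qed
    then have "z \<in> fatten n (2 * a n)" using fatten_shift[of y n 0 z "2 * a n"] that(3)
        by (simp add: trimmed_def)
    with that show False by (auto simp: trimmed_def)
  qed
  show False
    using prec_total[OF \<open>n \<noteq> m\<close>] *[of n m y z] *[of m n z y] assms by blast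
qed

text \<open>Levels with \<open>r \<le> a m\<close>: by separation at most one trimmed piece meets
  the ball, and \<open>weight_ball_le_\<Theta>\<close> applies to it. Levels with
  \<open>a m < r\<close>: the shadows have disjoint supports inside the ball of radius
  \<open>2 * r\<close> and are bounded by \<open>270 ^ d\<close>, so their total mass is at most a
  multiple of \<open>r ^ d\<close>, however many levels there are.\<close>

lemma sum_trimmed_ball_le:
  assumes "finite I" "\<And>n. n \<in> I \<Longrightarrow> 1 \<le> n" "0 < r"
  shows "(\<Sum>m\<in>I. ennreal (w m) * emeasure lborel (max_cball x r \<inter> trimmed I m)) \<le>
    ennreal (ball_const * (\<Theta> r * r ^ CARD('n)))"
proof -
  let ?g = "\<lambda>m. ennreal (w m) * emeasure lborel (max_cball x r \<inter> trimmed I m)"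
  have tr: "trimmed I m \<subseteq> target m" for m by (auto simp: trimmed_def)
  have [measurable]: "trimmed I m \<in> sets borel" for m using assms(1) by (rule trimmed_sets)
  define J where "J = {m \<in> I. r \<le> a m}"
  define S where "S = {m \<in> I. a m < r}"
  have "sum ?g J \<le> ennreal (270 ^ CARD('n) * (\<Theta> r * r ^ CARD('n)))"
  proof (rule sum_at_most_one_le)
    show "finite J" using assms(1) by (simp add: J_def)
    fix m assume m: "m \<in> J"
    have "?g m \<le> ennreal (w m) * emeasure lborel (max_cball x r \<inter> target m)"
      using tr by (intro mult_left_mono emeasure_mono) auto
    also have "\<dots> \<le> ennreal (270 ^ CARD('n) * (\<Theta> r * r ^ CARD('n)))"
      using m assms by (intro weight_ball_le_\<Theta>) (auto simp: J_def)
    finally show "?g m \<le> ennreal (270 ^ CARD('n) * (\<Theta> r * r ^ CARD('n)))" .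
    fix n assume n: "n \<in> J" "m \<noteq> n"
    show "?g m = 0 \<or> ?g n = 0"
    proof (rule ccontr)
      assume "\<not> (?g m = 0 \<or> ?g n = 0)"
      then have "max_cball x r \<inter> trimmed I m \<noteq> {}" "max_cball x r \<inter> trimmed I n \<noteq> {}"
        by (auto simp del: Int_iff)
      then obtain y z where yz: "y \<in> max_cball x r" "y \<in> trimmed I m" "z \<in> max_cball x r"
          "z \<in> trimmed I n" by blast
      have "r \<le> a m" "r \<le> a n" using m n by (simp_all add: J_def)
      then have "x \<in> max_cball y (a m)" "x \<in> max_cball z (a n)"
        using yz(1,3) max_cball_mono max_cball_sym by blast+
      from trimmed_separated[OF _ _ n(2) yz(2,4) this] m n show False by (simp add: J_def)
    qed
  qed
  moreover have "sum ?g S \<le> ennreal (1080 ^ CARD('n) * (\<Theta> r * r ^ CARD('n)))"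
  proof -
    let ?A = "\<lambda>m. max_cball x r \<inter> trimmed I m"
    have S: "finite S" "\<And>m. m \<in> S \<Longrightarrow> 1 \<le> m" using assms by (auto simp: S_def)
    have At: "?A m \<inter> target m = ?A m" for m using tr by auto
    have "sum ?g S = (\<Sum>m\<in>S. \<integral>\<^sup>+y. shadow m (?A m) y \<partial>lborel)"
      using S(2) by (intro sum.cong) (simp_all add: nn_integral_shadow At)
    also have "\<dots> = (\<integral>\<^sup>+y. (\<Sum>m\<in>S. shadow m (?A m) y) \<partial>lborel)"
      using S by (intro nn_integral_sum[symmetric] shadow_measurable) simp_all
    also have "\<dots> \<le> (\<integral>\<^sup>+y. ennreal (270 ^ CARD('n)) * indicator (max_cball x (2 * r)) y \<partial>lborel)"
    proof (rule nn_integral_mono)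
      fix y
      show "(\<Sum>m\<in>S. shadow m (?A m) y) \<le>
          ennreal (270 ^ CARD('n)) * indicator (max_cball x (2 * r)) y"
      proof (cases "y \<in> max_cball x (2 * r)")
        case True
        have "(\<Sum>m\<in>S. shadow m (?A m) y) \<le> ennreal (270 ^ CARD('n))"
        proof (rule sum_at_most_one_le[OF S(1)])
          fix m n assume mn: "m \<in> S" "n \<in> S" "m \<noteq> n"
          show "shadow m (?A m) y = 0 \<or> shadow n (?A n) y = 0"
          proof (rule ccontr)
            assume "\<not> (shadow m (?A m) y = 0 \<or> shadow n (?A n) y = 0)"
            then obtain z z' where "z \<in> trimmed I m" "z \<in> max_cball y (a m)" "z' \<in> trimmed I n"
                "z' \<in> max_cball y (a n)"
              using shadow_nonzeroD by (metis IntD2)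
            with trimmed_separated[of m I n z z' y] mn max_cball_sym show False
                by (auto simp: S_def)
          qed
        qed (use S shadow_le in simp)
        with True show ?thesis by simp
      next
        case False
        have "shadow m (?A m) y = 0" if "m \<in> S" for m
        proof (rule ccontr)
          assume "shadow m (?A m) y \<noteq> 0"
          then obtain z where z: "z \<in> max_cball x r" "z \<in> max_cball y (a m)"
            using shadow_nonzeroD by (metis IntD1)
          have "y \<in> max_cball x (2 * r)"
            unfolding mem_max_cball
          proof
            fix i
            have "\<bar>z $ i - x $ i\<bar> \<le> r" "\<bar>z $ i - y $ i\<bar> \<le> a m" "a m < r" using z that
                by (auto simp: mem_max_cball S_def)
            then show "\<bar>y $ i - x $ i\<bar> \<le> 2 * r" by linarith
          qed
          with False show False by simp
        qed
        then show ?thesis by simp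
      qed
    qed
    also have "\<dots> = ennreal (270 ^ CARD('n)) * ennreal ((2 * (2 * r)) ^ CARD('n))"
      using assms(3) by (subst nn_integral_cmult) (simp_all add: emeasure_max_cball)
    also have "\<dots> = ennreal (270 ^ CARD('n) * (2 * (2 * r)) ^ CARD('n))"
      using assms(3) by (subst ennreal_mult) simp_all
    also have "270 ^ CARD('n) * (2 * (2 * r)) ^ CARD('n) = 1080 ^ CARD('n) * (1 * r ^ CARD('n))"
    proof -
      have "270 * (2 * (2 * r)) = 1080 * r" by simp
      then show ?thesis by (simp only: mult_1 power_mult_distrib[symmetric])
    qed
    also have "ennreal \<dots> \<le> ennreal (1080 ^ CARD('n) * (\<Theta> r * r ^ CARD('n)))"
      using assms(3) \<Theta>_ge_1[OF assms(3)]
          by (intro ennreal_leI mult_left_mono mult_right_mono) simp_all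
    finally show ?thesis .
  qed
  moreover have "sum ?g I = sum ?g J + sum ?g S"
  proof -
    have "I = J \<union> S" "J \<inter> S = {}" "finite J" "finite S" using assms(1) by (auto simp: J_def S_def)
    then show ?thesis using sum.union_disjoint by blast
  qed
  ultimately have "sum ?g I \<le> ennreal (270 ^ CARD('n) * (\<Theta> r * r ^ CARD('n))) +
      ennreal (1080 ^ CARD('n) * (\<Theta> r * r ^ CARD('n)))"
    by (simp add: add_mono)
  also have "\<dots> = ennreal (ball_const * (\<Theta> r * r ^ CARD('n)))"
    unfolding ball_const_def using assms(3) \<Theta>_ge_1[OF assms(3)]
    by (subst ennreal_plus[symmetric]) (auto simp: distrib_right)
  finally show ?thesis .
qed

text \<open>The mass of level \<open>m\<close> close to a preceding level \<open>n\<close>.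
  Averaging over radius \<open>a m \<le> a n\<close> keeps points within \<open>4 * a n\<close> and
  \<open>4 * a m\<close> of the two targets, so \<open>emeasure_pair_le\<close> bounds the volume of
  the shadow; the middle half of the cube leaves room \<open>\<delta> / 4\<close> for this. The
  bound is symmetric in \<open>m\<close> and \<open>n\<close> because the order of scales need not
  be the order of levels.\<close>

lemma overlap_le:
  assumes "1 \<le> m" "1 \<le> n" "prec n m" "\<And>i. p i m \<le> \<delta> / 4" "\<And>i. p i n \<le> \<delta> / 4"
  shows "ennreal (w m) * emeasure lborel (box_product (\<lambda>i.
      {s i + \<delta> / 4..s i + 3 * \<delta> / 4}) \<inter> fatten n (3 * a n) \<inter> target m) \<le>
    ennreal (pair_const * \<delta> ^ CARD('n) *
        (\<rho> n * \<rho> m + 2 ^ CARD('n) * ((\<rho> n + \<rho> m) / 2 ^ (max n m - min n m))))"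
proof -
  let ?A = "box_product (\<lambda>i. {s i + \<delta> / 4..s i + 3 * \<delta> / 4}) \<inter> fatten n (3 * a n)"
  let ?Q = "box_product (\<lambda>i. {s i..s i + \<delta>})"
  let ?B = "?Q \<inter> fatten n (4 * a n) \<inter> fatten m (4 * a m)"
  have am: "0 < a m" "a m \<le> a n" "0 < a n" using a_pos assms prec_le by auto
  \<comment> \<open>One coordinate suffices: the scale is at most one cell side, and all cell sides
    are at most \<open>\<delta> / 4\<close>.\<close>
  obtain i where "a m \<le> p i m" using a_le assms by blast
  with assms(4)[of i] have am4: "a m \<le> \<delta> / 4" by linarith
  have \<delta>: "0 < \<delta>" using am am4 by linarith
  have [measurable]: "?A \<in> sets borel" "?B \<in> sets borel"
    by (auto intro!: sets.Int box_product_sets)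
  have "ennreal (w m) * emeasure lborel (?A \<inter> target m) = (\<integral>\<^sup>+y. shadow m ?A y \<partial>lborel)"
    using assms by (simp add: nn_integral_shadow)
  also have "\<dots> \<le> (\<integral>\<^sup>+y. ennreal (270 ^ CARD('n)) * indicator ?B y \<partial>lborel)"
  proof (rule nn_integral_mono)
    fix y
    show "shadow m ?A y \<le> ennreal (270 ^ CARD('n)) * indicator ?B y"
    proof (cases "shadow m ?A y = 0")
      case False
      then obtain z where z: "z \<in> ?A" "z \<in> target m" "z \<in> max_cball y (a m)"
          by (rule shadow_nonzeroD)
      have y: "y \<in> max_cball z (a m)" using z(3) max_cball_sym by blast
      then have y': "y \<in> max_cball z (a n)" using am max_cball_mono by blast
      have "y \<in> fatten n (3 * a n + a n)" using z(1) y' by (intro fatten_shift) auto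
      moreover have "y \<in> fatten m (4 * a m)"
        using fatten_shift[OF z(2) y] fatten_mono[of "0 + a m" "4 * a m" m] am by auto
      moreover have "y \<in> ?Q"
      proof -
        have "s i \<le> y $ i \<and> y $ i \<le> s i + \<delta>" for i
        proof -
          have "\<bar>y $ i - z $ i\<bar> \<le> a m" using y by (simp add: mem_max_cball)
          moreover have "s i + \<delta> / 4 \<le> z $ i" "z $ i \<le> s i + 3 * \<delta> / 4" using z(1) by auto
          ultimately show ?thesis using am4 by linarith
        qed
        then show ?thesis by simp
      qed
      ultimately have "y \<in> ?B" by (simp del: mem_box_product)
      then show ?thesis using shadow_le[OF assms(1), of ?A y] by (simp del: mem_box_product)
    qed simp
  qed
  also have "\<dots> = ennreal (270 ^ CARD('n)) * emeasure lborel ?B"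
    by (subst nn_integral_cmult) simp_all
  also have "emeasure lborel ?B \<le>
      ennreal ((16200 * \<delta>) ^ CARD('n) *
      (\<rho> n * \<rho> m + 2 ^ CARD('n) * ((\<rho> n + \<rho> m) / 2 ^ (max n m - min n m))))"
  proof -
    have \<rho>: "0 \<le> \<rho> n" "0 \<le> \<rho> m" using proportion_bounds assms by (simp_all add: less_imp_le)
    have le\<delta>: "p i m \<le> \<delta>" "p i n \<le> \<delta>" for i
      using assms(4)[of i] assms(5)[of i] \<delta> by linarith+
    have le: "(x + D / e) * y \<le> x * y + D * ((x + y) / e)" if "0 \<le> x" "0 \<le> y" "0 \<le> D" "0 < e"
        for x y D e :: real
      using that by (simp add: field_simps)
    show ?thesis
    proof (cases "m \<le> n")
      case True
      have "?B = ?Q \<inter> fatten m (4 * a m) \<inter> fatten n (4 * a n)" by blast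
      then have "emeasure lborel ?B \<le>
          ennreal ((16200 * \<delta>) ^ CARD('n) * ((\<rho> m + 2 ^ CARD('n) / 2 ^ (n - m)) * \<rho> n))"
        using emeasure_pair_le[OF assms(1) True, of "a m" "a n" \<delta> s] am le\<delta> by simp
      also have "\<dots> \<le> ennreal ((16200 * \<delta>) ^ CARD('n) *
          (\<rho> m * \<rho> n + 2 ^ CARD('n) * ((\<rho> m + \<rho> n) / 2 ^ (n - m))))"
        using \<delta> \<rho> by (intro ennreal_leI mult_left_mono le) simp_all
      finally show ?thesis using True by (simp add: add.commute mult.commute)
    next
      case False
      then have nm: "n \<le> m" by simp
      have "emeasure lborel ?B \<le>
          ennreal ((16200 * \<delta>) ^ CARD('n) * ((\<rho> n + 2 ^ CARD('n) / 2 ^ (m - n)) * \<rho> m))"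
        using emeasure_pair_le[OF assms(2) nm, of "a n" "a m" \<delta> s] am le\<delta> by simp
      also have "\<dots> \<le> ennreal ((16200 * \<delta>) ^ CARD('n) *
          (\<rho> n * \<rho> m + 2 ^ CARD('n) * ((\<rho> n + \<rho> m) / 2 ^ (m - n))))"
        using \<delta> \<rho> by (intro ennreal_leI mult_left_mono le) simp_all
      finally show ?thesis using nm by simp
    qed
  qed
  finally have "ennreal (w m) * emeasure lborel (?A \<inter> target m) \<le> ennreal (270 ^ CARD('n)) *
     ennreal ((16200 * \<delta>) ^ CARD('n) *
         (\<rho> n * \<rho> m + 2 ^ CARD('n) * ((\<rho> n + \<rho> m) / 2 ^ (max n m - min n m))))"
    by (simp add: mult_left_mono)
  also have "\<dots> = ennreal (pair_const * \<delta> ^ CARD('n) *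
      (\<rho> n * \<rho> m + 2 ^ CARD('n) * ((\<rho> n + \<rho> m) / 2 ^ (max n m - min n m))))"
    unfolding pair_const_def power_mult_distrib
    by (subst ennreal_mult'[symmetric]) (simp_all only: mult.assoc zero_le_power zero_le_numeral)
  finally show ?thesis .
qed

lemma exists_fine_scale:
  assumes "0 < \<delta>"
  obtains N where "1 \<le> N" "\<And>n i. N \<le> n \<Longrightarrow> p i n \<le> \<delta>"
proof -
  have "\<exists>k. p i 1 / 2 ^ k \<le> \<delta>" for i
  proof -
    have "(\<lambda>k. p i 1 / 2 ^ k) \<longlonglongrightarrow> 0"
      by (rule LIMSEQ_divide_realpow_zero) simp
    then have "eventually (\<lambda>k. p i 1 / 2 ^ k < \<delta>) sequentially"
      using assms by (rule order_tendstoD)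
    then show ?thesis by (auto simp: eventually_sequentially intro: less_imp_le)
  qed
  then obtain k where k: "p i 1 / 2 ^ k i \<le> \<delta>" for i by metis
  show thesis
  proof (rule that[of "Suc (Max (range k))"])
    fix n i assume n: "Suc (Max (range k)) \<le> n"
    have "k i \<le> Max (range k)" by (rule Max_ge) auto
    with n have "k i \<le> n - 1" by linarith
    then have "p i 1 / 2 ^ (n - 1) \<le> p i 1 / 2 ^ k i"
      using p_pos[of 1 i] by (intro divide_left_mono power_increasing) (auto simp: less_imp_le)
    with refine[of 1 n i] n k[of i] show "p i n \<le> \<delta>" by simp
  qed simp
qed

text \<open>Between the distances \<open>2 * a n\<close> and \<open>3 * a n\<close> the cutoff
  \<open>\<eta> n\<close> passes from 0 to 1, so a product of cutoffs is a continuous substitute for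
  trimming. The price is the wider neighbourhood \<open>3 * a n\<close> in
  \<open>overlap_le\<close>.\<close>

lemma exists_bumps:
  obtains b \<eta> :: "nat \<Rightarrow> real ^ 'n \<Rightarrow> real"
  where "\<And>n. 1 \<le> n \<Longrightarrow> continuous_on UNIV (b n)" "\<And>n x. 1 \<le> n \<Longrightarrow> 0 \<le> b n x \<and> b n x \<le> 1"
    "\<And>n x. 1 \<le> n \<Longrightarrow> x \<in> core n \<Longrightarrow> b n x = 1" "\<And>n x. 1 \<le> n \<Longrightarrow> x \<notin> target n \<Longrightarrow> b n x = 0"
    "\<And>n. 1 \<le> n \<Longrightarrow> continuous_on UNIV (\<eta> n)" "\<And>n x. 1 \<le> n \<Longrightarrow> 0 \<le> \<eta> n x \<and> \<eta> n x \<le> 1"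
    "\<And>n x. 1 \<le> n \<Longrightarrow> x \<in> fatten n (2 * a n) \<Longrightarrow> \<eta> n x = 0" "\<And>n x. 1 \<le> n \<Longrightarrow> x \<notin> fatten n (3 * a n) \<Longrightarrow>
        \<eta> n x = 1"
proof -
  have op: "open (box_product (\<lambda>i. open_fat (u i n) (M i n) (c * q i n) \<delta>))" for n \<delta>
    by (rule open_box_product) simp
  have sub: "box_product (\<lambda>i. open_fat (u i n) (M i n) (c * q i n) \<delta>) \<subseteq> fatten n \<delta>" for n \<delta>
    unfolding fatten_def using open_fat_subset_fat by fastforce
  define B where "B n f \<longleftrightarrow> continuous_on UNIV f \<and> (\<forall>x. 0 \<le> f x \<and> f x \<le> 1) \<and>
      (\<forall>x\<in>core n. f x = 1) \<and> (\<forall>x. x \<notin> target n \<longrightarrow> f x = (0 :: real))" for n f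
  have "\<exists>f. B n f" if n: "1 \<le> n" for n
  proof -
    have cl: "closed (core n)" by (simp add: core_def closed_box_product)
    have "core n \<subseteq> box_product (\<lambda>i. open_fat (u i n) (M i n) (c * q i n) 0)"
      unfolding core_def using fat_subset_open_fat[of "- (c * q _ n) / 4" 0] cq_pos[OF n]
          by fastforce
    from continuous_bump[OF cl op this]
    obtain f where "continuous_on UNIV f" "\<And>x. 0 \<le> f x" "\<And>x. f x \<le> (1 :: real)"
        "\<And>x. x \<in> core n \<Longrightarrow> f x = 1"
      "\<And>x. x \<notin> box_product (\<lambda>i. open_fat (u i n) (M i n) (c * q i n) 0) \<Longrightarrow> f x = 0" by blast
    with sub[of n 0] show ?thesis unfolding B_def by (intro exI[of _ f]) blast
  qed
  then have b: "B n (SOME f. B n f)" if "1 \<le> n" for n using that by (simp add: someI_ex)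
  define X where "X n f \<longleftrightarrow> continuous_on UNIV f \<and> (\<forall>x. 0 \<le> f x \<and> f x \<le> 1) \<and>
      (\<forall>x\<in>fatten n (2 * a n). f x = 0) \<and> (\<forall>x. x \<notin> fatten n (3 * a n) \<longrightarrow> f x = (1 :: real))" for n f
  have "\<exists>f. X n f" if n: "1 \<le> n" for n
  proof -
    have "fatten n (2 * a n) \<subseteq> box_product (\<lambda>i. open_fat (u i n) (M i n) (c * q i n) (3 * a n))"
      unfolding fatten_def using fat_subset_open_fat[of "2 * a n" "3 * a n"] a_pos[OF n]
          by fastforce
    from continuous_bump[OF closed_fatten op this]
    obtain f where f: "continuous_on UNIV f" "\<And>x. 0 \<le> f x" "\<And>x. f x \<le> (1 :: real)"
        "\<And>x. x \<in> fatten n (2 * a n) \<Longrightarrow> f x = 1"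
      "\<And>x. x \<notin> box_product (\<lambda>i. open_fat (u i n) (M i n) (c * q i n) (3 * a n)) \<Longrightarrow> f x = 0" by blast
    have "continuous_on UNIV (\<lambda>x. 1 - f x)" by (intro continuous_intros f)
    moreover have "f x = 0" if "x \<notin> fatten n (3 * a n)" for x
      using f(5) sub[of n "3 * a n"] that by blast
    ultimately show ?thesis using f(2-4)
      unfolding X_def by (intro exI[of _ "\<lambda>x. 1 - f x"]) auto
  qed
  then have x: "X n (SOME f. X n f)" if "1 \<le> n" for n using that by (simp add: someI_ex)
  show thesis
    by (rule that[of "\<lambda>n. SOME f. B n f" "\<lambda>n. SOME f. X n f"])
      (use b x in \<open>auto simp: B_def X_def\<close>)
qed

text \<open>The part with \<open>\<rho> n * \<rho> m\<close> is bounded by the punctured sums. The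
  gaps are symmetric in \<open>n\<close> and \<open>m\<close>, so both halves of the other part
  equal one sum, to which \<open>sum_gaps_le\<close> applies.\<close>

lemma sum_interactions_le:
  assumes "finite I" "\<And>n. n \<in> I \<Longrightarrow> 1 \<le> n \<and> n mod G = g" "0 < G" "0 \<le> K"
    and "\<And>m. m \<in> I \<Longrightarrow> sum \<rho> (I - {m}) \<le> K"
  shows "(\<Sum>m\<in>I. \<Sum>n\<in>I - {m}. \<rho> n * \<rho> m + D * ((\<rho> n + \<rho> m) / 2 ^ (max n m - min n m))) \<le>
      (K + \<bar>D\<bar> * (8 / 2 ^ G)) * sum \<rho> I"
proof -
  have \<rho>: "0 \<le> \<rho> n" if "n \<in> I" for n using that proportion_bounds[of n] assms(2)
      by (simp add: less_imp_le)
  let ?e = "\<lambda>n m. 1 / 2 ^ (max n m - min n m) :: real"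
  have 1: "(\<Sum>m\<in>I. \<Sum>n\<in>I - {m}. \<rho> n * \<rho> m) \<le> K * sum \<rho> I"
  proof -
    have "(\<Sum>m\<in>I. \<Sum>n\<in>I - {m}. \<rho> n * \<rho> m) = (\<Sum>m\<in>I. sum \<rho> (I - {m}) * \<rho> m)"
      by (simp add: sum_distrib_right)
    also have "\<dots> \<le> (\<Sum>m\<in>I. K * \<rho> m)" using assms(5) \<rho> by (intro sum_mono mult_right_mono) auto
    finally show ?thesis by (simp add: sum_distrib_left)
  qed
  have 2: "(\<Sum>m\<in>I. \<Sum>n\<in>I - {m}. \<rho> m * ?e n m) \<le> 4 / 2 ^ G * sum \<rho> I"
  proof -
    have "(\<Sum>m\<in>I. \<Sum>n\<in>I - {m}. \<rho> m * ?e n m) = (\<Sum>m\<in>I. \<rho> m * (\<Sum>n\<in>I - {m}. ?e n m))"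
      by (simp only: sum_distrib_left)
    also have "\<dots> \<le> (\<Sum>m\<in>I. \<rho> m * (4 / 2 ^ G))"
      using assms \<rho> by (intro sum_mono mult_left_mono sum_gaps_le[of I G g]) auto
    also have "\<dots> = 4 / 2 ^ G * sum \<rho> I"
      by (subst sum_distrib_right[symmetric]) (rule mult.commute)
    finally show ?thesis .
  qed
  have aux: "(\<Sum>n\<in>I. if n \<noteq> m then g n else 0) = sum g (I - {m})" for g :: "nat \<Rightarrow> real" and m
  proof -
    have "I - {m} = {n \<in> I. n \<noteq> m}" by auto
    then show ?thesis by (simp only: sum.inter_filter[OF assms(1)])
  qed
  have sw: "(\<Sum>m\<in>I. \<Sum>n\<in>I - {m}. \<rho> n * ?e n m) = (\<Sum>m\<in>I. \<Sum>n\<in>I - {m}. \<rho> m * ?e n m)"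
  proof -
    have "(\<Sum>m\<in>I. \<Sum>n\<in>I - {m}. \<rho> n * ?e n m) = (\<Sum>m\<in>I. \<Sum>n\<in>I. if n \<noteq> m then \<rho> n * ?e n m else 0)"
      by (simp only: aux)
    also have "\<dots> = (\<Sum>n\<in>I. \<Sum>m\<in>I. if n \<noteq> m then \<rho> n * ?e n m else 0)" by (rule sum.swap)
    also have "\<dots> = (\<Sum>m\<in>I. \<Sum>n\<in>I. if n \<noteq> m then \<rho> m * ?e n m else 0)"
      by (intro sum.cong refl) (auto simp: max.commute min.commute)
    also have "\<dots> = (\<Sum>m\<in>I. \<Sum>n\<in>I - {m}. \<rho> m * ?e n m)"
      by (simp only: aux)
    finally show ?thesis .
  qed
  have pw: "\<rho> n * \<rho> m + D * ((\<rho> n + \<rho> m) / 2 ^ (max n m - min n m)) =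
      \<rho> n * \<rho> m + (D * (\<rho> n * ?e n m) + D * (\<rho> m * ?e n m))" for n m
    by (simp add: add_divide_distrib distrib_left)
  have eq: "(\<Sum>m\<in>I. \<Sum>n\<in>I - {m}. \<rho> n * \<rho> m + D * ((\<rho> n + \<rho> m) / 2 ^ (max n m - min n m))) =
     (\<Sum>m\<in>I. \<Sum>n\<in>I - {m}. \<rho> n * \<rho> m) +
         (D * (\<Sum>m\<in>I. \<Sum>n\<in>I - {m}. \<rho> n * ?e n m) + D * (\<Sum>m\<in>I. \<Sum>n\<in>I - {m}. \<rho> m * ?e n m))"
    unfolding pw by (simp only: sum.distrib sum_distrib_left)
  let ?S = "\<Sum>m\<in>I. \<Sum>n\<in>I - {m}. \<rho> m * ?e n m"
  have S0: "0 \<le> ?S" using \<rho> by (intro sum_nonneg mult_nonneg_nonneg) auto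
  have "D * ?S \<le> \<bar>D\<bar> * ?S" using S0 by (intro mult_right_mono) auto
  also have "\<dots> \<le> \<bar>D\<bar> * (4 / 2 ^ G * sum \<rho> I)" using 2 by (intro mult_left_mono) auto
  finally have "D * ?S \<le> \<bar>D\<bar> * (4 / 2 ^ G) * sum \<rho> I" by (simp add: mult.assoc)
  moreover have "(K + \<bar>D\<bar> * (8 / 2 ^ G)) * sum \<rho> I =
      K * sum \<rho> I + (\<bar>D\<bar> * (4 / 2 ^ G) * sum \<rho> I + \<bar>D\<bar> * (4 / 2 ^ G) * sum \<rho> I)"
    by (simp add: distrib_right)
  ultimately show ?thesis unfolding eq sw using 1 by linarith
qed

text \<open>The density is assembled from the uniform densities on finitely many targets, processed in
  the order of decreasing scale \<open>a n\<close>: each one is cut off near the targets of larger scale. Then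
  balls of radius \<open>a n\<close> around the surviving pieces are disjoint, which yields the upper bound on
  balls, while the loss of mass is controlled by the quasi-independence of the targets.\<close>

theorem exists_density:
  assumes "0 < \<delta>"
  obtains \<sigma> :: "real ^ 'n \<Rightarrow> real" and I where "finite I" "\<And>n. n \<in> I \<Longrightarrow> N \<le> n \<and> 1 \<le> n"
    "continuous_on UNIV \<sigma>" "\<And>x. 0 \<le> \<sigma> x" "\<And>x. \<sigma> x \<noteq> 0 \<Longrightarrow> x \<in> (\<Union>n\<in>I. target n)"
    "\<And>x r. 0 < r \<Longrightarrow> (\<integral>\<^sup>+y. ennreal (\<sigma> y) * indicator (max_cball x r) y \<partial>lborel) \<le>
        ennreal (ball_const * (\<Theta> r * r ^ CARD('n)))"
    "\<And>s. \<forall>i. 0 \<le> s i \<and> s i + \<delta> \<le> 1 \<Longrightarrow> ennreal (mass_const * \<delta> ^ CARD('n)) \<le>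
      (\<integral>\<^sup>+y. ennreal (\<sigma> y) * indicator (box_product (\<lambda>i. {s i + \<delta> / 4..s i + 3 * \<delta> / 4})) y
          \<partial>lborel)"
proof -
  \<comment> \<open>\<open>G\<close> is so large that \<open>pair_const\<close> times the gap error
    \<open>2 ^ d * (8 / 2 ^ G)\<close> is at most a quarter of \<open>core_const\<close>; the
    \<open>Suc\<close> below makes it positive.\<close>
  have "\<exists>G. 32 * 2 ^ CARD('n) * pair_const / core_const < 2 ^ G"
    by (rule real_arch_pow) simp
  then obtain G' where G': "32 * 2 ^ CARD('n) * pair_const / core_const < (2 :: real) ^ G'" by blast
  define G where "G = Suc G'"
  have "32 * 2 ^ CARD('n) * pair_const / core_const \<le> 2 ^ G"
  proof -
    have "(2 :: real) ^ G' \<le> 2 ^ G" by (simp add: G_def)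
    with G' show ?thesis by linarith
  qed
  then have G: "32 * 2 ^ CARD('n) * pair_const \<le> core_const * 2 ^ G"
    using const_pos by (simp add: pos_divide_le_eq mult.commute)
  have G0: "0 < G" by (simp add: G_def)
  \<comment> \<open>Then \<open>4 * p i n \<le> \<delta> / 2\<close>, as needed for counting cores
    in the middle half of a cube.\<close>
  obtain N0 where N0: "1 \<le> N0" "\<And>n i. N0 \<le> n \<Longrightarrow> p i n \<le> \<delta> / 8"
    using exists_fine_scale[of "\<delta> / 8"] assms by auto
  \<comment> \<open>Level 0 is suppressed: nothing is known about it, and \<open>divergent\<close>
    speaks of the levels from 1 on.\<close>
  have "\<not> summable (\<lambda>n. if n = 0 then 0 else \<rho> n)"
    using divergent by (subst summable_Suc_iff[symmetric]) simp
  moreover have "0 \<le> (if n = 0 then 0 else \<rho> n)" for n using proportion_bounds[of n]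
      by (simp add: less_imp_le)
  ultimately obtain I g where I: "finite I" "\<And>n. n \<in> I \<Longrightarrow> max N N0 \<le> n \<and> n mod G = g"
    "kappa \<le> sum (\<lambda>n. if n = 0 then 0 else \<rho> n) I"
    "\<And>m. m \<in> I \<Longrightarrow> sum (\<lambda>n. if n = 0 then 0 else \<rho> n) (I - {m}) \<le> 2 * kappa"
    using nonsummable_residue_class[OF _ _ G0 const_pos(4), of _ "max N N0"] by (metis (lifting))
  have I1: "1 \<le> n" "N \<le> n" "N0 \<le> n" if "n \<in> I" for n using I(2)[OF that] N0(1) by auto
  have eqI: "sum (\<lambda>n. if n = 0 then 0 else \<rho> n) J = sum \<rho> J" if "J \<subseteq> I" for J
    using I1 that by (intro sum.cong) force+
  have \<kappa>: "kappa \<le> sum \<rho> I" "\<And>m. m \<in> I \<Longrightarrow> sum \<rho> (I - {m}) \<le> 2 * kappa"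
    using I(3,4) eqI by auto
  obtain b \<eta> :: "nat \<Rightarrow> real ^ 'n \<Rightarrow> real" where
    b: "\<And>n. 1 \<le> n \<Longrightarrow> continuous_on UNIV (b n)" "\<And>n x. 1 \<le> n \<Longrightarrow> 0 \<le> b n x \<and> b n x \<le> 1"
    "\<And>n x. 1 \<le> n \<Longrightarrow> x \<in> core n \<Longrightarrow> b n x = 1" "\<And>n x. 1 \<le> n \<Longrightarrow> x \<notin> target n \<Longrightarrow> b n x = 0"
    and \<eta>: "\<And>n. 1 \<le> n \<Longrightarrow> continuous_on UNIV (\<eta> n)" "\<And>n x. 1 \<le> n \<Longrightarrow> 0 \<le> \<eta> n x \<and> \<eta> n x \<le> 1"
    "\<And>n x. 1 \<le> n \<Longrightarrow> x \<in> fatten n (2 * a n) \<Longrightarrow> \<eta> n x = 0" "\<And>n x. 1 \<le> n \<Longrightarrow> x \<notin> fatten n (3 * a n) \<Longrightarrow>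
        \<eta> n x = 1"
    by (rule exists_bumps) (rule that)
  define P where "P m = {n \<in> I. prec n m}" for m
  have P: "P m \<subseteq> I - {m}" "finite (P m)" for m using I(1) prec_irrefl by (auto simp: P_def)
  have PI: "1 \<le> n" "n \<in> I" if "n \<in> P m" for n m using that I1 P by blast+
  define \<tau> where "\<tau> m x = w m * (b m x * (\<Prod>n\<in>P m. \<eta> n x))" for m x
  define \<sigma> where "\<sigma> x = (\<Sum>m\<in>I. \<tau> m x)" for x
  have prod01: "0 \<le> (\<Prod>n\<in>P m. \<eta> n x)" "(\<Prod>n\<in>P m. \<eta> n x) \<le> 1" for m x
    using \<eta>(2)[OF PI(1)] by (auto intro!: prod_nonneg prod_le_1)
  have w0: "0 \<le> w m" if "m \<in> I" for m using weight_pos[of m] I1[OF that] by (simp add: less_imp_le)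
  have \<tau>0: "0 \<le> \<tau> m x" if "m \<in> I" for m x
    unfolding \<tau>_def using w0[OF that] b(2)[of m x] I1[OF that] prod01
        by (intro mult_nonneg_nonneg) auto
  have \<tau>_le: "ennreal (\<tau> m x) \<le> ennreal (w m) * indicator (trimmed I m) x" if m: "m \<in> I" for m x
  proof (cases "x \<in> trimmed I m")
    case True
    have "b m x * (\<Prod>n\<in>P m. \<eta> n x) \<le> 1 * 1"
      using b(2)[of m x] I1[OF m] prod01[where m = m and x = x] by (intro mult_mono) auto
    then have "\<tau> m x \<le> w m * 1" unfolding \<tau>_def using w0[OF m] by (intro mult_left_mono) auto
    with True show ?thesis by (simp add: ennreal_leI)
  next
    case False
    then consider "x \<notin> target m" | n where "n \<in> P m" "x \<in> fatten n (2 * a n)"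
      by (auto simp: trimmed_def P_def)
    then have "\<tau> m x = 0"
    proof cases
      case 1
      then show ?thesis using b(4) I1[OF m] by (simp add: \<tau>_def)
    next
      case 2
      then have "\<eta> n x = 0" using \<eta>(3) I1 P by blast
      then have "(\<Prod>n\<in>P m. \<eta> n x) = 0" using 2 P(2) by (intro prod_zero) auto
      then show ?thesis by (simp add: \<tau>_def)
    qed
    then show ?thesis by simp
  qed
  have [measurable]: "trimmed I m \<in> sets borel" for m using I(1) by (rule trimmed_sets)
  have cont\<tau>: "continuous_on UNIV (\<tau> m)" if "m \<in> I" for m
    unfolding \<tau>_def using b(1)[OF I1(1)[OF that]] \<eta>(1)[OF PI(1)]
    by (intro continuous_intros continuous_on_prod) auto
  have cont: "continuous_on UNIV \<sigma>"
    unfolding \<sigma>_def by (intro continuous_on_sum cont\<tau>)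
  have [measurable]: "\<tau> m \<in> borel_measurable borel" if "m \<in> I" for m
    using cont\<tau>[OF that] by (rule borel_measurable_continuous_onI)
  have [measurable]: "\<sigma> \<in> borel_measurable borel"
    using cont by (rule borel_measurable_continuous_onI)
  have e\<sigma>: "ennreal (\<sigma> x) = (\<Sum>m\<in>I. ennreal (\<tau> m x))" for x
    unfolding \<sigma>_def using \<tau>0 by (simp add: sum_ennreal)
  show thesis
  proof (rule that[of I \<sigma>])
    show "finite I" by fact
    show "N \<le> n \<and> 1 \<le> n" if "n \<in> I" for n using I1[OF that] by simp
    show "continuous_on UNIV \<sigma>" by fact
    show "0 \<le> \<sigma> x" for x unfolding \<sigma>_def using \<tau>0 by (intro sum_nonneg)
    show "x \<in> (\<Union>n\<in>I. target n)" if "\<sigma> x \<noteq> 0" for x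
    proof -
      from that obtain m where m: "m \<in> I" "\<tau> m x \<noteq> 0" unfolding \<sigma>_def by (meson sum.neutral)
      then have "x \<in> target m" using b(4)[of m x] I1 by (force simp: \<tau>_def)
      with m show ?thesis by blast
    qed
  next
    fix x and r :: real assume r: "0 < r"
    have "(\<integral>\<^sup>+y. ennreal (\<sigma> y) * indicator (max_cball x r) y \<partial>lborel) \<le>
        (\<integral>\<^sup>+y. (\<Sum>m\<in>I. ennreal (w m) * indicator (max_cball x r \<inter> trimmed I m) y) \<partial>lborel)"
    proof (rule nn_integral_mono)
      fix y
      have "ennreal (\<sigma> y) \<le> (\<Sum>m\<in>I. ennreal (w m) * indicator (trimmed I m) y)"
        unfolding e\<sigma> by (intro sum_mono \<tau>_le)
      then show "ennreal (\<sigma> y) * indicator (max_cball x r) y \<le>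
          (\<Sum>m\<in>I. ennreal (w m) * indicator (max_cball x r \<inter> trimmed I m) y)"
        by (auto simp: indicator_def)
    qed
    also have "\<dots> = (\<Sum>m\<in>I. ennreal (w m) * emeasure lborel (max_cball x r \<inter> trimmed I m))"
      by (subst nn_integral_sum) (auto simp: nn_integral_cmult)
    also have "\<dots> \<le> ennreal (ball_const * (\<Theta> r * r ^ CARD('n)))"
      using I(1) I1(1) r by (rule sum_trimmed_ball_le)
    finally show "(\<integral>\<^sup>+y. ennreal (\<sigma> y) * indicator (max_cball x r) y \<partial>lborel) \<le>
        ennreal (ball_const * (\<Theta> r * r ^ CARD('n)))" .
  next
    fix s :: "'n \<Rightarrow> real" assume "\<forall>i. 0 \<le> s i \<and> s i + \<delta> \<le> 1"
    then have s: "0 \<le> s i \<and> s i + \<delta> \<le> 1" for i by blast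
    let ?H = "box_product (\<lambda>i. {s i + \<delta> / 4..s i + 3 * \<delta> / 4})"
    have [measurable]: "?H \<in> sets borel" by (rule box_product_sets) simp
    have fine: "p i n \<le> \<delta> / 8" if "n \<in> I" for i n using N0(2) I1[OF that] by blast
    have \<delta>d: "0 < \<delta> ^ CARD('n)" using assms by simp
    define C where "C = core_const * \<delta> ^ CARD('n)"
    have C0: "0 < C" using const_pos \<delta>d by (simp add: C_def)
    have \<rho>0: "0 \<le> \<rho> n" if "n \<in> I" for n using that proportion_bounds[of n] I1
        by (simp add: less_imp_le)
    have S0: "0 < sum \<rho> I" using \<kappa>(1) const_pos by linarith
    have core_ge: "ennreal (C * \<rho> m) \<le> ennreal (w m) * emeasure lborel (?H \<inter> core m)" if m: "m \<in> I"
        for m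
    proof -
      have "ennreal ((c * (\<delta> / 2) / 4) ^ CARD('n) * (\<Prod>i\<in>UNIV. q i m / p i m)) \<le>
          emeasure lborel (box_product (\<lambda>i. {s i + \<delta> / 4..s i + \<delta> / 4 + \<delta> / 2}) \<inter> core m)"
      proof (rule emeasure_core_cube_ge)
        show "1 \<le> m" using I1[OF m] by simp
        fix i
        show "0 \<le> s i + \<delta> / 4" "s i + \<delta> / 4 + \<delta> / 2 \<le> 1" using s[of i] assms by linarith+
        show "4 * p i m \<le> \<delta> / 2" using fine[OF m, of i] by linarith
      qed
      moreover have "s i + \<delta> / 4 + \<delta> / 2 = s i + 3 * \<delta> / 4" for i by simp
      ultimately have "ennreal (w m) *
          ennreal ((c * (\<delta> / 2) / 4) ^ CARD('n) * (\<Prod>i\<in>UNIV. q i m / p i m)) \<le>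
          ennreal (w m) * emeasure lborel (?H \<inter> core m)"
        by (intro mult_left_mono) (simp_all only: zero_le)
      also have "ennreal (w m) * ennreal ((c * (\<delta> / 2) / 4) ^ CARD('n) * (\<Prod>i\<in>UNIV. q i m / p i m)) =
          ennreal (w m * ((c * (\<delta> / 2) / 4) ^ CARD('n) * (\<Prod>i\<in>UNIV. q i m / p i m)))"
        using w0[OF m] by (intro ennreal_mult'[symmetric])
      also have "w m * ((c * (\<delta> / 2) / 4) ^ CARD('n) * (\<Prod>i\<in>UNIV. q i m / p i m)) = C * \<rho> m"
      proof -
        have "(\<Prod>i\<in>UNIV. q i m) \<noteq> 0" using q_pos[of m] I1[OF m]
            by (simp add: less_imp_neq[symmetric])
        then have "w m * (\<Prod>i\<in>UNIV. q i m / p i m) = \<rho> m"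
          unfolding weight_def proportion_eq by (simp add: prod_dividef)
        moreover have "(c * (\<delta> / 2) / 4) ^ CARD('n) = C"
          unfolding C_def core_const_def by (simp flip: power_mult_distrib)
        ultimately show ?thesis by (simp add: mult.left_commute)
      qed
      finally show ?thesis .
    qed
    have "ennreal (C * sum \<rho> I) = (\<Sum>m\<in>I. ennreal (C * \<rho> m))"
      using C0 \<rho>0 by (subst sum_ennreal) (auto simp: sum_distrib_left)
    also have "\<dots> \<le> (\<Sum>m\<in>I. ennreal (w m) * emeasure lborel (?H \<inter> core m))"
      by (intro sum_mono core_ge)
    also have "\<dots> = (\<integral>\<^sup>+y. (\<Sum>m\<in>I. ennreal (w m) * indicator (?H \<inter> core m) y) \<partial>lborel)"
      by (subst nn_integral_sum) (auto simp: nn_integral_cmult)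
    also have "\<dots> \<le> (\<integral>\<^sup>+y. ennreal (\<sigma> y) * indicator ?H y +
        (\<Sum>m\<in>I. \<Sum>n\<in>P m. ennreal (w m) * indicator (?H \<inter> fatten n (3 * a n) \<inter> target m) y) \<partial>lborel)"
    proof (rule nn_integral_mono)
      fix y
      \<comment> \<open>On the core \<open>b m y = 1\<close>, so \<open>prod_one_minus_ge\<close>
        bounds the loss by \<open>w m\<close> for each preceding level whose fattened target
        contains \<open>y\<close>.\<close>
      have "ennreal (w m) * indicator (?H \<inter> core m) y \<le> ennreal (\<tau> m y) * indicator ?H y +
          (\<Sum>n\<in>P m. ennreal (w m) * indicator (?H \<inter> fatten n (3 * a n) \<inter> target m) y)" if m: "m \<in>
              I" for m
      proof (cases "y \<in> ?H \<inter> core m")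
        case True
        let ?B = "{n. y \<in> fatten n (3 * a n)}"
        have tm: "y \<in> target m" using True core_subset I1[OF m] by blast
        have "1 \<le> (\<Prod>n\<in>P m. \<eta> n y) + real (card (P m \<inter> ?B))"
        proof (rule prod_one_minus_ge)
          show "0 \<le> \<eta> n y \<and> \<eta> n y \<le> 1" if "n \<in> P m" for n using \<eta>(2)[OF PI(1)[OF that]] .
          show "\<eta> n y = 1" if "n \<in> P m" "n \<notin> ?B" for n using \<eta>(4)[OF PI(1)[OF that(1)]] that(2)
              by simp
        qed (rule P(2))
        then have "w m * 1 \<le> w m * ((\<Prod>n\<in>P m. \<eta> n y) + real (card (P m \<inter> ?B)))"
          using w0[OF m] by (rule mult_left_mono)
        also have "\<dots> = \<tau> m y + w m * real (card (P m \<inter> ?B))"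
          using True b(3) I1[OF m] by (simp add: \<tau>_def distrib_left)
        finally have le: "w m * 1 \<le> \<tau> m y + w m * real (card (P m \<inter> ?B))" .
        have "ennreal (w m) \<le> ennreal (\<tau> m y) + ennreal (w m * real (card (P m \<inter> ?B)))"
        proof -
          from le have "ennreal (w m) \<le> ennreal (\<tau> m y + w m * real (card (P m \<inter> ?B)))"
            by (intro ennreal_leI) simp
          then show ?thesis using \<tau>0[OF m, of y] w0[OF m] by (simp add: ennreal_plus)
        qed
        also have "ennreal (w m * real (card (P m \<inter> ?B))) =
            (\<Sum>n\<in>P m. ennreal (w m) * indicator (?H \<inter> fatten n (3 * a n) \<inter> target m) y)"
        proof -
          have "(\<Sum>n\<in>P m. ennreal (w m) * indicator (?H \<inter> fatten n (3 * a n) \<inter> target m) y) =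
              (\<Sum>n\<in>P m. if n \<in> ?B then ennreal (w m) else 0)"
            using True tm by (intro sum.cong refl)
                (auto simp: indicator_def simp del: mem_box_product)
          also have "\<dots> = of_nat (card (P m \<inter> ?B)) * ennreal (w m)"
            using P(2) by (simp add: sum.If_cases)
          also have "\<dots> = ennreal (w m * real (card (P m \<inter> ?B)))"
            using w0[OF m] by (simp add: ennreal_mult' ennreal_of_nat_eq_real_of_nat mult.commute)
          finally show ?thesis by simp
        qed
        finally show ?thesis using True by (simp del: mem_box_product)
      qed simp
      then have "(\<Sum>m\<in>I. ennreal (w m) * indicator (?H \<inter> core m) y) \<le>
         (\<Sum>m\<in>I. ennreal (\<tau> m y) * indicator ?H y +
             (\<Sum>n\<in>P m. ennreal (w m) * indicator (?H \<inter> fatten n (3 * a n) \<inter> target m) y))"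
        by (rule sum_mono)
      then show "(\<Sum>m\<in>I. ennreal (w m) * indicator (?H \<inter> core m) y) \<le>
          ennreal (\<sigma> y) * indicator ?H y +
         (\<Sum>m\<in>I. \<Sum>n\<in>P m. ennreal (w m) * indicator (?H \<inter> fatten n (3 * a n) \<inter> target m) y)"
        by (simp add: sum.distrib e\<sigma> sum_distrib_right del: mem_box_product)
    qed
    also have "\<dots> = (\<integral>\<^sup>+y. ennreal (\<sigma> y) * indicator ?H y \<partial>lborel) +
        (\<Sum>m\<in>I. \<Sum>n\<in>P m. ennreal (w m) * emeasure lborel (?H \<inter> fatten n (3 * a n) \<inter> target m))"
      by (subst nn_integral_add)
          (auto simp: nn_integral_sum nn_integral_cmult simp del: mem_box_product)
    also have "(\<Sum>m\<in>I. \<Sum>n\<in>P m. ennreal (w m) *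
        emeasure lborel (?H \<inter> fatten n (3 * a n) \<inter> target m)) \<le> ennreal (C / 2 * sum \<rho> I)"
    proof -
      let ?t = "\<lambda>m n. \<rho> n * \<rho> m + 2 ^ CARD('n) * ((\<rho> n + \<rho> m) / 2 ^ (max n m - min n m))"
      let ?K = "pair_const * \<delta> ^ CARD('n)"
      have K0: "0 < ?K" using const_pos \<delta>d by simp
      have t0: "0 \<le> ?t m n" if "m \<in> I" "n \<in> I" for m n
        using \<rho>0[OF that(1)] \<rho>0[OF that(2)]
            by (intro add_nonneg_nonneg mult_nonneg_nonneg divide_nonneg_nonneg) auto
      have "(\<Sum>m\<in>I. \<Sum>n\<in>P m. ennreal (w m) * emeasure lborel (?H \<inter> fatten n (3 * a n) \<inter> target m)) \<le>
          (\<Sum>m\<in>I. \<Sum>n\<in>P m. ennreal (?K * ?t m n))"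
      proof (intro sum_mono)
        fix m n assume mn: "m \<in> I" "n \<in> P m"
        then have n: "n \<in> I" "prec n m" by (auto simp: P_def)
        show "ennreal (w m) * emeasure lborel (?H \<inter> fatten n (3 * a n) \<inter> target m) \<le>
            ennreal (?K * ?t m n)"
        proof (rule overlap_le[OF _ _ n(2)])
          show "1 \<le> m" "1 \<le> n" using I1 mn n by blast+
          show "p i m \<le> \<delta> / 4" "p i n \<le> \<delta> / 4" for i
            using fine[OF mn(1), of i] fine[OF n(1), of i] assms by linarith+
        qed
      qed
      also have "\<dots> \<le> (\<Sum>m\<in>I. \<Sum>n\<in>I - {m}. ennreal (?K * ?t m n))"
        using P I(1) by (intro sum_mono sum_mono2) auto
      also have "\<dots> = ennreal (?K * (\<Sum>m\<in>I. \<Sum>n\<in>I - {m}. ?t m n))"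
      proof -
        have nn: "0 \<le> ?K * ?t m n" if "m \<in> I" "n \<in> I - {m}" for m n
          using mult_nonneg_nonneg[OF less_imp_le[OF K0] t0[OF that(1)]] that(2) by blast
        have "(\<Sum>m\<in>I. \<Sum>n\<in>I - {m}. ennreal (?K * ?t m n)) = (\<Sum>m\<in>I. ennreal (\<Sum>n\<in>I - {m}. ?K * ?t m n))"
          by (intro sum.cong refl sum_ennreal nn)
        also have "\<dots> = ennreal (\<Sum>m\<in>I. \<Sum>n\<in>I - {m}. ?K * ?t m n)"
          by (intro sum_ennreal sum_nonneg nn)
        finally show ?thesis by (simp only: sum_distrib_left)
      qed
      also have "\<dots> \<le> ennreal (?K * ((2 * kappa + \<bar>2 ^ CARD('n)\<bar> * (8 / 2 ^ G)) * sum \<rho> I))"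
        using K0 const_pos I1 I \<kappa>(2) G0
        by (intro ennreal_leI mult_left_mono sum_interactions_le[where g = g])
            (auto simp: less_imp_le)
      also have "\<dots> \<le> ennreal (C / 2 * sum \<rho> I)"
      proof (rule ennreal_leI)
        \<comment> \<open>The products and the gaps cost a quarter of the core mass each, so half of
          it survives the trimming.\<close>
        have "pair_const * (2 * kappa) = core_const / 4"
          unfolding kappa_def using const_pos by (simp add: field_simps)
        moreover have "pair_const * (\<bar>2 ^ CARD('n)\<bar> * (8 / 2 ^ G)) \<le> core_const / 4"
          using G by (simp add: field_simps)
        ultimately have "pair_const * (2 * kappa + \<bar>2 ^ CARD('n)\<bar> * (8 / 2 ^ G)) \<le> core_const / 2"
          by (simp add: distrib_left)
        then have "pair_const * (2 * kappa + \<bar>2 ^ CARD('n)\<bar> * (8 / 2 ^ G)) *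
            (\<delta> ^ CARD('n) * sum \<rho> I) \<le> core_const / 2 * (\<delta> ^ CARD('n) * sum \<rho> I)"
          using \<delta>d S0 by (intro mult_right_mono) auto
        then show "?K * ((2 * kappa + \<bar>2 ^ CARD('n)\<bar> * (8 / 2 ^ G)) * sum \<rho> I) \<le> C / 2 * sum \<rho> I"
          unfolding C_def by (simp add: mult_ac)
      qed
      finally show ?thesis .
    qed
    finally have fin: "ennreal (C * sum \<rho> I) \<le>
        (\<integral>\<^sup>+y. ennreal (\<sigma> y) * indicator ?H y \<partial>lborel) + ennreal (C / 2 * sum \<rho> I)"
      by (simp add: add_left_mono)
    have "ennreal (C / 2 * sum \<rho> I) \<le> (\<integral>\<^sup>+y. ennreal (\<sigma> y) * indicator ?H y \<partial>lborel)"
    proof -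
      have "C * sum \<rho> I = C / 2 * sum \<rho> I + C / 2 * sum \<rho> I" by simp
      then have "ennreal (C * sum \<rho> I) = ennreal (C / 2 * sum \<rho> I) + ennreal (C / 2 * sum \<rho> I)"
        using C0 S0 by (metis ennreal_plus half_gt_zero less_imp_le mult_pos_pos)
      with fin show ?thesis by (simp add: ennreal_add_left_cancel_le add.commute)
    qed
    moreover have "mass_const * \<delta> ^ CARD('n) \<le> C / 2 * sum \<rho> I"
      using mult_left_mono[OF \<kappa>(1), of "C / 2"] C0 by (simp add: mass_const_def C_def mult_ac)
    ultimately show "ennreal (mass_const * \<delta> ^ CARD('n)) \<le>
        (\<integral>\<^sup>+y. ennreal (\<sigma> y) * indicator ?H y \<partial>lborel)"
      using ennreal_leI order_trans by blast
  qed
qed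

end

section \<open>Cube covers and null sets\<close>

definition unit_cube :: "(real ^ 'n) set" where
  "unit_cube = {x. \<forall>i. x $ i \<in> {0..1}}"

lemma unit_cube_eq: "unit_cube = box_product (\<lambda>i. {0..1})"
  by (auto simp: unit_cube_def)

lemma unit_cube_sets [measurable, simp]: "unit_cube \<in> sets borel"
  by (simp add: unit_cube_eq)

lemma emeasure_unit_cube: "emeasure lborel (unit_cube :: (real ^ 'n) set) = 1"
  unfolding unit_cube_eq by (simp add: emeasure_box_product)

lemma cube_is_max_cball:
  "box_product (\<lambda>i. {s i..s i + \<delta>}) = max_cball (\<chi> i. s i + \<delta> / 2) (\<delta> / 2)"
proof -
  have "{s i..s i + \<delta>} = {(\<chi> i. s i + \<delta> / 2) $ i - \<delta> / 2..(\<chi> i. s i + \<delta> / 2) $ i + \<delta> / 2}" for i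
    by simp
  then show ?thesis unfolding max_cball_eq by (simp add: add.commute)
qed

text \<open>The cubes obtained from \<open>measurable_outer_intervals_bounded\<close> have disjoint
  interiors, so their volumes add up to the volume of the union. Finite subfamilies suffice for the
  later uses.\<close>

lemma exists_cube_cover:
  fixes S :: "(real ^ 'n) set"
  assumes S: "S \<in> sets borel" "S \<subseteq> unit_cube" and "0 < e"
  obtains \<D> where "countable \<D>"
    "\<And>K. K \<in> \<D> \<Longrightarrow> \<exists>s \<delta>. 0 < \<delta> \<and> (\<forall>i. 0 \<le> s i \<and> s i + \<delta> \<le> 1) \<and> K = box_product (\<lambda>i. {s i..s i + \<delta>})"
    "S \<subseteq> \<Union>\<D>"
    "\<And>\<F>. finite \<F> \<Longrightarrow> \<F> \<subseteq> \<D> \<Longrightarrow> (\<Sum>K\<in>\<F>. emeasure lborel K) \<le> emeasure lborel S + ennreal e"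
proof -
  let ?o = "(\<chi> i. 1) :: real ^ 'n"
  have cb: "cbox 0 ?o = unit_cube" by (auto simp: mem_box_cart unit_cube_def)
  have Sl: "S \<in> lmeasurable"
    using S by (intro bounded_set_imp_lmeasurable bounded_subset[OF bounded_cbox[of 0 ?o]])
        (auto simp: cb)
  obtain \<D> where \<D>: "countable \<D>"
    "\<And>K. K \<in> \<D> \<Longrightarrow> K \<subseteq> cbox 0 ?o \<and> K \<noteq> {} \<and> (\<exists>c d. K = cbox c d)"
    "pairwise (\<lambda>A B. interior A \<inter> interior B = {}) \<D>"
    "\<And>u v. cbox u v \<in> \<D> \<Longrightarrow> \<exists>n. \<forall>i \<in> Basis. v \<bullet> i - u \<bullet> i = (?o \<bullet> i - 0 \<bullet> i)/2^n"
    "S \<subseteq> \<Union>\<D>" "\<Union>\<D> \<in> lmeasurable" "measure lebesgue (\<Union>\<D>) \<le> measure lebesgue S + e"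
    using measurable_outer_intervals_bounded[OF Sl, of 0 ?o e] S(2) \<open>0 < e\<close> unfolding cb by metis
  have cube: "\<exists>s \<delta>. 0 < \<delta> \<and> (\<forall>i. 0 \<le> s i \<and> s i + \<delta> \<le> 1) \<and> K = box_product (\<lambda>i. {s i..s i + \<delta>})"
      if K: "K \<in> \<D>" for K
  proof -
    obtain c d where cd: "K = cbox c d" "cbox c d \<noteq> {}" "cbox c d \<subseteq> unit_cube" using \<D>(2)[OF K]
        unfolding cb by metis
    with K \<D>(4) obtain n where n: "\<forall>i \<in> Basis. d \<bullet> i - c \<bullet> i = (?o \<bullet> i - 0 \<bullet> i)/2^n" by blast
    \<comment> \<open>All sides are \<open>1 / 2 ^ n\<close> times those of the unit cube, so the
      boxes are cubes.\<close>
    have d: "d $ i = c $ i + 1 / 2 ^ n" for i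
      using n[rule_format, of "axis i 1"] by (simp add: axis_in_Basis_iff inner_axis algebra_simps)
    then have ne: "c \<in> cbox c d" "d \<in> cbox c d" by (auto simp: mem_box_cart)
    then have "c \<in> unit_cube" "d \<in> unit_cube" using cd(3) by auto
    then have "\<forall>i. 0 \<le> c $ i \<and> c $ i + 1 / 2 ^ n \<le> 1" using d by (auto simp: unit_cube_def)
    moreover have "K = box_product (\<lambda>i. {c $ i..c $ i + 1 / 2 ^ n})"
      unfolding cd(1) by (auto simp: mem_box_cart d)
    ultimately show ?thesis by (intro exI[of _ "\<lambda>i. c $ i"] exI[of _ "1 / 2 ^ n"]) simp
  qed
  have lm: "K \<in> lmeasurable" "K \<in> sets borel" if "K \<in> \<D>" for K using \<D>(2)[OF that] by auto
  have lborel_eq_measure: "emeasure lborel A = ennreal (measure lebesgue A)"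
    if "A \<subseteq> unit_cube" "A \<in> sets borel" for A :: "(real ^ 'n) set"
  proof -
    have "emeasure lborel A \<le> 1" using emeasure_mono[OF that(1), of lborel]
        by (simp add: emeasure_unit_cube)
    then have "emeasure lborel A = ennreal (measure lborel A)"
      by (intro emeasure_eq_ennreal_measure) (auto simp: top_unique)
    with that(2) show ?thesis by simp
  qed
  have "(\<Sum>K\<in>\<F>. emeasure lborel K) \<le> emeasure lborel S + ennreal e" if \<F>: "finite \<F>" "\<F> \<subseteq> \<D>" for \<F>
  proof -
    have "emeasure lborel K = ennreal (measure lebesgue K)" if "K \<in> \<F>" for K
      using that \<F>(2) \<D>(2)[of K] lm(2)[of K] by (intro lborel_eq_measure) (auto simp: cb)
    then have "(\<Sum>K\<in>\<F>. emeasure lborel K) = ennreal (\<Sum>K\<in>\<F>. measure lebesgue K)"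
      by (simp add: sum_ennreal)
    also have "(\<Sum>K\<in>\<F>. measure lebesgue K) = measure lebesgue (\<Union>\<F>)"
    proof (rule measure_negligible_finite_Union[symmetric])
      show "pairwise (\<lambda>S T. negligible (S \<inter> T)) \<F>"
      proof (rule pairwiseI)
        fix A B assume AB: "A \<in> \<F>" "B \<in> \<F>" "A \<noteq> B"
        then have "interior (A \<inter> B) = {}" using \<D>(3) \<F> by (auto simp: pairwise_def)
        moreover have "convex (A \<inter> B)" using AB \<F> \<D>(2) by (metis convex_Int convex_box(1) subsetD)
        ultimately show "negligible (A \<inter> B)" using negligible_convex_interior by blast
      qed
    qed (use \<F> lm in auto)
    also have "ennreal (measure lebesgue (\<Union>\<F>)) \<le> ennreal (measure lebesgue S + e)"
    proof (rule ennreal_leI)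
      have "\<Union>\<F> \<in> lmeasurable" using \<F> lm by (intro fmeasurable.finite_Union) auto
      then have "measure lebesgue (\<Union>\<F>) \<le> measure lebesgue (\<Union>\<D>)"
        using \<F> \<D>(6) by (intro measure_mono_fmeasurable) auto
      with \<D>(7) show "measure lebesgue (\<Union>\<F>) \<le> measure lebesgue S + e" by simp
    qed
    also have "\<dots> = emeasure lborel S + ennreal e"
    proof -
      have "emeasure lborel S = ennreal (measure lebesgue S)"
        using S(2,1) by (rule lborel_eq_measure)
      then show ?thesis using \<open>0 < e\<close> by (simp add: ennreal_plus)
    qed
    finally show ?thesis .
  qed
  with \<D>(1,5) cube show thesis by (intro that[of \<D>]) blast+
qed

text \<open>The cubes of an efficient cover would otherwise capture too little of \<open>S\<close>.\<close>

lemma null_if_proportion_le: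
  fixes S :: "(real ^ 'n) set"
  assumes S: "S \<in> sets borel" "S \<subseteq> unit_cube" and \<theta>: "0 \<le> \<theta>" "\<theta> < 1"
    and le: "\<And>s \<delta>. 0 < \<delta> \<Longrightarrow> (\<And>i. 0 \<le> s i \<and> s i + \<delta> \<le> 1) \<Longrightarrow>
      emeasure lborel (S \<inter> box_product (\<lambda>i. {s i..s i + \<delta>})) \<le> ennreal \<theta> * emeasure lborel
          (box_product (\<lambda>i. {s i..s i + \<delta>}))"
  shows "emeasure lborel S = 0"
proof -
  have fin: "emeasure lborel S \<le> 1"
    using emeasure_mono[OF S(2), of lborel] by (simp add: emeasure_unit_cube)
  then obtain m where m: "emeasure lborel S = ennreal m" "0 \<le> m" "m \<le> 1"
    by (cases "emeasure lborel S") (auto simp: top_unique)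
  have bound: "m \<le> \<theta> * (m + e)" if e: "0 < e" for e
  proof -
    obtain \<D> where \<D>: "countable \<D>"
      "\<And>K. K \<in> \<D> \<Longrightarrow> \<exists>s \<delta>. 0 < \<delta> \<and> (\<forall>i. 0 \<le> s i \<and> s i + \<delta> \<le> 1) \<and> K = box_product (\<lambda>i. {s i..s i + \<delta>})"
      "S \<subseteq> \<Union>\<D>"
      "\<And>\<F>. finite \<F> \<Longrightarrow> \<F> \<subseteq> \<D> \<Longrightarrow> (\<Sum>K\<in>\<F>. emeasure lborel K) \<le> emeasure lborel S + ennreal e"
      using exists_cube_cover[OF S e] by blast
    \<comment> \<open>\<open>A n\<close> is the cube with index \<open>n\<close>, or empty; this
      makes a sequence out of a family that may be finite.\<close>
    define A where "A n = (\<Union>{K \<in> \<D>. to_nat_on \<D> K = n})" for n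
    have A1: "A (to_nat_on \<D> K) = K" if "K \<in> \<D>" for K
    proof -
      have "{K' \<in> \<D>. to_nat_on \<D> K' = to_nat_on \<D> K} = {K}" using that \<D>(1) by auto
      then show ?thesis by (simp add: A_def)
    qed
    have A2: "A n = {} \<or> (A n \<in> \<D> \<and> to_nat_on \<D> (A n) = n)" for n
    proof (cases "\<exists>K\<in>\<D>. to_nat_on \<D> K = n")
      case True
      then show ?thesis using A1 by metis
    next
      case False
      then show ?thesis by (auto simp: A_def)
    qed
    have Ab: "A n \<in> sets borel" for n
    proof (cases "A n = {}")
      case False
      then obtain s \<delta> where "A n = box_product (\<lambda>i. {s i..s i + \<delta>})" using A2[of n] \<D>(2) by blast
      then show ?thesis by simp
    qed simp
    have part: "(\<Sum>n<N. emeasure lborel (S \<inter> A n)) \<le> ennreal (\<theta> * (m + e))" for N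
    proof -
      have "(\<Sum>n<N. emeasure lborel (S \<inter> A n)) \<le> (\<Sum>n<N. ennreal \<theta> * emeasure lborel (A n))"
      proof (rule sum_mono)
        fix n
        show "emeasure lborel (S \<inter> A n) \<le> ennreal \<theta> * emeasure lborel (A n)"
        proof (cases "A n = {}")
          case False
          then obtain s \<delta> where "0 < \<delta>" "\<forall>i. 0 \<le> s i \<and> s i + \<delta> \<le> 1"
              "A n = box_product (\<lambda>i. {s i..s i + \<delta>})"
            using A2[of n] \<D>(2) by blast
          then show ?thesis using le[of \<delta> s] by simp
        qed simp
      qed
      also have "\<dots> = ennreal \<theta> * (\<Sum>n<N. emeasure lborel (A n))" by (simp add: sum_distrib_left)
      also have "(\<Sum>n<N. emeasure lborel (A n)) = (\<Sum>n\<in>{n. n < N \<and> A n \<noteq> {}}. emeasure lborel (A n))"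
        by (rule sum.mono_neutral_right) auto
      also have "\<dots> = (\<Sum>K\<in>A ` {n. n < N \<and> A n \<noteq> {}}. emeasure lborel K)"
      proof -
        have idx: "to_nat_on \<D> (A n) = n" if "A n \<noteq> {}" for n using A2[of n] that by blast
        have "inj_on A {n. n < N \<and> A n \<noteq> {}}"
          by (rule inj_on_inverseI[of _ "to_nat_on \<D>"]) (simp add: idx)
        then show ?thesis by (simp only: sum.reindex o_def)
      qed
      also have "\<dots> \<le> emeasure lborel S + ennreal e"
        using A2 by (intro \<D>(4)) auto
      also have "\<dots> = ennreal (m + e)" using m e by (simp add: ennreal_plus)
      finally have "(\<Sum>n<N. emeasure lborel (S \<inter> A n)) \<le> ennreal \<theta> * ennreal (m + e)"
          by (simp add: mult_left_mono)
      then show ?thesis using \<theta> by (simp add: ennreal_mult')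
    qed
    have "ennreal m = emeasure lborel (\<Union>n. S \<inter> A n)"
    proof -
      have "S = (\<Union>n. S \<inter> A n)"
      proof
        show "S \<subseteq> (\<Union>n. S \<inter> A n)"
        proof
          fix x assume "x \<in> S"
          with \<D>(3) obtain K where K: "K \<in> \<D>" "x \<in> K" by blast
          then have "x \<in> S \<inter> A (to_nat_on \<D> K)" using A1 \<open>x \<in> S\<close> by blast
          then show "x \<in> (\<Union>n. S \<inter> A n)" by blast
        qed
      qed blast
      then show ?thesis using m by simp
    qed
    also have "\<dots> \<le> (\<Sum>n. emeasure lborel (S \<inter> A n))"
      using S(1) Ab by (intro emeasure_subadditive_countably) auto
    also have "\<dots> \<le> ennreal (\<theta> * (m + e))"
      using part by (intro suminf_le_const) auto
    finally show ?thesis using \<theta> m e by (simp add: ennreal_le_iff)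
  qed
  have "m \<le> \<theta> * m + e" if e: "0 < e" for e
  proof -
    have "\<theta> * e \<le> 1 * e" using \<theta> e by (intro mult_right_mono) auto
    with bound[OF e] show ?thesis by (simp add: distrib_left)
  qed
  then have "m \<le> \<theta> * m" by (rule field_le_epsilon)
  then have "(1 - \<theta>) * m \<le> 0" by (simp add: left_diff_distrib)
  with \<theta> m have "m = 0" by (simp add: mult_le_0_iff)
  with m show ?thesis by simp
qed

section \<open>Hausdorff content of unions, and sets of Lebesgue measure zero\<close>

lemma sum_ennreal_le_UN:
  fixes g :: "'a \<Rightarrow> ennreal"
  assumes "finite F" "F \<subseteq> (\<Union>n. B n)"
  shows "sum g F \<le> (\<Sum>n. \<Sum>\<^sub>\<infinity>x\<in>B n. g x)"
proof -
  have "\<forall>x\<in>F. \<exists>n. x \<in> B n" using assms by auto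
  then obtain k where k: "\<And>x. x \<in> F \<Longrightarrow> x \<in> B (k x)" by metis
  have "sum g F = (\<Sum>n\<in>k ` F. \<Sum>x\<in>{x \<in> F. k x = n}. g x)"
    using assms(1) by (rule sum.image_gen)
  also have "\<dots> \<le> (\<Sum>n\<in>k ` F. \<Sum>\<^sub>\<infinity>x\<in>B n. g x)"
  proof (rule sum_mono)
    fix n
    have "sum g {x \<in> F. k x = n} = (\<Sum>\<^sub>\<infinity>x\<in>{x \<in> F. k x = n}. g x)" using assms(1) by simp
    also have "\<dots> \<le> (\<Sum>\<^sub>\<infinity>x\<in>B n. g x)" using k
        by (intro infsum_mono_neutral) (auto intro: nonneg_summable_on_complete)
    finally show "sum g {x \<in> F. k x = n} \<le> (\<Sum>\<^sub>\<infinity>x\<in>B n. g x)" .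
  qed
  also have "\<dots> \<le> (\<Sum>n. \<Sum>\<^sub>\<infinity>x\<in>B n. g x)" using assms(1) by (intro sum_le_suminf) auto
  finally show ?thesis .
qed

lemma infsum_UN_le:
  fixes g :: "'a \<Rightarrow> ennreal"
  shows "(\<Sum>\<^sub>\<infinity>x\<in>(\<Union>n :: nat. B n). g x) \<le> (\<Sum>n. \<Sum>\<^sub>\<infinity>x\<in>B n. g x)"
  by (subst nonneg_infsum_complete) (auto intro!: SUP_least sum_ennreal_le_UN)

lemma hausdorff_content_le:
  "\<B> \<in> ball_covers \<eta> A \<Longrightarrow> hausdorff_content f \<eta> A \<le> (\<Sum>\<^sub>\<infinity>B\<in>\<B>. ennreal (f (max_diameter B)))"
  unfolding hausdorff_content_def by (rule INF_lower)

lemma hausdorff_content_UN_le: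
  assumes "\<And>n. \<B> n \<in> ball_covers \<eta> (A n)" "S \<subseteq> (\<Union>n :: nat. A n)"
    "\<And>n. (\<Sum>\<^sub>\<infinity>B\<in>\<B> n. ennreal (f (max_diameter B))) \<le> c n"
  shows "hausdorff_content f \<eta> S \<le> (\<Sum>n. c n)"
proof -
  have "(\<Union>n. \<B> n) \<in> ball_covers \<eta> S"
    unfolding ball_covers_def
  proof (intro CollectI conjI ballI)
    have sub: "A n \<subseteq> \<Union>(\<B> n)" for n using assms(1)[of n] by (simp add: ball_covers_def)
    show "S \<subseteq> \<Union>(\<Union>n. \<B> n)"
    proof
      fix x assume "x \<in> S"
      with assms(2) obtain n where "x \<in> A n" by blast
      with sub[of n] obtain B where "B \<in> \<B> n" "x \<in> B" by blast
      then show "x \<in> \<Union>(\<Union>n. \<B> n)" by blast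
    qed
    show "countable (\<Union>n. \<B> n)" using assms(1) by (simp add: ball_covers_def)
    fix B assume "B \<in> (\<Union>n. \<B> n)"
    then obtain n where "B \<in> \<B> n" by blast
    with assms(1)[of n] show "\<exists>x r. 0 < r \<and> B = max_cball x r" "max_diameter B \<le> \<eta>"
      by (simp_all add: ball_covers_def)
  qed
  then have "hausdorff_content f \<eta> S \<le> (\<Sum>\<^sub>\<infinity>B\<in>(\<Union>n. \<B> n). ennreal (f (max_diameter B)))"
    by (rule hausdorff_content_le)
  also have "\<dots> \<le> (\<Sum>n. \<Sum>\<^sub>\<infinity>B\<in>\<B> n. ennreal (f (max_diameter B)))" by (rule infsum_UN_le)
  also have "\<dots> \<le> (\<Sum>n. c n)" using assms(3) by (intro suminf_le) auto
  finally show ?thesis .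
qed

lemma hausdorff_measure_mono: "A \<subseteq> B \<Longrightarrow> hausdorff_measure f A \<le> hausdorff_measure f B"
proof -
  assume "A \<subseteq> B"
  then have "ball_covers \<eta> B \<subseteq> ball_covers \<eta> A" for \<eta> :: real by (auto simp: ball_covers_def)
  then show ?thesis
    unfolding hausdorff_measure_eq_SUP hausdorff_content_def
    by (intro SUP_mono) (metis INF_superset_mono order_refl)
qed

text \<open>As \<open>f r \<le> \<Lambda> * r ^ d\<close>, the cost of a cube is at most
  \<open>\<Lambda>\<close> times its volume, so a cover by cubes of small total volume is
  cheap.\<close>

lemma null_set_small_cover:
  fixes S :: "(real ^ 'n) set"
  assumes S: "S \<in> sets borel" "S \<subseteq> unit_cube" "emeasure lborel S = 0"
    and f: "\<And>r. 0 < r \<Longrightarrow> f r \<le> \<Lambda> * r ^ CARD('n)" "0 \<le> \<Lambda>" and pos: "0 < \<eta>" "0 < e"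
  obtains \<B> where "\<B> \<in> ball_covers \<eta> S" "(\<Sum>\<^sub>\<infinity>B\<in>\<B>. ennreal (f (max_diameter B))) \<le> ennreal e"
proof -
  \<comment> \<open>The bound \<open>\<eta> ^ d\<close> limits the volume, hence the side, of each
    single cube; the other bound limits the total cost.\<close>
  define e' where "e' = min (\<eta> ^ CARD('n)) (e / (\<Lambda> + 1))"
  have e': "0 < e'" "e' \<le> \<eta> ^ CARD('n)" "\<Lambda> * e' \<le> e"
  proof -
    show "0 < e'" "e' \<le> \<eta> ^ CARD('n)" using pos f(2) by (auto simp: e'_def)
    have "\<Lambda> * e' \<le> \<Lambda> * (e / (\<Lambda> + 1))" using f(2) by (intro mult_left_mono) (auto simp: e'_def)
    also have "\<dots> \<le> e" using f(2) pos by (simp add: field_simps)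
    finally show "\<Lambda> * e' \<le> e" .
  qed
  obtain \<D> where \<D>: "countable \<D>"
    "\<And>K. K \<in> \<D> \<Longrightarrow> \<exists>s \<delta>. 0 < \<delta> \<and> (\<forall>i. 0 \<le> s i \<and> s i + \<delta> \<le> 1) \<and> K = box_product (\<lambda>i. {s i..s i + \<delta>})"
    "S \<subseteq> \<Union>\<D>"
    "\<And>\<F>. finite \<F> \<Longrightarrow> \<F> \<subseteq> \<D> \<Longrightarrow> (\<Sum>K\<in>\<F>. emeasure lborel K) \<le> emeasure lborel S + ennreal e'"
    using exists_cube_cover[OF S(1,2) e'(1)] by blast
  have K: "\<exists>x \<delta>. 0 < \<delta> \<and> \<delta> \<le> \<eta> \<and> K = max_cball x (\<delta> / 2) \<and> max_diameter K = \<delta> \<and> emeasure lborel K =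
      ennreal (\<delta> ^ CARD('n))"
    if KD: "K \<in> \<D>" for K
  proof -
    obtain s \<delta> where s: "0 < \<delta>" "K = box_product (\<lambda>i. {s i..s i + \<delta>})" using \<D>(2)[OF KD] by blast
    then have K: "K = max_cball (\<chi> i. s i + \<delta> / 2) (\<delta> / 2)" by (simp add: cube_is_max_cball)
    then have diam: "max_diameter K = \<delta>" "emeasure lborel K = ennreal (\<delta> ^ CARD('n))"
      using s(1) by (simp_all add: max_diameter_max_cball emeasure_max_cball)
    have "ennreal (\<delta> ^ CARD('n)) \<le> ennreal (\<eta> ^ CARD('n))"
      using \<D>(4)[of "{K}"] KD diam(2) S(3) e'(2) by (simp add: order_trans ennreal_leI)
    then have "\<delta> ^ CARD('n) \<le> \<eta> ^ CARD('n)" using pos by (simp add: ennreal_le_iff)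
    then have "\<delta> \<le> \<eta>" using pos s(1) by (simp add: power_mono_iff)
    with s(1) K diam show ?thesis by blast
  qed
  show thesis
  proof (rule that[of \<D>])
    show "\<D> \<in> ball_covers \<eta> S"
      unfolding ball_covers_def
    proof (intro CollectI conjI ballI)
      fix B assume "B \<in> \<D>"
      then obtain x \<delta> where x: "0 < \<delta>" "\<delta> \<le> \<eta>" "B = max_cball x (\<delta> / 2)" "max_diameter B = \<delta>"
          using K by blast
      show "\<exists>x r. 0 < r \<and> B = max_cball x r"
        by (intro exI[of _ x] exI[of _ "\<delta> / 2"]) (use x in simp)
      show "max_diameter B \<le> \<eta>" using x by simp
    qed (use \<D> in auto)
    show "(\<Sum>\<^sub>\<infinity>B\<in>\<D>. ennreal (f (max_diameter B))) \<le> ennreal e"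
    proof (subst nonneg_infsum_complete, simp, rule SUP_least)
      fix F assume F: "F \<in> {F. finite F \<and> F \<subseteq> \<D>}"
      have "(\<Sum>B\<in>F. ennreal (f (max_diameter B))) \<le> (\<Sum>B\<in>F. ennreal \<Lambda> * emeasure lborel B)"
      proof (rule sum_mono)
        fix B assume "B \<in> F"
        then obtain \<delta> where \<delta>: "0 < \<delta>" "max_diameter B = \<delta>"
            "emeasure lborel B = ennreal (\<delta> ^ CARD('n))" using K F by blast
        then show "ennreal (f (max_diameter B)) \<le> ennreal \<Lambda> * emeasure lborel B"
          using f(1)[OF \<delta>(1)] f(2) by (simp add: ennreal_leI flip: ennreal_mult')
      qed
      also have "\<dots> = ennreal \<Lambda> * (\<Sum>B\<in>F. emeasure lborel B)" by (simp add: sum_distrib_left)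
      also have "\<dots> \<le> ennreal \<Lambda> * (0 + ennreal e')" using \<D>(4)[of F] F S(3)
          by (intro mult_left_mono) auto
      also have "\<dots> = ennreal (\<Lambda> * e')" using f(2) by (simp add: ennreal_mult')
      also have "\<dots> \<le> ennreal e" using e'(3) by (rule ennreal_leI)
      finally show "(\<Sum>B\<in>F. ennreal (f (max_diameter B))) \<le> ennreal e" .
    qed
  qed
qed

text \<open>Every cover of \<open>W\<close> becomes one of the cube by adding a cover of the null
  remainder at cost \<open>e\<close>.\<close>

lemma hausdorff_measure_cube_le_of_null:
  fixes W :: "(real ^ 'n) set"
  assumes W: "W \<in> sets borel" and null: "emeasure lborel (unit_cube - W) = 0"
    and f: "\<And>r. 0 < r \<Longrightarrow> f r \<le> \<Lambda> * r ^ CARD('n)" "0 \<le> \<Lambda>"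
  shows "hausdorff_measure f (unit_cube :: (real ^ 'n) set) \<le> hausdorff_measure f W"
  unfolding hausdorff_measure_eq_SUP
proof (rule SUP_mono)
  fix \<eta> :: real assume \<eta>: "\<eta> \<in> {0<..}"
  have "hausdorff_content f \<eta> (unit_cube :: (real ^ 'n) set) \<le> hausdorff_content f \<eta> W"
    unfolding hausdorff_content_def[of f \<eta> W]
  proof (rule INF_greatest)
    fix \<B> assume \<B>: "\<B> \<in> ball_covers \<eta> W"
    show "hausdorff_content f \<eta> (unit_cube :: (real ^ 'n) set) \<le>
        (\<Sum>\<^sub>\<infinity>B\<in>\<B>. ennreal (f (max_diameter B)))" (is "_ \<le> ?c")
    proof (rule ennreal_le_epsilon)
      fix e :: real assume "0 < e"
      then obtain \<N> where \<N>: "\<N> \<in> ball_covers \<eta> (unit_cube - W)"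
          "(\<Sum>\<^sub>\<infinity>B\<in>\<N>. ennreal (f (max_diameter B))) \<le> ennreal e"
        using null_set_small_cover[of "unit_cube - W" f \<Lambda> \<eta> e] W null f \<eta> by auto
      let ?X = "\<lambda>n. if n = 0 then \<B> else if n = Suc 0 then \<N> else {}"
      have "hausdorff_content f \<eta> (unit_cube :: (real ^ 'n) set) \<le>
          (\<Sum>n. if n = 0 then ?c else if n = Suc 0 then ennreal e else 0)"
      proof (rule hausdorff_content_UN_le[where \<B> = ?X and A =
          "\<lambda>n. if n = 0 then W else if n = Suc 0 then unit_cube - W else {}"])
        show "unit_cube \<subseteq> (\<Union>n. if n = 0 then W else if n = Suc 0 then unit_cube - W else {})"
        proof
          fix x :: "real ^ 'n" assume "x \<in> unit_cube"
          then show "x \<in> (\<Union>n. if n = 0 then W else if n = Suc 0 then unit_cube - W else {})"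
            by (cases "x \<in> W") (auto intro: UN_I[of 0] UN_I[of "Suc 0"])
        qed
      qed (use \<B> \<N> in \<open>auto simp: ball_covers_def\<close>)
      also have "(\<Sum>n. if n = 0 then ?c else if n = Suc 0 then ennreal e else 0) =
          (\<Sum>n\<in>{0, Suc 0}. if n = 0 then ?c else if n = Suc 0 then ennreal e else 0)"
        by (rule suminf_finite) auto
      also have "\<dots> = ?c + ennreal e" by simp
      finally show "hausdorff_content f \<eta> (unit_cube :: (real ^ 'n) set) \<le> ?c + ennreal e" .
    qed
  qed
  with \<eta> show "\<exists>m\<in>{0<..}. hausdorff_content f \<eta> (unit_cube :: (real ^ 'n) set) \<le>
      hausdorff_content f m W" by blast
qed

text \<open>The start of the iteration; the middle half of the cube provides the mass, and the rest
  leaves room for a continuous cutoff.\<close>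

lemma exists_initial_density:
  obtains g :: "real ^ 'n \<Rightarrow> real" where "continuous_on UNIV g" "\<And>x. 0 \<le> g x" "\<And>x. g x \<le> 1"
    "\<And>x. g x \<noteq> 0 \<Longrightarrow> x \<in> unit_cube" "ennreal ((1 / 2) ^ CARD('n)) \<le> (\<integral>\<^sup>+x. ennreal (g x) \<partial>lborel)"
proof -
  let ?S = "box_product (\<lambda>i. {1 / 4..3 / 4}) :: (real ^ 'n) set" and ?U =
      "box_product (\<lambda>i. {0<..<1}) :: (real ^ 'n) set"
  have c: "closed ?S" by (rule closed_box_product) simp
  have o: "open ?U" by (rule open_box_product) simp
  have "?S \<subseteq> ?U"
  proof
    fix x :: "real ^ 'n" assume x: "x \<in> ?S"
    have "x $ i \<in> {0<..<1}" for i
    proof -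
      have "1 / 4 \<le> x $ i" "x $ i \<le> 3 / 4" using x by auto
      then show ?thesis by (simp only: greaterThanLessThan_iff) linarith
    qed
    then show "x \<in> ?U" by simp
  qed
  from continuous_bump[OF c o this] obtain g where g: "continuous_on UNIV g" "\<And>x. 0 \<le> g x"
      "\<And>x. g x \<le> (1 :: real)"
    "\<And>x. x \<in> ?S \<Longrightarrow> g x = 1" "\<And>x. x \<notin> ?U \<Longrightarrow> g x = 0" by blast
  show thesis
  proof (rule that[of g])
    show "x \<in> unit_cube" if "g x \<noteq> 0" for x
    proof -
      have "x \<in> ?U" using that g(5) by blast
      then show ?thesis by (auto simp: unit_cube_def less_imp_le)
    qed
    have "ennreal ((1 / 2) ^ CARD('n)) = emeasure lborel ?S"
    proof -
      have "emeasure lborel {1 / 4..3 / 4 :: real} = ennreal (1 / 2)"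
        by (subst emeasure_lborel_Icc) auto
      then have "emeasure lborel ?S = ennreal (1 / 2) ^ CARD('n)"
        by (subst emeasure_box_product) simp_all
      then show ?thesis by (simp only: ennreal_power)
    qed
    also have "\<dots> = (\<integral>\<^sup>+x. indicator ?S x \<partial>lborel)" by simp
    also have "\<dots> \<le> (\<integral>\<^sup>+x. ennreal (g x) \<partial>lborel)"
      using g(4) by (intro nn_integral_mono) (auto simp: indicator_def simp del: mem_box_product)
    finally show "ennreal ((1 / 2) ^ CARD('n)) \<le> (\<integral>\<^sup>+x. ennreal (g x) \<partial>lborel)" .
  qed (use g in auto)
qed

section \<open>Large limsup sets\<close>

text \<open>Hausdorff covers consist of closed balls; the compactness argument needs open sets
  between a ball and its double.\<close>

definition open_cube :: "real ^ 'n \<Rightarrow> real \<Rightarrow> (real ^ 'n) set" where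
  "open_cube x r = box_product (\<lambda>i. {x $ i - r<..<x $ i + r})"

lemma open_open_cube: "open (open_cube x r)"
  unfolding open_cube_def by (rule open_box_product) simp

lemma open_cube_subset: "open_cube x r \<subseteq> max_cball x r"
  by (auto simp: open_cube_def max_cball_eq less_imp_le)

lemma max_cball_subset_open_cube: "r < r' \<Longrightarrow> max_cball x r \<subseteq> open_cube x r'"
proof
  fix y assume a: "r < r'" "y \<in> max_cball x r"
  have "y $ i \<in> {x $ i - r'<..<x $ i + r'}" for i
  proof -
    have "\<bar>y $ i - x $ i\<bar> \<le> r" using a by (simp add: mem_max_cball)
    then show ?thesis using a(1) by (simp add: abs_le_iff)
  qed
  then show "y \<in> open_cube x r'" by (simp add: open_cube_def)
qed

lemma compact_unit_cube: "compact (unit_cube :: (real ^ 'n) set)"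
proof -
  have eq: "unit_cube = cbox (0 :: real ^ 'n) (\<chi> i. 1)" by (auto simp: mem_box_cart unit_cube_def)
  show ?thesis unfolding eq by (rule compact_cbox)
qed

text \<open>A point of the shell has some coordinate in one of two slabs of width
  \<open>\<delta>\<close>; inside the unit cube the other factors are at most 1, so the bound does
  not grow with \<open>r\<close>.\<close>

lemma emeasure_cube_shell_le:
  fixes x :: "real ^ 'n" and r \<delta> :: real
  assumes "0 \<le> r" "0 \<le> \<delta>"
  shows "emeasure lborel (unit_cube \<inter> max_cball x (r + \<delta>) - max_cball x r) \<le>
      ennreal (2 * CARD('n) * \<delta>)"
proof -
  define A where "A i = box_product (\<lambda>j. if j =
      i then {x $ i - (r + \<delta>)..x $ i - r} \<union> {x $ i + r..x $ i + (r + \<delta>)} else {0..1})" for i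
  have A[measurable]: "A i \<in> sets borel" for i unfolding A_def by (intro box_product_sets) auto
  have A_le: "emeasure lborel (A i) \<le> ennreal (2 * \<delta>)" for i
  proof -
    have "emeasure lborel (A i) =
        (\<Prod>j\<in>UNIV. if j = i then emeasure lborel
        ({x $ i - (r + \<delta>)..x $ i - r} \<union> {x $ i + r..x $ i + (r + \<delta>)}) else 1)"
    proof -
      have "emeasure lborel (A i) =
          (\<Prod>j\<in>UNIV. emeasure lborel
          (if j = i then {x $ i - (r + \<delta>)..x $ i - r} \<union> {x $ i + r..x $ i + (r + \<delta>)} else {0..1}))"
        unfolding A_def by (rule emeasure_box_product) auto
      also have "\<dots> = (\<Prod>j\<in>UNIV. if j =
          i then emeasure lborel ({x $ i - (r + \<delta>)..x $ i - r} \<union> {x $ i + r..x $ i + (r + \<delta>)}) else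
          1)"
        by (rule prod.cong) auto
      finally show ?thesis .
    qed
    also have "\<dots> = emeasure lborel ({x $ i - (r + \<delta>)..x $ i - r} \<union> {x $ i + r..x $ i + (r + \<delta>)})"
      by (subst prod.delta) auto
    also have "\<dots> \<le> emeasure lborel {x $ i - (r + \<delta>)..x $ i - r} +
        emeasure lborel {x $ i + r..x $ i + (r + \<delta>)}"
      by (rule emeasure_subadditive) auto
    also have "\<dots> = ennreal (2 * \<delta>)" using assms by (simp flip: ennreal_plus)
    finally show ?thesis .
  qed
  have "unit_cube \<inter> max_cball x (r + \<delta>) - max_cball x r \<subseteq> (\<Union>i. A i)"
  proof
    fix y assume y: "y \<in> unit_cube \<inter> max_cball x (r + \<delta>) - max_cball x r"
    then obtain i where i: "\<not> \<bar>y $ i - x $ i\<bar> \<le> r" by (auto simp: mem_max_cball)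
    moreover have "\<bar>y $ i - x $ i\<bar> \<le> r + \<delta>" using y by (auto simp: mem_max_cball)
    ultimately have "y $ i \<in> {x $ i - (r + \<delta>)..x $ i - r} \<union> {x $ i + r..x $ i + (r + \<delta>)}"
      by (auto simp: abs_le_iff not_le)
    moreover have "y $ j \<in> {0..1}" for j using y by (simp add: unit_cube_def)
    ultimately have "y \<in> A i" by (simp add: A_def)
    then show "y \<in> (\<Union>i. A i)" by blast
  qed
  then have "emeasure lborel (unit_cube \<inter> max_cball x (r + \<delta>) - max_cball x r) \<le>
      emeasure lborel (\<Union>i. A i)"
    by (rule emeasure_mono) measurable
  also have "\<dots> \<le> (\<Sum>i\<in>UNIV. emeasure lborel (A i))" by (rule emeasure_subadditive_finite) auto
  also have "\<dots> \<le> (\<Sum>i\<in>(UNIV :: 'n set). ennreal (2 * \<delta>))" by (intro sum_mono A_le)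
  also have "\<dots> = ennreal (2 * CARD('n) * \<delta>)"
    using assms by (simp add: ennreal_of_nat_eq_real_of_nat mult_ac flip: ennreal_mult)
  finally show ?thesis .
qed

text \<open>Half-open cells are disjoint, and they cover the unit cube up to a null set of
  faces.\<close>

definition grid_cube :: "nat \<Rightarrow> ('n \<Rightarrow> nat) \<Rightarrow> (real ^ 'n) set" where
  "grid_cube M k = box_product (\<lambda>i. {k i / M..<(real (k i) + 1) / M})"

definition grid :: "nat \<Rightarrow> ('n :: finite \<Rightarrow> nat) set" where
  "grid M = {k. \<forall>i. k i < M}"

lemma finite_grid: "finite (grid M :: ('n :: finite \<Rightarrow> nat) set)"
proof -
  have "grid M = PiE (UNIV :: 'n set) (\<lambda>_. {..<M})" by (auto simp: grid_def PiE_def Pi_def)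
  then show ?thesis by (simp add: finite_PiE)
qed

lemma grid_cube_sets [measurable, simp]: "grid_cube M k \<in> sets borel"
  by (simp add: grid_cube_def)

lemma emeasure_grid_cube:
  assumes "0 < M"
  shows "emeasure lborel (grid_cube M k :: (real ^ 'n) set) = ennreal ((1 / M) ^ CARD('n))"
proof -
  have "emeasure lborel {k i / M..<(real (k i) + 1) / M} = ennreal (1 / M)" for i
  proof -
    have "k i / M \<le> (real (k i) + 1) / M" using assms by (intro divide_right_mono) auto
    then show ?thesis by (simp add: add_divide_distrib)
  qed
  then show ?thesis unfolding grid_cube_def
      by (subst emeasure_box_product) (simp_all add: ennreal_power)
qed

lemma grid_cube_disjoint:
  assumes "0 < M" "x \<in> grid_cube M k" "x \<in> grid_cube M k'"
  shows "k = k'"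
proof
  fix i
  have *: "j = nat \<lfloor>x $ i * M\<rfloor>" if "x $ i \<in> {j / M..<(real j + 1) / M}" for j :: nat
  proof -
    have "real j \<le> x $ i * M" "x $ i * M < j + 1" using that assms(1)
        by (simp_all add: pos_divide_le_eq pos_less_divide_eq)
    then have "\<lfloor>x $ i * M\<rfloor> = int j" by (intro floor_unique) auto
    then show ?thesis by simp
  qed
  show "k i = k' i" using *[of "k i"] *[of "k' i"] assms(2,3) by (simp add: grid_cube_def)
qed

lemma grid_cube_subset_unit_cube: "0 < M \<Longrightarrow> k \<in> grid M \<Longrightarrow> grid_cube M k \<subseteq> unit_cube"
proof
  fix x assume a: "0 < M" "k \<in> grid M" "x \<in> grid_cube M k"
  show "x \<in> unit_cube" unfolding unit_cube_def
  proof (intro CollectI allI)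
    fix i
    have "k i + 1 \<le> M" using a by (simp add: grid_def Suc_le_eq)
    then have "real (k i) + 1 \<le> M" by linarith
    then have "(real (k i) + 1) / M \<le> 1" using a by (simp add: divide_le_eq)
    moreover have "0 \<le> k i / M" by simp
    moreover have "x $ i \<in> {k i / M..<(real (k i) + 1) / M}" using a by (simp add: grid_cube_def)
    ultimately show "x $ i \<in> {0..1}" by (simp only: atLeastAtMost_iff atLeastLessThan_iff) linarith
  qed
qed

lemma unit_cube_minus_grid_null:
  assumes "0 < M"
  shows "emeasure lborel (unit_cube - (\<Union>k\<in>grid M. grid_cube M k) :: (real ^ 'n) set) = 0"
proof -
  have sub: "unit_cube - (\<Union>k\<in>grid M. grid_cube M k) \<subseteq>
      unit_cube - (box_product (\<lambda>i. {0..<1}) :: (real ^ 'n) set)"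
  proof
    fix x :: "real ^ 'n" assume x: "x \<in> unit_cube - (\<Union>k\<in>grid M. grid_cube M k)"
    have False if b: "\<forall>i. x $ i \<in> {0..<1}"
    proof -
      define k where "k i = nat \<lfloor>x $ i * M\<rfloor>" for i
      have k: "real (k i) \<le> x $ i * M" "x $ i * M < k i + 1" for i
      proof -
        have "0 \<le> x $ i * M" using b by simp
        then show "real (k i) \<le> x $ i * M" "x $ i * M < k i + 1" unfolding k_def by linarith+
      qed
      have "x $ i * M < 1 * real M" for i using b assms by (intro mult_strict_right_mono) auto
      then have "k i < M" for i using k(1)[of i] le_less_trans
          by (metis le_less_trans mult_1 of_nat_less_iff)
      moreover have "x \<in> grid_cube M k"
        using k assms by (simp add: grid_cube_def pos_divide_le_eq pos_less_divide_eq add.commute)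
      ultimately show False using x by (auto simp: grid_def)
    qed
    then show "x \<in> unit_cube - box_product (\<lambda>i. {0..<1})" using x by auto
  qed
  have "emeasure lborel (box_product (\<lambda>i. {0..<1}) :: (real ^ 'n) set) = 1"
    by (subst emeasure_box_product) simp_all
  moreover have "(box_product (\<lambda>i. {0..<1}) :: (real ^ 'n) set) \<subseteq> unit_cube"
      by (auto simp: unit_cube_def less_imp_le)
  ultimately have "emeasure lborel (unit_cube - (box_product (\<lambda>i. {0..<1}) :: (real ^ 'n) set)) = 0"
    by (subst emeasure_Diff) (auto simp: emeasure_unit_cube)
  then show ?thesis using emeasure_mono[OF sub, of lborel] by simp
qed

lemma nn_integral_grid:
  fixes g :: "real ^ 'n \<Rightarrow> ennreal"
  assumes [measurable]: "g \<in> borel_measurable borel" and "0 < M" "\<And>x. x \<notin> unit_cube \<Longrightarrow> g x = 0"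
  shows "(\<integral>\<^sup>+x. g x \<partial>lborel) = (\<Sum>k\<in>grid M. \<integral>\<^sup>+x. g x * indicator (grid_cube M k) x \<partial>lborel)"
proof -
  have "AE x in lborel. x \<notin> unit_cube - (\<Union>k\<in>grid M. grid_cube M k :: (real ^ 'n) set)"
    using unit_cube_minus_grid_null[OF assms(2)] finite_grid
    by (intro AE_not_in null_setsI) auto
  then have "AE x in lborel. g x = (\<Sum>k\<in>grid M. g x * indicator (grid_cube M k) x)"
  proof eventually_elim
    fix x :: "real ^ 'n" assume x: "x \<notin> unit_cube - (\<Union>k\<in>grid M. grid_cube M k)"
    show "g x = (\<Sum>k\<in>grid M. g x * indicator (grid_cube M k) x)"
    proof (cases "x \<in> unit_cube")
      case True
      with x obtain k where k: "k \<in> grid M" "x \<in> grid_cube M k" by blast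
      have ind: "x \<in> grid_cube M k' \<longleftrightarrow> k' = k" for k'
        using k(2) grid_cube_disjoint[OF assms(2)] by blast
      have "(\<Sum>k'\<in>grid M. g x * indicator (grid_cube M k') x) =
          (\<Sum>k'\<in>grid M. if k' = k then g x else 0)"
        by (intro sum.cong refl) (simp add: indicator_def ind)
      then show ?thesis using k by (simp add: finite_grid)
    next
      case False
      then show ?thesis using assms(3) by simp
    qed
  qed
  then have "(\<integral>\<^sup>+x. g x \<partial>lborel) = (\<integral>\<^sup>+x. (\<Sum>k\<in>grid M. g x * indicator (grid_cube M k) x) \<partial>lborel)"
    by (rule nn_integral_cong_AE)
  also have "\<dots> = (\<Sum>k\<in>grid M. \<integral>\<^sup>+x. g x * indicator (grid_cube M k) x \<partial>lborel)"
    by (rule nn_integral_sum) simp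
  finally show ?thesis .
qed

text \<open>The data of the iteration: \<open>C\<close> and \<open>m\<close> are fixed while
  \<open>\<epsilon>\<close>, \<open>\<delta>\<close> and \<open>N\<close> vary in
  \<open>density\<close>. \<open>f_dominates\<close> is the case in which \<open>r ^ d\<close> is
  negligible against \<open>f r\<close> for small \<open>r\<close>.\<close>

locale ubiquitous_targets =
  fixes T :: "nat \<Rightarrow> (real ^ 'n) set" and f :: "real \<Rightarrow> real" and C m :: real
  assumes closed_T: "closed (T n)"
    and f_mono: "0 < r \<Longrightarrow> r \<le> r' \<Longrightarrow> f r \<le> f r'" and f_pos: "0 < r \<Longrightarrow> 0 < f r"
    and f_dominates: "\<exists>r0>0. \<forall>r. 0 < r \<longrightarrow> r \<le> r0 \<longrightarrow> K * r ^ CARD('n) \<le> f r"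
    and C_pos: "0 < C" and m_pos: "0 < m"
    and density: "0 < \<epsilon> \<Longrightarrow> 0 < \<delta> \<Longrightarrow> \<exists>\<sigma> I. finite I \<and> (\<forall>n\<in>I. N \<le> n) \<and> continuous_on UNIV \<sigma> \<and>
        (\<forall>x. 0 \<le> \<sigma> x) \<and>
      (\<forall>x. \<sigma> x \<noteq> 0 \<longrightarrow> x \<in> (\<Union>n\<in>I. T n)) \<and>
      (\<forall>x r. 0 < r \<longrightarrow> (\<integral>\<^sup>+y. ennreal (\<sigma> y) * indicator (max_cball x r) y \<partial>lborel) \<le> ennreal
          (C * (r ^ CARD('n) + \<epsilon> * f r))) \<and>
      (\<forall>s. (\<forall>i. 0 \<le> s i \<and> s i + \<delta> \<le> 1) \<longrightarrow> ennreal (m * \<delta> ^ CARD('n)) \<le>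
        (\<integral>\<^sup>+y. ennreal (\<sigma> y) * indicator (box_product (\<lambda>i. {s i + \<delta> / 4..s i + 3 * \<delta> / 4})) y
            \<partial>lborel))"
begin

text \<open>Renormalising the density cell by cell of a fine grid, it becomes close to Lebesgue measure
  at large scales, without affecting its behaviour on small balls.\<close>

lemma exists_normalized_density:
  assumes "0 < \<epsilon>" "0 < (M :: nat)"
  obtains s :: "real ^ 'n \<Rightarrow> real" and t :: "('n \<Rightarrow> nat) \<Rightarrow> real ^ 'n \<Rightarrow> real" and I where "finite I"
      "\<And>n. n \<in> I \<Longrightarrow> N \<le> n" "continuous_on UNIV s"
    "\<And>x. s x \<noteq> 0 \<Longrightarrow> x \<in> (\<Union>n\<in>I. T n)"
    "\<And>x. s x = (\<Sum>k\<in>grid M. t k x)" "\<And>k x. k \<in> grid M \<Longrightarrow> 0 \<le> t k x"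
        "\<And>k. k \<in> grid M \<Longrightarrow> continuous_on UNIV (t k)"
    "\<And>k x. k \<in> grid M \<Longrightarrow> t k x \<noteq> 0 \<Longrightarrow> x \<in> grid_cube M k"
    "\<And>k. k \<in> grid M \<Longrightarrow> (\<integral>\<^sup>+x. ennreal (t k x) \<partial>lborel) = ennreal ((1 / M) ^ CARD('n))"
    "\<And>x r. 0 < r \<Longrightarrow> (\<integral>\<^sup>+y. ennreal (s y) * indicator (max_cball x r) y \<partial>lborel) \<le>
        ennreal (C / m * (r ^ CARD('n) + \<epsilon> * f r))"
proof -
  define \<delta> where "\<delta> = 1 / real M"
  have \<delta>: "0 < \<delta>" using assms(2) by (simp add: \<delta>_def)
  have "\<exists>\<sigma> I. finite I \<and> (\<forall>n\<in>I. N \<le> n) \<and> continuous_on UNIV \<sigma> \<and> (\<forall>x. 0 \<le> \<sigma> x) \<and>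
      (\<forall>x. \<sigma> x \<noteq> 0 \<longrightarrow> x \<in> (\<Union>n\<in>I. T n)) \<and>
      (\<forall>x r. 0 < r \<longrightarrow> (\<integral>\<^sup>+y. ennreal (\<sigma> y) * indicator (max_cball x r) y \<partial>lborel) \<le> ennreal
          (C * (r ^ CARD('n) + \<epsilon> * f r))) \<and>
      (\<forall>s. (\<forall>i. 0 \<le> s i \<and> s i + \<delta> \<le> 1) \<longrightarrow> ennreal (m * \<delta> ^ CARD('n)) \<le>
        (\<integral>\<^sup>+y. ennreal (\<sigma> y) * indicator (box_product (\<lambda>i. {s i + \<delta> / 4..s i + 3 * \<delta> / 4})) y
            \<partial>lborel))"
    using density[OF assms(1) \<delta>, of N] .
  then obtain \<sigma> I where I: "finite I" "\<forall>n\<in>I. N \<le> n" and \<sigma>: "continuous_on UNIV \<sigma>" "\<forall>x. 0 \<le> \<sigma> x"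
      "\<forall>x. \<sigma> x \<noteq> 0 \<longrightarrow> x \<in> (\<Union>n\<in>I. T n)"
      "\<forall>x r. 0 < r \<longrightarrow> (\<integral>\<^sup>+y. ennreal (\<sigma> y) * indicator (max_cball x r) y \<partial>lborel) \<le>
          ennreal (C * (r ^ CARD('n) + \<epsilon> * f r))"
      "\<forall>s. (\<forall>i. 0 \<le> s i \<and> s i + \<delta> \<le> 1) \<longrightarrow> ennreal (m * \<delta> ^ CARD('n)) \<le>
        (\<integral>\<^sup>+y. ennreal (\<sigma> y) * indicator (box_product (\<lambda>i. {s i + \<delta> / 4..s i + 3 * \<delta> / 4})) y
            \<partial>lborel)"
    by (elim exE conjE) (rule that)
  have [measurable]: "\<sigma> \<in> borel_measurable borel" using \<sigma>(1)
      by (rule borel_measurable_continuous_onI)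
  define H where "H k = (box_product (\<lambda>i. {k i / M + \<delta> / 4..k i / M + 3 * \<delta> / 4}) :: (real ^ 'n)
      set)" for k :: "'n \<Rightarrow> nat"
  \<comment> \<open>The open cell lets the cutoff be continuous on the whole space while it vanishes
    outside the half-open cell.\<close>
  define U where "U k = (box_product (\<lambda>i. {k i / M<..<(real (k i) + 1) / M}) :: (real ^ 'n) set)"
      for k :: "'n \<Rightarrow> nat"
  have U_sub: "U k \<subseteq> grid_cube M k" for k by (auto simp: U_def grid_cube_def less_imp_le)
  have [measurable]: "H k \<in> sets borel" for k unfolding H_def by (rule box_product_sets) simp
  have "\<exists>b. continuous_on UNIV b \<and> (\<forall>x. 0 \<le> b x \<and> b x \<le> (1 :: real)) \<and> (\<forall>x\<in>H k. b x = 1) \<and>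
      (\<forall>x. x \<notin> U k \<longrightarrow> b x = 0)" for k
  proof -
    have c: "closed (H k)" unfolding H_def by (rule closed_box_product) simp
    have o: "open (U k)" unfolding U_def by (rule open_box_product) simp
    have "H k \<subseteq> U k"
    proof
      fix x assume x: "x \<in> H k"
      have "k i / M < x $ i \<and> x $ i < (real (k i) + 1) / M" for i
      proof -
        have "k i / M + \<delta> / 4 \<le> x $ i" "x $ i \<le> k i / M + 3 * \<delta> / 4" using x by (auto simp: H_def)
        moreover have "(real (k i) + 1) / M = k i / M + \<delta>" by (simp add: \<delta>_def add_divide_distrib)
        ultimately show ?thesis using \<delta> by linarith
      qed
      then show "x \<in> U k" by (simp add: U_def)
    qed
    from continuous_bump[OF c o this] obtain b where "continuous_on UNIV b" "\<And>x. 0 \<le> b x"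
        "\<And>x. b x \<le> (1 :: real)"
      "\<And>x. x \<in> H k \<Longrightarrow> b x = 1" "\<And>x. x \<notin> U k \<Longrightarrow> b x = 0" by blast
    then show ?thesis by (intro exI[of _ b]) blast
  qed
  then have "\<exists>b. \<forall>k. continuous_on UNIV (b k) \<and> (\<forall>x. 0 \<le> b k x \<and> b k x \<le> (1 :: real)) \<and>
      (\<forall>x\<in>H k. b k x = 1) \<and> (\<forall>x. x \<notin> U k \<longrightarrow> b k x = 0)"
    by (intro choice) blast
  then obtain b where b: "\<And>k. continuous_on UNIV (b k)" "\<And>k x. 0 \<le> b k x"
      "\<And>k x. b k x \<le> (1 :: real)"
    "\<And>k x. x \<in> H k \<Longrightarrow> b k x = 1" "\<And>k x. x \<notin> U k \<Longrightarrow> b k x = 0" by blast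
  define v where "v k = (\<integral>\<^sup>+x. ennreal (b k x * \<sigma> x) \<partial>lborel)" for k
  have [measurable]: "b k \<in> borel_measurable borel" for k using b(1)
      by (rule borel_measurable_continuous_onI)
  have v_ge: "ennreal (m * \<delta> ^ CARD('n)) \<le> v k" if k: "k \<in> grid M" for k
  proof -
    have "ennreal (m * \<delta> ^ CARD('n)) \<le> (\<integral>\<^sup>+y. ennreal (\<sigma> y) * indicator (H k) y \<partial>lborel)"
      unfolding H_def
    proof (rule \<sigma>(5)[rule_format])
      fix i
      have "k i + 1 \<le> M" using k by (simp add: grid_def Suc_le_eq)
      then have "real (k i) + 1 \<le> M" by linarith
      then have "(real (k i) + 1) / M \<le> 1" using assms(2) by (simp add: divide_le_eq)
      then show "0 \<le> k i / M \<and> k i / M + \<delta> \<le> 1" by (simp add: \<delta>_def add_divide_distrib)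
    qed
    also have "\<dots> \<le> v k" unfolding v_def
      using b \<sigma>(2) by (intro nn_integral_mono) (auto simp: indicator_def intro!: ennreal_leI)
    finally show ?thesis .
  qed
  have v_fin: "v k < top" for k
  proof -
    have "v k \<le> (\<integral>\<^sup>+y. ennreal (\<sigma> y) *
        indicator (max_cball (\<chi> i. real (k i) / M + \<delta> / 2) \<delta>) y \<partial>lborel)"
      unfolding v_def
    proof (rule nn_integral_mono)
      fix y
      show "ennreal (b k y * \<sigma> y) \<le>
          ennreal (\<sigma> y) * indicator (max_cball (\<chi> i. real (k i) / M + \<delta> / 2) \<delta>) y"
      proof (cases "y \<in> U k")
        case True
        have "y \<in> max_cball (\<chi> i. real (k i) / M + \<delta> / 2) \<delta>"
          unfolding mem_max_cball
        proof
          fix i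
          have "k i / M < y $ i" "y $ i < (real (k i) + 1) / M" using True by (auto simp: U_def)
          moreover have "(real (k i) + 1) / M = k i / M + \<delta>" by (simp add: \<delta>_def add_divide_distrib)
          ultimately show "\<bar>y $ i - (\<chi> i. real (k i) / M + \<delta> / 2) $ i\<bar> \<le> \<delta>" using \<delta>
              by (simp add: abs_le_iff)
        qed
        moreover have "b k y * \<sigma> y \<le> 1 * \<sigma> y" using b(3) \<sigma>(2) by (intro mult_right_mono) auto
        ultimately show ?thesis by (simp add: ennreal_leI)
      qed (simp add: b(5))
    qed
    also have "\<dots> \<le> ennreal (C * (\<delta> ^ CARD('n) + \<epsilon> * f \<delta>))" using \<sigma>(4) \<delta> by blast
    finally show ?thesis by (rule le_less_trans) simp
  qed
  define w where "w k = enn2real (v k)" for k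
  have w: "v k = ennreal (w k)" for k using v_fin[of k] by (simp add: w_def)
  have w_ge: "m * \<delta> ^ CARD('n) \<le> w k" if "k \<in> grid M" for k
    using v_ge[OF that] unfolding w by (subst (asm) ennreal_le_iff) (simp_all add: w_def)
  have md: "0 < m * \<delta> ^ CARD('n)" using m_pos \<delta> by simp
  have w_pos: "0 < w k" if "k \<in> grid M" for k using w_ge[OF that] md by linarith
  \<comment> \<open>Each cell receives exactly its Lebesgue measure \<open>\<delta> ^ d\<close>. By
    \<open>w_ge\<close> this multiplies the density by at most \<open>1 / m\<close>, so the ball
    bound deteriorates only by that factor.\<close>
  define t where "t k x = \<delta> ^ CARD('n) / w k * (b k x * \<sigma> x)" for k x
  define s where "s x = (\<Sum>k\<in>grid M. t k x)" for x
  have t0: "0 \<le> t k x" if "k \<in> grid M" for k x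
    unfolding t_def using w_pos[OF that] \<delta> b(2) \<sigma>(2)
        by (intro mult_nonneg_nonneg divide_nonneg_nonneg) (auto simp: less_imp_le)
  have t_supp: "x \<in> grid_cube M k" if "t k x \<noteq> 0" for k x
    using that b(5) U_sub unfolding t_def by (metis mult_eq_0_iff subsetD)
  have cont_t: "continuous_on UNIV (t k)" for k
    unfolding t_def by (intro continuous_intros b(1) \<sigma>(1))
  have t_le: "t k x \<le> \<sigma> x / m" if k: "k \<in> grid M" for k x
  proof -
    have 1: "\<delta> ^ CARD('n) / w k \<le> 1 / m"
      using w_ge[OF k] w_pos[OF k] m_pos by (simp add: field_simps)
    have 2: "b k x * \<sigma> x \<le> 1 * \<sigma> x" using b(3) \<sigma>(2) by (intro mult_right_mono) auto
    have "t k x \<le> 1 / m * (1 * \<sigma> x)" unfolding t_def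
      by (rule mult_mono[OF 1 2]) (use m_pos b(2) \<sigma>(2) in \<open>simp_all add: less_imp_le\<close>)
    then show ?thesis by simp
  qed
  have s_le: "s x \<le> \<sigma> x / m" for x
  proof (cases "\<exists>k\<in>grid M. t k x \<noteq> 0")
    case True
    then obtain k where k: "k \<in> grid M" "t k x \<noteq> 0" by blast
    have "t k' x = 0" if "k' \<noteq> k" for k'
      using grid_cube_disjoint[OF assms(2) t_supp t_supp[OF k(2)]] that by blast
    then have "s x = (\<Sum>k'\<in>grid M. if k' = k then t k x else 0)"
      unfolding s_def by (intro sum.cong refl) simp
    also have "\<dots> = t k x" using k by (simp add: finite_grid)
    finally show ?thesis using t_le[OF k(1)] by simp
  next
    case False
    then have "s x = 0" by (simp add: s_def)
    then show ?thesis using \<sigma>(2) m_pos by simp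
  qed
  show thesis
  proof (rule that[of I s t])
    show "finite I" "\<And>n. n \<in> I \<Longrightarrow> N \<le> n" using I by auto
    show "continuous_on UNIV s" unfolding s_def by (intro continuous_on_sum cont_t)
    show "x \<in> (\<Union>n\<in>I. T n)" if "s x \<noteq> 0" for x
    proof -
      have "\<sigma> x \<noteq> 0"
      proof
        assume "\<sigma> x = 0"
        then have "s x = 0" by (simp add: s_def t_def)
        with that show False by simp
      qed
      with \<sigma>(3) show ?thesis by blast
    qed
    show "s x = (\<Sum>k\<in>grid M. t k x)" for x by (simp add: s_def)
    show "0 \<le> t k x" if "k \<in> grid M" for k x using t0[OF that] .
    show "continuous_on UNIV (t k)" for k by (rule cont_t)
    show "x \<in> grid_cube M k" if "t k x \<noteq> 0" for k x using t_supp[OF that] .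
    show "(\<integral>\<^sup>+x. ennreal (t k x) \<partial>lborel) = ennreal ((1 / M) ^ CARD('n))" if k: "k \<in> grid M" for k
    proof -
      have q: "0 \<le> \<delta> ^ CARD('n) / w k" using w_pos[OF k] \<delta> by simp
      have "(\<integral>\<^sup>+x. ennreal (t k x) \<partial>lborel) =
          (\<integral>\<^sup>+x. ennreal (\<delta> ^ CARD('n) / w k) * ennreal (b k x * \<sigma> x) \<partial>lborel)"
        unfolding t_def using q by (simp only: ennreal_mult')
      also have "\<dots> = ennreal (\<delta> ^ CARD('n) / w k) * v k" unfolding v_def
          by (rule nn_integral_cmult) simp
      also have "\<dots> = ennreal (\<delta> ^ CARD('n) / w k * w k)" unfolding w using q
          by (simp only: ennreal_mult')
      also have "\<delta> ^ CARD('n) / w k * w k = (1 / M) ^ CARD('n)" using w_pos[OF k]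
          by (simp add: \<delta>_def)
      finally show ?thesis .
    qed
    fix x and r :: real assume r: "0 < r"
    have "(\<integral>\<^sup>+y. ennreal (s y) * indicator (max_cball x r) y \<partial>lborel) \<le>
        (\<integral>\<^sup>+y. ennreal (1 / m) * (ennreal (\<sigma> y) * indicator (max_cball x r) y) \<partial>lborel)"
    proof (rule nn_integral_mono)
      fix y
      have "ennreal (s y) \<le> ennreal (1 / m * \<sigma> y)" using s_le[of y] by (intro ennreal_leI) simp
      also have "\<dots> = ennreal (1 / m) * ennreal (\<sigma> y)" using m_pos by (intro ennreal_mult') simp
      finally show "ennreal (s y) * indicator (max_cball x r) y \<le>
          ennreal (1 / m) * (ennreal (\<sigma> y) * indicator (max_cball x r) y)"
        by (simp add: mult_right_mono flip: mult.assoc)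
    qed
    also have "\<dots> = ennreal (1 / m) * (\<integral>\<^sup>+y. ennreal (\<sigma> y) * indicator (max_cball x r) y \<partial>lborel)"
      by (rule nn_integral_cmult) simp
    also have "\<dots> \<le> ennreal (1 / m) * ennreal (C * (r ^ CARD('n) + \<epsilon> * f r))"
      using \<sigma>(4) r by (intro mult_left_mono) auto
    also have "\<dots> = ennreal (C / m * (r ^ CARD('n) + \<epsilon> * f r))"
      using m_pos by (subst ennreal_mult'[symmetric]) auto
    finally show "(\<integral>\<^sup>+y. ennreal (s y) * indicator (max_cball x r) y \<partial>lborel) \<le>
        ennreal (C / m * (r ^ CARD('n) + \<epsilon> * f r))" .
  qed
qed

text \<open>The new density is \<open>g * s\<close>. On a small cell \<open>g\<close> is almost
  constant and \<open>s\<close> has the mass of Lebesgue measure, so the total mass and the mass of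
  balls larger than \<open>r0\<close> change little; balls up to \<open>r0\<close> are controlled by
  the bound of \<open>g\<close> and the ball bound of \<open>s\<close>, since there \<open>f\<close>
  dominates.\<close>

lemma refine_density:
  assumes g: "continuous_on UNIV g" "\<And>x. 0 \<le> g x" "\<And>x. g x \<noteq> 0 \<Longrightarrow> x \<in> unit_cube" and \<kappa>: "0 < \<kappa>"
  obtains g' :: "real ^ 'n \<Rightarrow> real" and I where "finite I" "\<And>n. n \<in> I \<Longrightarrow> N \<le> n"
      "continuous_on UNIV g'" "\<And>x. 0 \<le> g' x"
    "\<And>x. g' x \<noteq> 0 \<Longrightarrow> g x \<noteq> 0 \<and> x \<in> (\<Union>n\<in>I. T n)"
    "(\<integral>\<^sup>+x. ennreal (g x) \<partial>lborel) \<le> (\<integral>\<^sup>+x. ennreal (g' x) \<partial>lborel) + ennreal \<kappa>"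
    "\<And>x r. 0 < r \<Longrightarrow> (\<integral>\<^sup>+y. ennreal (g' y) * indicator (max_cball x r) y \<partial>lborel) \<le>
       (\<integral>\<^sup>+y. ennreal (g y) * indicator (max_cball x r) y \<partial>lborel) + ennreal (\<kappa> * f r)"
proof -
  have g0: "g x = 0" if "x \<notin> unit_cube" for x using that g(3) by blast
  have gc: "continuous_on unit_cube g" using g(1) continuous_on_subset by blast
  obtain D where D: "1 \<le> D" "\<And>x. g x \<le> D"
  proof -
    have "bounded (g ` unit_cube)" using compact_continuous_image[OF gc compact_unit_cube]
        by (rule compact_imp_bounded)
    then obtain b where b: "\<And>x. x \<in> unit_cube \<Longrightarrow> \<bar>g x\<bar> \<le> b" by (auto simp: bounded_iff)
    have "g x \<le> max 1 b" for x
    proof (cases "x \<in> unit_cube")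
      case True
      then show ?thesis using b[of x] by simp
    next
      case False
      then have "g x = 0" using g(3) by blast
      then show ?thesis by simp
    qed
    with that[of "max 1 b"] show thesis by simp
  qed
  \<comment> \<open>Makes \<open>D * (C / m) * \<epsilon>\<close> equal to
    \<open>\<kappa> / 2\<close>; the choice of \<open>r0\<close> gives the same share to the term
    with \<open>r ^ d\<close>.\<close>
  define \<epsilon> where "\<epsilon> = \<kappa> * m / (2 * C * D)"
  have \<epsilon>: "0 < \<epsilon>" using \<kappa> m_pos C_pos D by (simp add: \<epsilon>_def)
  obtain r0 where r0: "0 < r0" "\<And>r. 0 < r \<Longrightarrow> r \<le> r0 \<Longrightarrow> 2 * D * C / (m * \<kappa>) * r ^ CARD('n) \<le> f r"
    using f_dominates by blast
  \<comment> \<open>The oscillation of \<open>g\<close> enters as \<open>2 * \<omega>\<close>: at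
    most \<open>\<kappa>\<close> in the mass estimate, at most half of
    \<open>\<kappa> * f r0\<close> for large balls.\<close>
  define \<omega> where "\<omega> = min (\<kappa> / 2) (\<kappa> * f r0 / 4)"
  have \<omega>: "0 < \<omega>" "\<omega> \<le> \<kappa> / 2" "\<omega> \<le> \<kappa> * f r0 / 4" using \<kappa> f_pos[OF r0(1)] by (auto simp: \<omega>_def)
  have "uniformly_continuous_on unit_cube g" using gc compact_unit_cube
      by (rule compact_uniformly_continuous)
  then obtain e where e: "0 < e" "\<And>x y. x \<in> unit_cube \<Longrightarrow> y \<in> unit_cube \<Longrightarrow> dist y x < e \<Longrightarrow>
      dist (g y) (g x) < \<omega>"
    unfolding uniformly_continuous_on_def using \<omega>(1) by meson
  \<comment> \<open>The first bound makes the cells finer than the modulus of continuity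
    \<open>e\<close>; the second keeps the contribution of the shell around a large ball below
    \<open>\<kappa> * f r0 / 2\<close>.\<close>
  define e' where "e' = min (e / (CARD('n) + 1)) (\<kappa> * f r0 / (4 * CARD('n) * D))"
  have e': "0 < e'" "e' \<le> e / (CARD('n) + 1)" "e' \<le> \<kappa> * f r0 / (4 * CARD('n) * D)"
    using e(1) \<kappa> f_pos[OF r0(1)] D by (auto simp: e'_def)
  obtain M :: nat where M: "0 < M" "1 / real M < e'"
    using ex_inverse_of_nat_less[OF e'(1)] by (auto simp: inverse_eq_divide)
  define \<delta> where "\<delta> = 1 / real M"
  have \<delta>: "0 < \<delta>" "\<delta> < e'" using M by (simp_all add: \<delta>_def)
  obtain s :: "real ^ 'n \<Rightarrow> real" and t :: "('n \<Rightarrow> nat) \<Rightarrow> real ^ 'n \<Rightarrow> real" and I where I: "finite I"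
      "\<And>n. n \<in> I \<Longrightarrow> N \<le> n" and
    s: "continuous_on UNIV s" "\<And>x. s x \<noteq> 0 \<Longrightarrow> x \<in> (\<Union>n\<in>I. T n)" "\<And>x. s x = (\<Sum>k\<in>grid M. t k x)" and
    t: "\<And>k x. k \<in> grid M \<Longrightarrow> 0 \<le> t k x" "\<And>k. k \<in> grid M \<Longrightarrow> continuous_on UNIV (t k)"
    "\<And>k x. k \<in> grid M \<Longrightarrow> t k x \<noteq> 0 \<Longrightarrow> x \<in> grid_cube M k"
    "\<And>k. k \<in> grid M \<Longrightarrow> (\<integral>\<^sup>+x. ennreal (t k x) \<partial>lborel) = ennreal ((1 / M) ^ CARD('n))" and
    s_ball: "\<And>x r. 0 < r \<Longrightarrow> (\<integral>\<^sup>+y. ennreal (s y) * indicator (max_cball x r) y \<partial>lborel) \<le>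
        ennreal (C / m * (r ^ CARD('n) + \<epsilon> * f r))"
    by (rule exists_normalized_density[OF \<epsilon> M(1)]) (rule that)
  have s0: "0 \<le> s x" for x unfolding s(3) using t(1) by (intro sum_nonneg)
  have [measurable]: "g \<in> borel_measurable borel" "s \<in> borel_measurable borel"
    using g(1) s(1) by (auto intro: borel_measurable_continuous_onI)
  have tm[measurable]: "t k \<in> borel_measurable borel" if "k \<in> grid M" for k
    using t(2)[OF that] by (rule borel_measurable_continuous_onI)
  have near: "\<bar>x $ i - y $ i\<bar> \<le> \<delta>" if "x \<in> grid_cube M k" "y \<in> grid_cube M k" for x y :: "real ^ 'n"
      and k i
  proof -
    have "k i / M \<le> x $ i" "x $ i < (real (k i) + 1) / M" "k i / M \<le> y $ i"
        "y $ i < (real (k i) + 1) / M"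
      using that by (simp_all add: grid_cube_def)
    moreover have "(real (k i) + 1) / M = k i / M + \<delta>" by (simp add: \<delta>_def add_divide_distrib)
    ultimately show ?thesis by linarith
  qed
  have osc: "\<bar>g x - g y\<bar> \<le> \<omega>" if k: "k \<in> grid M" "x \<in> grid_cube M k" "y \<in> grid_cube M k" for x y k
  proof -
    have "dist x y \<le> (\<Sum>i\<in>UNIV. \<bar>(x - y) $ i\<bar>)" unfolding dist_norm by (rule norm_le_l1_cart)
    also have "\<dots> \<le> (\<Sum>i\<in>(UNIV :: 'n set). \<delta>)" using near[OF k(2,3)] by (intro sum_mono) simp
    also have "\<dots> = CARD('n) * \<delta>" by simp
    also have "\<dots> < (CARD('n) + 1) * e'" using \<delta> by (intro mult_strict_mono) auto
    also have "\<dots> \<le> e" using e'(2) by (simp add: pos_le_divide_eq mult.commute)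
    finally have "dist x y < e" .
    then have "dist (g x) (g y) < \<omega>"
      using e(2) k grid_cube_subset_unit_cube[OF M(1) k(1)] by blast
    then show ?thesis by (simp add: dist_real_def)
  qed
  have cell: "emeasure lborel (grid_cube M k :: (real ^ 'n) set) = ennreal (\<delta> ^ CARD('n))" for k
    unfolding \<delta>_def by (rule emeasure_grid_cube[OF M(1)])
  \<comment> \<open>Obtained by integrating the indicator of the unit cube over the grid, which
    avoids counting the cells.\<close>
  have card_cells: "(\<Sum>k\<in>(grid M :: ('n \<Rightarrow> nat) set). ennreal (\<delta> ^ CARD('n))) = 1"
  proof -
    let ?u = "unit_cube :: (real ^ 'n) set"
    have "(\<integral>\<^sup>+x. indicator ?u x \<partial>lborel) =
        (\<Sum>k\<in>grid M. \<integral>\<^sup>+x. indicator ?u x * indicator (grid_cube M k) x \<partial>lborel)"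
      using M(1) by (intro nn_integral_grid) auto
    also have "\<dots> = (\<Sum>k\<in>(grid M :: ('n \<Rightarrow> nat) set). ennreal (\<delta> ^ CARD('n)))"
    proof (rule sum.cong[OF refl])
      fix k :: "'n \<Rightarrow> nat" assume "k \<in> grid M"
      then have "(\<integral>\<^sup>+x. indicator ?u x * indicator (grid_cube M k) x \<partial>lborel) =
          (\<integral>\<^sup>+x. indicator (grid_cube M k :: (real ^ 'n) set) x \<partial>lborel)"
        using grid_cube_subset_unit_cube[OF M(1)]
            by (intro nn_integral_cong) (auto simp: indicator_def)
      then show "(\<integral>\<^sup>+x. indicator ?u x * indicator (grid_cube M k) x \<partial>lborel) =
          ennreal (\<delta> ^ CARD('n))"
        by (simp add: cell)
    qed
    finally show ?thesis by (simp add: emeasure_unit_cube)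
  qed
  define c :: "('n \<Rightarrow> nat) \<Rightarrow> real ^ 'n" where "c k = (\<chi> i. k i / M)" for k
  have c: "c k \<in> grid_cube M k" for k
    using M(1) by (simp add: c_def grid_cube_def divide_strict_right_mono)
  have gs: "ennreal (g x * s x) = (\<Sum>k\<in>grid M. ennreal (g x * t k x))" for x
    using t(1) g(2) by (simp add: s(3) sum_distrib_left sum_ennreal)
  show thesis
  proof (rule that[of I "\<lambda>x. g x * s x"])
    show "finite I" "\<And>n. n \<in> I \<Longrightarrow> N \<le> n" using I by auto
    show "continuous_on UNIV (\<lambda>x. g x * s x)" by (intro continuous_intros g(1) s(1))
    show "0 \<le> g x * s x" for x using g(2) s0 by simp
    show "g x \<noteq> 0 \<and> x \<in> (\<Union>n\<in>I. T n)" if "g x * s x \<noteq> 0" for x using that s(2) by auto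
  next
    have cellwise: "(\<integral>\<^sup>+x. ennreal (g x) * indicator (grid_cube M k) x \<partial>lborel) \<le>
        (\<integral>\<^sup>+x. ennreal (g x * t k x) \<partial>lborel) + ennreal (\<kappa> * \<delta> ^ CARD('n))" if k: "k \<in> grid M" for k
    proof -
      have "(\<integral>\<^sup>+x. ennreal (g x) * indicator (grid_cube M k) x \<partial>lborel) \<le>
          (\<integral>\<^sup>+x. ennreal (g (c k) + \<omega>) * indicator (grid_cube M k) x \<partial>lborel)"
      proof (rule nn_integral_mono)
        fix x
        show "ennreal (g x) * indicator (grid_cube M k) x \<le>
            ennreal (g (c k) + \<omega>) * indicator (grid_cube M k) x"
          using osc[OF k _ c, of x] by (auto simp: indicator_def intro!: ennreal_leI)
      qed
      also have "\<dots> = ennreal (g (c k) + \<omega>) * ennreal (\<delta> ^ CARD('n))"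
        by (subst nn_integral_cmult) (simp_all add: cell)
      also have "\<dots> = (\<integral>\<^sup>+x. ennreal (g (c k) + \<omega>) * ennreal (t k x) \<partial>lborel)"
        using tm[OF k] t(4)[OF k] by (simp add: nn_integral_cmult \<delta>_def)
      also have "\<dots> \<le> (\<integral>\<^sup>+x. ennreal (g x * t k x) + ennreal \<kappa> * ennreal (t k x) \<partial>lborel)"
      proof (rule nn_integral_mono)
        fix x
        show "ennreal (g (c k) + \<omega>) * ennreal (t k x) \<le>
            ennreal (g x * t k x) + ennreal \<kappa> * ennreal (t k x)"
        proof (cases "t k x = 0")
          case False
          then have "x \<in> grid_cube M k" by (rule t(3)[OF k])
          then have "g (c k) + \<omega> \<le> g x + \<kappa>" using osc[OF k _ c, of x] \<omega>(2) by auto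
          then have "(g (c k) + \<omega>) * t k x \<le> (g x + \<kappa>) * t k x" using t(1)[OF k]
              by (rule mult_right_mono)
          then have "ennreal ((g (c k) + \<omega>) * t k x) \<le> ennreal (g x * t k x + \<kappa> * t k x)"
              by (simp add: distrib_right ennreal_leI)
          then show ?thesis using g(2) t(1)[OF k] \<kappa> \<omega>(1)
              by (simp add: ennreal_mult' ennreal_plus less_imp_le)
        qed simp
      qed
      also have "\<dots> = (\<integral>\<^sup>+x. ennreal (g x * t k x) \<partial>lborel) + ennreal \<kappa> * ennreal (\<delta> ^ CARD('n))"
        using tm[OF k] t(4)[OF k] by (simp add: nn_integral_add nn_integral_cmult \<delta>_def)
      finally show ?thesis using \<kappa> by (simp add: ennreal_mult')
    qed
    have "(\<integral>\<^sup>+x. ennreal (g x) \<partial>lborel) =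
        (\<Sum>k\<in>grid M. \<integral>\<^sup>+x. ennreal (g x) * indicator (grid_cube M k) x \<partial>lborel)"
      using M(1) by (intro nn_integral_grid) (auto simp: g0)
    also have "\<dots> \<le> (\<Sum>k\<in>grid M. (\<integral>\<^sup>+x. ennreal (g x * t k x) \<partial>lborel) + ennreal (\<kappa> * \<delta> ^ CARD('n)))"
      by (rule sum_mono) (rule cellwise)
    also have "\<dots> = (\<integral>\<^sup>+x. ennreal (g x * s x) \<partial>lborel) +
        (\<Sum>k\<in>(grid M :: ('n \<Rightarrow> nat) set). ennreal \<kappa> * ennreal (\<delta> ^ CARD('n)))"
      unfolding gs using \<kappa> tm by (subst nn_integral_sum) (auto simp: sum.distrib ennreal_mult')
    also have "(\<Sum>k\<in>(grid M :: ('n \<Rightarrow> nat) set). ennreal \<kappa> * ennreal (\<delta> ^ CARD('n))) = ennreal \<kappa>"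
      by (simp only: sum_distrib_left[symmetric] card_cells mult_1_right)
    finally show "(\<integral>\<^sup>+x. ennreal (g x) \<partial>lborel) \<le> (\<integral>\<^sup>+x. ennreal (g x * s x) \<partial>lborel) + ennreal \<kappa>" .
  next
    fix x and r :: real assume r: "0 < r"
    show "(\<integral>\<^sup>+y. ennreal (g y * s y) * indicator (max_cball x r) y \<partial>lborel) \<le>
       (\<integral>\<^sup>+y. ennreal (g y) * indicator (max_cball x r) y \<partial>lborel) + ennreal (\<kappa> * f r)"
    proof (cases "r \<le> r0")
      case True
      have "(\<integral>\<^sup>+y. ennreal (g y * s y) * indicator (max_cball x r) y \<partial>lborel) \<le>
          (\<integral>\<^sup>+y. ennreal D * (ennreal (s y) * indicator (max_cball x r) y) \<partial>lborel)"
      proof (rule nn_integral_mono)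
        fix y
        have "ennreal (g y * s y) \<le> ennreal (D * s y)" using D(2) s0
            by (intro ennreal_leI mult_right_mono)
        also have "\<dots> = ennreal D * ennreal (s y)" using D(1) by (intro ennreal_mult') simp
        finally show "ennreal (g y * s y) * indicator (max_cball x r) y \<le>
            ennreal D * (ennreal (s y) * indicator (max_cball x r) y)"
          by (simp add: mult_right_mono flip: mult.assoc)
      qed
      also have "\<dots> = ennreal D * (\<integral>\<^sup>+y. ennreal (s y) * indicator (max_cball x r) y \<partial>lborel)"
        by (rule nn_integral_cmult) simp
      also have "\<dots> \<le> ennreal D * ennreal (C / m * (r ^ CARD('n) + \<epsilon> * f r))"
        by (intro mult_left_mono s_ball r) simp
      also have "\<dots> = ennreal (D * (C / m * (r ^ CARD('n) + \<epsilon> * f r)))" using D(1)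
          by (intro ennreal_mult'[symmetric]) simp
      also have "\<dots> \<le> ennreal (\<kappa> * f r)"
      proof (rule ennreal_leI)
        have "D * (C / m * (\<epsilon> * f r)) = \<kappa> / 2 * f r"
          unfolding \<epsilon>_def using D(1) C_pos m_pos by (simp add: field_simps)
        moreover have "D * (C / m * r ^ CARD('n)) \<le> \<kappa> / 2 * f r"
          using mult_left_mono[OF r0(2)[OF r True], of "\<kappa> / 2"] \<kappa> m_pos by (simp add: field_simps)
        moreover have "D * (C / m * (r ^ CARD('n) + \<epsilon> * f r)) =
            D * (C / m * r ^ CARD('n)) + D * (C / m * (\<epsilon> * f r))"
          by (simp only: distrib_left)
        ultimately show "D * (C / m * (r ^ CARD('n) + \<epsilon> * f r)) \<le> \<kappa> * f r" by linarith
      qed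
      finally show ?thesis by (simp add: add_increasing)
    next
      case False
      let ?B = "max_cball x r" and ?B' = "max_cball x (r + \<delta>)"
      \<comment> \<open>A cell meeting the ball lies in the ball enlarged by
        \<open>\<delta>\<close>. On it \<open>g\<close> is compared with its value at
        \<open>c k\<close> and back, at a cost of \<open>\<omega>\<close> each time.\<close>
      have cellwise: "(\<integral>\<^sup>+y. ennreal (g y * t k y) * indicator ?B y \<partial>lborel) \<le>
          (\<integral>\<^sup>+y. (ennreal (g y) * indicator ?B' y + ennreal (2 * \<omega>) * indicator unit_cube y) *
              indicator (grid_cube M k) y \<partial>lborel)" if k: "k \<in> grid M" for k
      proof (cases "grid_cube M k \<inter> ?B = {}")
        case True
        have z: "ennreal (g y * t k y) * indicator ?B y = 0" for y
          using True t(3)[OF k, of y] by (cases "t k y = 0") (auto simp: indicator_def)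
        show ?thesis unfolding z by simp
      next
        case nonempty: False
        have B': "y \<in> ?B'" if y: "y \<in> grid_cube M k" for y
        proof -
          obtain z where z: "z \<in> grid_cube M k" "z \<in> ?B" using nonempty by blast
          show ?thesis unfolding mem_max_cball
          proof
            fix i
            have "\<bar>z $ i - x $ i\<bar> \<le> r" using z by (simp add: mem_max_cball)
            with near[OF z(1) y, of i] show "\<bar>y $ i - x $ i\<bar> \<le> r + \<delta>" by linarith
          qed
        qed
        have "(\<integral>\<^sup>+y. ennreal (g y * t k y) * indicator ?B y \<partial>lborel) \<le>
            (\<integral>\<^sup>+y. ennreal (g (c k) + \<omega>) * ennreal (t k y) \<partial>lborel)"
        proof (rule nn_integral_mono)
          fix y
          have "ennreal (g y * t k y) * indicator ?B y \<le> ennreal (g y * t k y)"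
              by (simp add: indicator_def)
          also have "\<dots> \<le> ennreal ((g (c k) + \<omega>) * t k y)"
          proof (cases "t k y = 0")
            case False
            then have "y \<in> grid_cube M k" by (rule t(3)[OF k])
            then have "g y \<le> g (c k) + \<omega>" using osc[OF k _ c, of y] by auto
            then show ?thesis using t(1)[OF k] by (intro ennreal_leI mult_right_mono)
          qed simp
          also have "\<dots> = ennreal (g (c k) + \<omega>) * ennreal (t k y)"
            using g(2)[of "c k"] \<omega>(1) by (intro ennreal_mult') simp
          finally show "ennreal (g y * t k y) * indicator ?B y \<le>
              ennreal (g (c k) + \<omega>) * ennreal (t k y)" .
        qed
        also have "\<dots> = ennreal (g (c k) + \<omega>) * ennreal (\<delta> ^ CARD('n))"
          using tm[OF k] t(4)[OF k] by (simp add: nn_integral_cmult \<delta>_def)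
        also have "\<dots> = (\<integral>\<^sup>+y. ennreal (g (c k) + \<omega>) * indicator (grid_cube M k) y \<partial>lborel)"
          by (subst nn_integral_cmult) (simp_all add: cell)
        also have "\<dots> \<le> (\<integral>\<^sup>+y. (ennreal (g y) * indicator ?B' y + ennreal (2 * \<omega>) *
            indicator unit_cube y) * indicator (grid_cube M k) y \<partial>lborel)"
        proof (rule nn_integral_mono)
          fix y
          show "ennreal (g (c k) + \<omega>) * indicator (grid_cube M k) y \<le>
            (ennreal (g y) * indicator ?B' y + ennreal (2 * \<omega>) * indicator unit_cube y) * indicator
                (grid_cube M k) y"
          proof (cases "y \<in> grid_cube M k")
            case True
            then have "g (c k) + \<omega> \<le> g y + 2 * \<omega>" using osc[OF k _ c, of y] by auto
            then have "ennreal (g (c k) + \<omega>) \<le> ennreal (g y) + ennreal (2 * \<omega>)"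
              using g(2)[of y] \<omega>(1) by (simp add: ennreal_leI flip: ennreal_plus)
            moreover have "y \<in> ?B'" "y \<in> unit_cube"
                using True B' grid_cube_subset_unit_cube[OF M(1) k] by auto
            ultimately show ?thesis using True by simp
          qed simp
        qed
        finally show ?thesis .
      qed
      have "(\<integral>\<^sup>+y. ennreal (g y * s y) * indicator ?B y \<partial>lborel) =
          (\<Sum>k\<in>grid M. \<integral>\<^sup>+y. ennreal (g y * t k y) * indicator ?B y \<partial>lborel)"
        unfolding gs sum_distrib_right using tm by (intro nn_integral_sum) auto
      also have "\<dots> \<le> (\<Sum>k\<in>grid M. \<integral>\<^sup>+y. (ennreal (g y) * indicator ?B' y + ennreal (2 * \<omega>) *
          indicator unit_cube y) * indicator (grid_cube M k) y \<partial>lborel)"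
        by (rule sum_mono) (rule cellwise)
      also have "\<dots> = (\<integral>\<^sup>+y. ennreal (g y) * indicator ?B' y + ennreal (2 * \<omega>) *
          indicator unit_cube y \<partial>lborel)"
        using M(1) by (intro nn_integral_grid[symmetric]) (auto simp: g0)
      also have "\<dots> \<le> (\<integral>\<^sup>+y. (ennreal (g y) * indicator ?B y + ennreal D *
          indicator (unit_cube \<inter> ?B' - ?B) y) + ennreal (2 * \<omega>) * indicator unit_cube y \<partial>lborel)"
      proof (intro nn_integral_mono add_mono order_refl)
        fix y
        show "ennreal (g y) * indicator ?B' y \<le>
            ennreal (g y) * indicator ?B y + ennreal D * indicator (unit_cube \<inter> ?B' - ?B) y"
          using D(2)[of y] by (auto simp: indicator_def g0 intro!: ennreal_leI)
      qed
      also have "\<dots> = (\<integral>\<^sup>+y. ennreal (g y) * indicator ?B y \<partial>lborel) + ennreal D *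
          emeasure lborel (unit_cube \<inter> ?B' - ?B) + ennreal (2 * \<omega>)"
        by (subst nn_integral_add, simp, simp, subst nn_integral_add, simp, simp)
            (simp add: nn_integral_cmult emeasure_unit_cube)
      also have "\<dots> \<le> (\<integral>\<^sup>+y. ennreal (g y) * indicator ?B y \<partial>lborel) + ennreal D *
          ennreal (2 * CARD('n) * \<delta>) + ennreal (2 * \<omega>)"
        using r \<delta> by (intro add_mono mult_left_mono order_refl emeasure_cube_shell_le) auto
      also have "\<dots> = (\<integral>\<^sup>+y. ennreal (g y) * indicator ?B y \<partial>lborel) +
          ennreal (D * (2 * CARD('n) * \<delta>) + 2 * \<omega>)"
        using D(1) \<delta> \<omega>(1) by (simp add: add.assoc ennreal_plus flip: ennreal_mult')
      also have "\<dots> \<le> (\<integral>\<^sup>+y. ennreal (g y) * indicator ?B y \<partial>lborel) + ennreal (\<kappa> * f r)"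
      proof (intro add_left_mono ennreal_leI)
        have "D * (2 * CARD('n) * \<delta>) \<le> D * (2 * CARD('n) * (\<kappa> * f r0 / (4 * CARD('n) * D)))"
          using \<delta> e'(3) D(1) by (intro mult_left_mono) auto
        also have "\<dots> = \<kappa> * f r0 / 2" using D(1) by (simp add: field_simps)
        finally have "D * (2 * CARD('n) * \<delta>) + 2 * \<omega> \<le> \<kappa> * f r0" using \<omega>(3) by linarith
        \<comment> \<open>The errors were measured against \<open>f r0\<close>; as \<open>f\<close>
          is nondecreasing, this serves all larger radii at once.\<close>
        also have "\<dots> \<le> \<kappa> * f r" using f_mono[OF r0(1), of r] False \<kappa> by simp
        finally show "D * (2 * CARD('n) * \<delta>) + 2 * \<omega> \<le> \<kappa> * f r" .
      qed
      finally show ?thesis .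
    qed
  qed
qed

definition limsup_set :: "(real ^ 'n) set" where
  "limsup_set = (\<Inter>N. \<Union>n\<in>{N..}. T n)"

text \<open>Step \<open>j\<close> may lose mass \<open>\<kappa> / 2 ^ (j + 1)\<close> and may add as
  much times \<open>f r\<close> to a ball, so both budgets stay below \<open>\<kappa>\<close>. The
  supports are nested by \<open>refine_density\<close>, and intersecting with finitely many closed
  targets keeps them inside compact sets.\<close>

lemma exists_density_sequence:
  assumes "0 < \<epsilon>"
  obtains g :: "nat \<Rightarrow> real ^ 'n \<Rightarrow> real" and K :: "nat \<Rightarrow> (real ^ 'n) set" and \<rho> where "0 < \<rho>"
    "\<And>j. continuous_on UNIV (g j)" "\<And>j x. 0 \<le> g j x" "\<And>j x. g j x \<noteq> 0 \<Longrightarrow> x \<in> K j" "\<And>j. compact (K j)"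
    "\<And>j. K (Suc j) \<subseteq> K j" "\<And>j. K (Suc j) \<subseteq> (\<Union>n\<in>{j..}. T n)"
    "\<And>j. ennreal ((1 / 2) ^ CARD('n) / 2) \<le> (\<integral>\<^sup>+x. ennreal (g j x) \<partial>lborel)"
    "\<And>j x r. 0 < r \<Longrightarrow> r \<le> \<rho> \<Longrightarrow> (\<integral>\<^sup>+y. ennreal (g j y) * indicator (max_cball x r) y \<partial>lborel) \<le>
        ennreal (\<epsilon> * f r)"
proof -
  define \<mu> where "\<mu> = (1 / 2 :: real) ^ CARD('n)"
  have \<mu>: "0 < \<mu>" by (simp add: \<mu>_def)
  \<comment> \<open>Half of the initial mass and half of the ball bound are reserved for the losses
    of all later steps.\<close>
  define \<kappa> where "\<kappa> = min (\<mu> / 2) (\<epsilon> / 2)"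
  have \<kappa>: "0 < \<kappa>" "\<kappa> \<le> \<mu> / 2" "\<kappa> \<le> \<epsilon> / 2" using \<mu> assms by (auto simp: \<kappa>_def)
  \<comment> \<open>For the initial density, which is at most 1: this says
    \<open>(2 * r) ^ d \<le> \<epsilon> / 2 * f r\<close>.\<close>
  obtain \<rho> where \<rho>: "0 < \<rho>" "\<And>r. 0 < r \<Longrightarrow> r \<le> \<rho> \<Longrightarrow> 2 ^ CARD('n) * 2 / \<epsilon> * r ^ CARD('n) \<le> f r"
    using f_dominates by blast
  define P where "P j G \<longleftrightarrow> (case G of (g, K) \<Rightarrow> continuous_on UNIV g \<and> (\<forall>x. 0 \<le> g x) \<and>
      (\<forall>x. g x \<noteq> 0 \<longrightarrow> x \<in> K) \<and>
      compact K \<and> K \<subseteq> unit_cube \<and> ennreal \<mu> \<le> (\<integral>\<^sup>+x. ennreal (g x) \<partial>lborel) + ennreal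
          (\<kappa> * (1 - (1 / 2) ^ j)) \<and>
      (\<forall>x r. 0 < r \<longrightarrow> r \<le> \<rho> \<longrightarrow> (\<integral>\<^sup>+y. ennreal (g y) * indicator (max_cball x r) y \<partial>lborel) \<le>
         ennreal ((\<epsilon> / 2 + \<kappa> * (1 - (1 / 2) ^ j)) * f r)))"
    for j :: nat and G :: "(real ^ 'n \<Rightarrow> real) \<times> (real ^ 'n) set"
  define Q where "Q j G G' \<longleftrightarrow> snd G' \<subseteq> snd G \<and> snd G' \<subseteq> (\<Union>n\<in>{j..}. T n)"
    for j :: nat and G G' :: "(real ^ 'n \<Rightarrow> real) \<times> (real ^ 'n) set"
  have "\<exists>F. \<forall>j. P j (F j) \<and> Q j (F j) (F (Suc j))"
  proof (rule dependent_nat_choice)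
    obtain g :: "real ^ 'n \<Rightarrow> real" where g: "continuous_on UNIV g" "\<And>x. 0 \<le> g x" "\<And>x. g x \<le> 1"
      "\<And>x. g x \<noteq> 0 \<Longrightarrow> x \<in> unit_cube" "ennreal ((1 / 2) ^ CARD('n)) \<le> (\<integral>\<^sup>+x. ennreal (g x) \<partial>lborel)"
      by (rule exists_initial_density) (rule that)
    have "(\<integral>\<^sup>+y. ennreal (g y) * indicator (max_cball x r) y \<partial>lborel) \<le> ennreal (\<epsilon> / 2 * f r)"
      if r: "0 < r" "r \<le> \<rho>" for x r
    proof -
      have "(\<integral>\<^sup>+y. ennreal (g y) * indicator (max_cball x r) y \<partial>lborel) \<le>
          (\<integral>\<^sup>+y. indicator (max_cball x r) y \<partial>lborel)"
        using g(3) by (intro nn_integral_mono) (auto simp: indicator_def)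
      also have "\<dots> = ennreal ((2 * r) ^ CARD('n))" using r by (simp add: emeasure_max_cball)
      also have "\<dots> \<le> ennreal (\<epsilon> / 2 * f r)"
        using mult_left_mono[OF \<rho>(2)[OF r], of "\<epsilon> / 2"] assms
            by (intro ennreal_leI) (simp add: power_mult_distrib)
      finally show ?thesis .
    qed
    with g(1,2,4) g(5)[folded \<mu>_def] compact_unit_cube have "P 0 (g, unit_cube)"
        by (simp add: P_def)
    then show "\<exists>G. P 0 G" ..
  next
    fix G j assume PG: "P j G"
    obtain g K where G: "G = (g, K)" by (cases G)
    have g: "continuous_on UNIV g" "\<And>x. 0 \<le> g x" "\<And>x. g x \<noteq> 0 \<Longrightarrow> x \<in> K" "compact K" "K \<subseteq> unit_cube"
      "ennreal \<mu> \<le> (\<integral>\<^sup>+x. ennreal (g x) \<partial>lborel) + ennreal (\<kappa> * (1 - (1 / 2) ^ j))"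
      "\<And>x r. 0 < r \<Longrightarrow> r \<le> \<rho> \<Longrightarrow> (\<integral>\<^sup>+y. ennreal (g y) * indicator (max_cball x r) y \<partial>lborel) \<le>
         ennreal ((\<epsilon> / 2 + \<kappa> * (1 - (1 / 2) ^ j)) * f r)"
      using PG unfolding P_def G by auto
    have gu: "x \<in> unit_cube" if "g x \<noteq> 0" for x using g(3)[OF that] g(5) by blast
    have k: "0 < \<kappa> * (1 / 2) ^ Suc j" using \<kappa> by simp
    obtain g' :: "real ^ 'n \<Rightarrow> real" and I where g': "finite I" "\<And>n. n \<in> I \<Longrightarrow> j \<le> n"
        "continuous_on UNIV g'" "\<And>x. 0 \<le> g' x"
      "\<And>x. g' x \<noteq> 0 \<Longrightarrow> g x \<noteq> 0 \<and> x \<in> (\<Union>n\<in>I. T n)"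
      "(\<integral>\<^sup>+x. ennreal (g x) \<partial>lborel) \<le>
          (\<integral>\<^sup>+x. ennreal (g' x) \<partial>lborel) + ennreal (\<kappa> * (1 / 2) ^ Suc j)"
      "\<And>x r. 0 < r \<Longrightarrow> (\<integral>\<^sup>+y. ennreal (g' y) * indicator (max_cball x r) y \<partial>lborel) \<le>
         (\<integral>\<^sup>+y. ennreal (g y) * indicator (max_cball x r) y \<partial>lborel) + ennreal
             (\<kappa> * (1 / 2) ^ Suc j * f r)"
      using gu by (rule refine_density[OF g(1,2) _ k, where N = j]) (assumption, rule that)
    have q: "\<kappa> * (1 - (1 / 2) ^ j) + \<kappa> * (1 / 2) ^ Suc j = \<kappa> * (1 - (1 / 2) ^ Suc j)"
      by (simp add: algebra_simps)
    have q0: "0 \<le> \<kappa> * (1 - (1 / 2) ^ j)" using \<kappa> by (simp add: power_le_one)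
    let ?K = "K \<inter> (\<Union>n\<in>I. T n)"
    have "P (Suc j) (g', ?K)"
      unfolding P_def
    proof (simp only: prod.case, intro conjI allI impI)
      show "compact ?K" using g(4) g'(1) closed_T by (intro compact_Int_closed closed_UN) auto
      have "ennreal \<mu> \<le> (\<integral>\<^sup>+x. ennreal (g' x) \<partial>lborel) + ennreal (\<kappa> * (1 / 2) ^ Suc j) +
          ennreal (\<kappa> * (1 - (1 / 2) ^ j))"
        by (rule order_trans[OF g(6) add_right_mono[OF g'(6)]])
      also have "\<dots> = (\<integral>\<^sup>+x. ennreal (g' x) \<partial>lborel) + ennreal (\<kappa> * (1 - (1 / 2) ^ Suc j))"
        unfolding q[symmetric] using q0 k
            by (subst ennreal_plus) (simp_all only: ac_simps less_imp_le)
      finally show "ennreal \<mu> \<le>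
          (\<integral>\<^sup>+x. ennreal (g' x) \<partial>lborel) + ennreal (\<kappa> * (1 - (1 / 2) ^ Suc j))" .
      fix x and r :: real assume r: "0 < r" "r \<le> \<rho>"
      have "(\<integral>\<^sup>+y. ennreal (g' y) * indicator (max_cball x r) y \<partial>lborel) \<le>
          ennreal ((\<epsilon> / 2 + \<kappa> * (1 - (1 / 2) ^ j)) * f r) + ennreal (\<kappa> * (1 / 2) ^ Suc j * f r)"
        by (rule order_trans[OF g'(7)[OF r(1)] add_right_mono[OF g(7)[OF r]]])
      also have "\<dots> = ennreal ((\<epsilon> / 2 + \<kappa> * (1 - (1 / 2) ^ j)) * f r + \<kappa> * (1 / 2) ^ Suc j * f r)"
      proof -
        have nn: "0 \<le> \<epsilon> / 2 + \<kappa> * (1 - (1 / 2) ^ j)" "0 \<le> f r" "0 \<le> \<kappa> * (1 / 2) ^ Suc j"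
          using q0 k f_pos[OF r(1)] assms by linarith+
        show ?thesis
          by (rule ennreal_plus[symmetric, OF mult_nonneg_nonneg[OF nn(1,2)]
              mult_nonneg_nonneg[OF nn(3,2)]])
      qed
      also have "(\<epsilon> / 2 + \<kappa> * (1 - (1 / 2) ^ j)) * f r + \<kappa> * (1 / 2) ^ Suc j * f r =
          (\<epsilon> / 2 + \<kappa> * (1 - (1 / 2) ^ Suc j)) * f r"
        unfolding q[symmetric] by (simp only: distrib_right add.assoc)
      finally show "(\<integral>\<^sup>+y. ennreal (g' y) * indicator (max_cball x r) y \<partial>lborel) \<le>
          ennreal ((\<epsilon> / 2 + \<kappa> * (1 - (1 / 2) ^ Suc j)) * f r)" .
    qed (use g g' in auto)
    moreover have "Q j G (g', ?K)" using g'(2) by (auto simp: Q_def G)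
    ultimately show "\<exists>G'. P (Suc j) G' \<and> Q j G G'" by blast
  qed
  then obtain F where F: "\<And>j. P j (F j)" "\<And>j. Q j (F j) (F (Suc j))" by blast
  have P: "continuous_on UNIV (fst (F j))" "\<And>x. 0 \<le> fst (F j) x"
      "\<And>x. fst (F j) x \<noteq> 0 \<Longrightarrow> x \<in> snd (F j)" "compact (snd (F j))"
      "ennreal \<mu> \<le> (\<integral>\<^sup>+x. ennreal (fst (F j) x) \<partial>lborel) + ennreal (\<kappa> * (1 - (1 / 2) ^ j))"
      "\<And>x r. 0 < r \<Longrightarrow> r \<le> \<rho> \<Longrightarrow> (\<integral>\<^sup>+y. ennreal (fst (F j) y) * indicator (max_cball x r) y \<partial>lborel) \<le>
         ennreal ((\<epsilon> / 2 + \<kappa> * (1 - (1 / 2) ^ j)) * f r)" for j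
    using F(1)[of j] unfolding P_def by (auto simp: case_prod_beta)
  have le: "\<kappa> * (1 - (1 / 2) ^ j) \<le> \<kappa>" for j :: nat using \<kappa> by simp
  show thesis
  proof (rule that[of \<rho> "\<lambda>j. fst (F j)" "\<lambda>j. snd (F j)"])
    show "snd (F (Suc j)) \<subseteq> snd (F j)" "snd (F (Suc j)) \<subseteq> (\<Union>n\<in>{j..}. T n)" for j using F(2)[of j]
        by (auto simp: Q_def)
    show "ennreal ((1 / 2) ^ CARD('n) / 2) \<le> (\<integral>\<^sup>+x. ennreal (fst (F j) x) \<partial>lborel)" for j
    proof -
      have "ennreal (\<mu> / 2) + ennreal (\<mu> / 2) = ennreal \<mu>" using \<mu> by (simp flip: ennreal_plus)
      also have "\<dots> \<le> (\<integral>\<^sup>+x. ennreal (fst (F j) x) \<partial>lborel) + ennreal (\<mu> / 2)"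
        using le[of j] \<kappa> by (intro order_trans[OF P(5)[of j]] add_left_mono ennreal_leI) linarith
      finally show ?thesis unfolding \<mu>_def by (simp add: ennreal_add_left_cancel_le add.commute)
    qed
    show "(\<integral>\<^sup>+y. ennreal (fst (F j) y) * indicator (max_cball x r) y \<partial>lborel) \<le> ennreal (\<epsilon> * f r)"
        if "0 < r" "r \<le> \<rho>" for j x r
    proof -
      have "(\<epsilon> / 2 + \<kappa> * (1 - (1 / 2) ^ j)) * f r \<le> \<epsilon> * f r"
        using le[of j] \<kappa> f_pos[OF that(1)] by (intro mult_right_mono) linarith+
      then show ?thesis by (rule order_trans[OF P(6)[OF that, of j x] ennreal_leI])
    qed
  qed (use \<rho> P in auto)
qed

text \<open>The mass distribution principle without a limit measure. The compact sets decrease to a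
  subset of the limsup set, so for a given cover compactness yields one \<open>j\<close> such that
  finitely many enlarged balls cover \<open>K j\<close>, and the density \<open>g j\<close> is
  tested on these. As \<open>\<epsilon>\<close> is arbitrary while \<open>\<mu>\<close> is fixed,
  the measure is infinite.\<close>

theorem hausdorff_measure_limsup_set: "hausdorff_measure f limsup_set = top"
proof -
  define \<mu> where "\<mu> = (1 / 2 :: real) ^ CARD('n) / 2"
  have \<mu>: "0 < \<mu>" by (simp add: \<mu>_def)
  have "ennreal \<mu> \<le> ennreal \<epsilon> * hausdorff_measure f limsup_set" if \<epsilon>: "0 < \<epsilon>" for \<epsilon>
  proof -
    obtain g :: "nat \<Rightarrow> real ^ 'n \<Rightarrow> real" and K :: "nat \<Rightarrow> (real ^ 'n) set" and \<rho> where \<rho>: "0 < \<rho>" and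
      g: "\<And>j. continuous_on UNIV (g j)" "\<And>j x. 0 \<le> g j x" "\<And>j x. g j x \<noteq> 0 \<Longrightarrow> x \<in> K j" and
      K: "\<And>j. compact (K j)" "\<And>j. K (Suc j) \<subseteq> K j" "\<And>j. K (Suc j) \<subseteq> (\<Union>n\<in>{j..}. T n)" and
      mass': "\<And>j. ennreal ((1 / 2) ^ CARD('n) / 2) \<le> (\<integral>\<^sup>+x. ennreal (g j x) \<partial>lborel)" and
      ball: "\<And>j x r. 0 < r \<Longrightarrow> r \<le> \<rho> \<Longrightarrow> (\<integral>\<^sup>+y. ennreal (g j y) * indicator (max_cball x r) y \<partial>lborel) \<le>
          ennreal (\<epsilon> * f r)"
      by (rule exists_density_sequence[OF \<epsilon>]) (rule that)
    note mass = mass'[folded \<mu>_def]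
    have [measurable]: "g j \<in> borel_measurable borel" for j using g(1)
        by (rule borel_measurable_continuous_onI)
    have Kmono: "K n \<subseteq> K m" if "m \<le> n" for m n by (rule lift_Suc_antimono_le[of K, OF K(2) that])
    have Klim: "(\<Inter>j. K j) \<subseteq> limsup_set"
      using K(3) unfolding limsup_set_def by blast
    have "ennreal \<mu> \<le> ennreal \<epsilon> * (\<Sum>\<^sub>\<infinity>B\<in>\<B>. ennreal (f (max_diameter B)))" if \<B>:
        "\<B> \<in> ball_covers \<rho> limsup_set" for \<B>
    proof -
      have "\<forall>B\<in>\<B>. \<exists>x r. 0 < r \<and> B = max_cball x r \<and> 2 * r \<le> \<rho> \<and> max_diameter B = 2 * r"
      proof
        fix B assume "B \<in> \<B>"
        with \<B> obtain x r where B: "0 < r" "B = max_cball x r" "max_diameter B \<le> \<rho>"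
          unfolding ball_covers_def by blast
        then have "max_diameter B = 2 * r" by (simp add: max_diameter_max_cball)
        with B show "\<exists>x r. 0 < r \<and> B = max_cball x r \<and> 2 * r \<le> \<rho> \<and> max_diameter B = 2 * r"
          by (intro exI[of _ x] exI[of _ r]) simp
      qed
      then obtain x r where xr: "\<And>B. B \<in> \<B> \<Longrightarrow> 0 < r B" "\<And>B. B \<in> \<B> \<Longrightarrow> B = max_cball (x B) (r B)"
        "\<And>B. B \<in> \<B> \<Longrightarrow> 2 * r B \<le> \<rho>" "\<And>B. B \<in> \<B> \<Longrightarrow> max_diameter B = 2 * r B" by metis
      \<comment> \<open>Doubling the radius makes room for an open set and costs nothing:
        \<open>f (2 * r B)\<close> is \<open>f\<close> of the diameter of \<open>B\<close>.\<close>
      let ?O = "\<lambda>B. open_cube (x B) (2 * r B)"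
      have cov: "limsup_set \<subseteq> (\<Union>B\<in>\<B>. ?O B)"
      proof
        fix y assume "y \<in> limsup_set"
        then obtain B where B: "B \<in> \<B>" "y \<in> B" using \<B> by (auto simp: ball_covers_def)
        then have "y \<in> ?O B" using max_cball_subset_open_cube[of "r B" "2 * r B"
            "x B"] xr(1,2)[OF B(1)] by auto
        with B(1) show "y \<in> (\<Union>B\<in>\<B>. ?O B)" by blast
      qed
      have "\<exists>j. K j - (\<Union>B\<in>\<B>. ?O B) = {}"
      proof (rule ccontr)
        assume "\<not> (\<exists>j. K j - (\<Union>B\<in>\<B>. ?O B) = {})"
        then have "(\<Inter>j. K j - (\<Union>B\<in>\<B>. ?O B)) \<noteq> {}"
        proof (intro compact_nest)
          show "compact (K j - (\<Union>B\<in>\<B>. ?O B))" for j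
            using K(1) by (intro compact_diff open_UN) (simp_all add: open_open_cube)
          show "K n - (\<Union>B\<in>\<B>. ?O B) \<subseteq> K m - (\<Union>B\<in>\<B>. ?O B)" if "m \<le> n" for m n
            using Kmono[OF that] by blast
        qed blast
        then obtain y where y: "y \<in> (\<Inter>j. K j - (\<Union>B\<in>\<B>. ?O B))" by (meson ex_in_conv)
        then have "y \<in> (\<Inter>j. K j)" "y \<notin> (\<Union>B\<in>\<B>. ?O B)" by simp_all
        with Klim cov show False by (meson subsetD)
      qed
      then obtain j where j: "K j \<subseteq> (\<Union>B\<in>\<B>. ?O B)" by blast
      have op: "open (?O B)" if "B \<in> \<B>" for B by (rule open_open_cube)
      obtain \<F> where \<F>: "\<F> \<subseteq> \<B>" "finite \<F>" "K j \<subseteq> (\<Union>B\<in>\<F>. ?O B)"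
        by (rule compactE_image[OF K(1) op j]) (assumption, rule that)
      have "ennreal \<mu> \<le> (\<integral>\<^sup>+y. ennreal (g j y) \<partial>lborel)" by (rule mass)
      also have "\<dots> \<le> (\<integral>\<^sup>+y. (\<Sum>B\<in>\<F>. ennreal (g j y) *
          indicator (max_cball (x B) (2 * r B)) y) \<partial>lborel)"
      proof (rule nn_integral_mono)
        fix y
        show "ennreal (g j y) \<le> (\<Sum>B\<in>\<F>. ennreal (g j y) * indicator (max_cball (x B) (2 * r B)) y)"
        proof (cases "g j y = 0")
          case False
          then obtain B where B: "B \<in> \<F>" "y \<in> ?O B" using g(3) \<F>(3) by blast
          then have "ennreal (g j y) = ennreal (g j y) * indicator (max_cball (x B) (2 * r B)) y"
            using open_cube_subset by (auto simp: indicator_def)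
          also have "\<dots> \<le> (\<Sum>B\<in>\<F>. ennreal (g j y) * indicator (max_cball (x B) (2 * r B)) y)"
            using B(1) \<F>(2) by (intro member_le_sum) auto
          finally show ?thesis .
        qed simp
      qed
      also have "\<dots> = (\<Sum>B\<in>\<F>. \<integral>\<^sup>+y. ennreal (g j y) *
          indicator (max_cball (x B) (2 * r B)) y \<partial>lborel)"
        by (rule nn_integral_sum) simp
      also have "\<dots> \<le> (\<Sum>B\<in>\<F>. ennreal \<epsilon> * ennreal (f (max_diameter B)))"
      proof (rule sum_mono)
        fix B assume "B \<in> \<F>"
        then have B: "B \<in> \<B>" using \<F>(1) by blast
        have "(\<integral>\<^sup>+y. ennreal (g j y) * indicator (max_cball (x B) (2 * r B)) y \<partial>lborel) \<le>
            ennreal (\<epsilon> * f (2 * r B))"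
          using xr(1,3)[OF B] by (intro ball) auto
        then show "(\<integral>\<^sup>+y. ennreal (g j y) * indicator (max_cball (x B) (2 * r B)) y \<partial>lborel) \<le>
            ennreal \<epsilon> * ennreal (f (max_diameter B))"
          using \<epsilon> by (simp add: xr(4)[OF B] ennreal_mult')
      qed
      also have "\<dots> = ennreal \<epsilon> * (\<Sum>B\<in>\<F>. ennreal (f (max_diameter B)))"
          by (simp add: sum_distrib_left)
      also have "(\<Sum>B\<in>\<F>. ennreal (f (max_diameter B))) \<le> (\<Sum>\<^sub>\<infinity>B\<in>\<B>. ennreal (f (max_diameter B)))"
        using \<F> by (subst nonneg_infsum_complete) (auto intro!: SUP_upper)
      finally show ?thesis by (simp add: mult_left_mono)
    qed
    then have "ennreal \<mu> / ennreal \<epsilon> \<le> hausdorff_content f \<rho> limsup_set"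
      unfolding hausdorff_content_def using \<epsilon>
          by (intro INF_greatest) (auto simp: divide_le_posI_ennreal mult.commute)
    also have "\<dots> \<le> hausdorff_measure f limsup_set"
      unfolding hausdorff_measure_eq_SUP using \<rho> by (intro SUP_upper) auto
    finally have "ennreal \<mu> / ennreal \<epsilon> * ennreal \<epsilon> \<le> hausdorff_measure f limsup_set * ennreal \<epsilon>"
      by (rule mult_right_mono) simp
    moreover have "ennreal \<mu> / ennreal \<epsilon> * ennreal \<epsilon> = ennreal \<mu>"
      using \<epsilon> \<mu> by (simp add: divide_ennreal flip: ennreal_mult')
    ultimately show ?thesis by (simp add: mult.commute)
  qed
  note bound = this
  show ?thesis
  proof (rule ccontr)
    assume "hausdorff_measure f limsup_set \<noteq> top"
    then obtain H where H: "hausdorff_measure f limsup_set = ennreal H" "0 \<le> H"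
        by (cases "hausdorff_measure f limsup_set") auto
    have "ennreal \<mu> \<le> ennreal (\<mu> / (2 * (H + 1)) * H)"
      using bound[of "\<mu> / (2 * (H + 1))"] \<mu> H by (simp add: ennreal_mult''[symmetric])
    then have "\<mu> \<le> \<mu> / (2 * (H + 1)) * H" using \<mu> H(2) by (subst (asm) ennreal_le_iff) auto
    moreover have "\<mu> / (2 * (H + 1)) * H < \<mu> * 1"
    proof -
      have "H / (2 * (H + 1)) < 1" using H(2) by (simp add: divide_less_eq)
      then have "\<mu> * (H / (2 * (H + 1))) < \<mu> * 1" using \<mu> by (rule mult_strict_left_mono)
      then show ?thesis by simp
    qed
    ultimately show False by simp
  qed
qed

end

section \<open>Scales and target intervals\<close>

text \<open>Between two consecutive elements of the set of scales, the product is a constant times a power of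
  the scale, so by \<open>f_cmp\<close> the whole expression is monotone there and the better endpoint works.\<close>

lemma exists_optimal_scale:
  fixes p q :: "'n :: finite \<Rightarrow> real" and f :: "real \<Rightarrow> real"
  assumes p: "\<And>i. 0 < p i" and q: "\<And>i. 0 < q i"
    and f_pos: "\<And>r. 0 < r \<Longrightarrow> 0 < f r" and f_mono: "\<And>r s. 0 < r \<Longrightarrow> r \<le> s \<Longrightarrow> f r \<le> f s"
    and f_le_d: "\<And>r s. 0 < r \<Longrightarrow> r \<le> s \<Longrightarrow> f s / s ^ CARD('n) \<le> f r / r ^ CARD('n)"
    and f_cmp: "\<And>k. 1 \<le> k \<Longrightarrow> k < CARD('n) \<Longrightarrow>
      (\<forall>r s. 0 < r \<longrightarrow> r \<le> s \<longrightarrow> f s / s ^ k \<le> f r / r ^ k) \<or>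
          (\<forall>r s. 0 < r \<longrightarrow> r \<le> s \<longrightarrow> f r / r ^ k \<le> f s / s ^ k)"
    and r: "0 < r" "r \<le> p i0"
  shows "\<exists>\<tau> \<in> range p \<union> range q. f \<tau> / \<tau> ^ CARD('n) * (\<Prod>i\<in>UNIV. min (p i) (max \<tau> (q i))) \<le>
    f r / r ^ CARD('n) * (\<Prod>i\<in>UNIV. min (p i) (max r (q i)))"
proof -
  \<comment> \<open>A \<open>q i\<close> exceeding \<open>p i\<close> is never active inside the
    minimum with \<open>p i\<close>; the truncation removes such scales.\<close>
  define q' where "q' i = min (p i) (q i)" for i
  define V where "V t = (\<Prod>i\<in>UNIV. min (p i) (max t (q i)))" for t
  have V_eq: "min (p i) (max t (q i)) = min (p i) (max t (q' i))" for i t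
      by (auto simp: q'_def min_def max_def)
  define A where "A = range p \<union> range q'"
  have A: "A \<subseteq> range p \<union> range q" "finite A" "\<And>\<tau>. \<tau> \<in> A \<Longrightarrow> 0 < \<tau>"
    using p q by (auto simp: A_def q'_def min_def)
  have V_pos: "0 < V t" if "0 < t" for t unfolding V_def using p that
      by (intro prod_pos) (auto simp: less_max_iff_disj)
  have ex: "\<exists>\<tau>\<in>A. f \<tau> / \<tau> ^ CARD('n) * V \<tau> \<le> f r / r ^ CARD('n) * V r"
  proof (cases "r \<in> A")
    case True
    then show ?thesis by auto
  next
    case rA: False
    let ?U = "{\<tau> \<in> A. r < \<tau>}"
    \<comment> \<open>The hypothesis \<open>r \<le> p i0\<close> guarantees a scale above
      \<open>r\<close>, so only the one below may be missing.\<close>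
    have "p i0 \<in> ?U" using r rA by (auto simp: A_def less_le)
    then have U: "finite ?U" "?U \<noteq> {}" using A(2) by auto
    define \<tau>2 where "\<tau>2 = Min ?U"
    have \<tau>2: "\<tau>2 \<in> A" "r < \<tau>2" "\<And>\<tau>. \<tau> \<in> A \<Longrightarrow> r < \<tau> \<Longrightarrow> \<tau>2 \<le> \<tau>"
      using Min_in[OF U] Min_le[OF U(1)] by (auto simp: \<tau>2_def)
    have r2: "0 < \<tau>2" using r \<tau>2 by simp
    let ?L = "{\<tau> \<in> A. \<tau> < r}"
    show ?thesis
    proof (cases "?L = {}")
      case True
      \<comment> \<open>Without a scale below \<open>r\<close> the product is constant up to the
        next scale, so only \<open>f r / r ^ d\<close> changes, and it is nonincreasing.\<close>
      have "min (p i) (max t (q' i)) = q' i" if "t \<le> \<tau>2" for i t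
      proof -
        have "q' i \<in> A" by (simp add: A_def)
        then have "\<tau>2 \<le> q' i" using True rA \<tau>2(3)
            by (metis (mono_tags, lifting) empty_iff linorder_neqE_linordered_idom mem_Collect_eq)
        then show ?thesis using that by (simp add: q'_def)
      qed
      then have "V r = V \<tau>2" using \<tau>2(2) unfolding V_def V_eq by (intro prod.cong) simp_all
      moreover have "f \<tau>2 / \<tau>2 ^ CARD('n) \<le> f r / r ^ CARD('n)" using f_le_d r \<tau>2 by simp
      ultimately show ?thesis using \<tau>2(1) V_pos[OF r2]
          by (intro bexI[of _ \<tau>2] mult_mono) (auto simp: less_imp_le f_pos r2 r)
    next
      case False
      have L: "finite ?L" using A(2) by auto
      define \<tau>1 where "\<tau>1 = Max ?L"
      have \<tau>1: "\<tau>1 \<in> A" "\<tau>1 < r" "\<And>\<tau>. \<tau> \<in> A \<Longrightarrow> \<tau> < r \<Longrightarrow> \<tau> \<le> \<tau>1"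
        using Max_in[OF L False] Max_ge[OF L] by (auto simp: \<tau>1_def)
      have r1: "0 < \<tau>1" using A \<tau>1 by blast
      have split: "\<tau> \<le> \<tau>1 \<or> \<tau>2 \<le> \<tau>" if "\<tau> \<in> A" for \<tau>
        using that \<tau>1(3) \<tau>2(3) rA by (metis linorder_neqE_linordered_idom)
      \<comment> \<open>Between the two scales, the coordinates in \<open>J\<close> contribute a
        factor \<open>t\<close> and all others a constant.\<close>
      define J where "J = {i. \<tau>2 \<le> p i \<and> q' i \<le> \<tau>1}"
      define c where "c i = (if p i \<le> \<tau>1 then p i else q' i)" for i
      define K where "K = (\<Prod>i\<in>- J. c i)"
      have fac: "min (p i) (max t (q' i)) = (if i \<in> J then t else c i)" if t: "\<tau>1 \<le> t" "t \<le> \<tau>2"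
          for i t
      proof -
        have a: "p i \<le> \<tau>1 \<or> \<tau>2 \<le> p i" "q' i \<le> \<tau>1 \<or> \<tau>2 \<le> q' i" "q' i \<le> p i"
          using split[of "p i"] split[of "q' i"] by (auto simp: A_def q'_def)
        show ?thesis
        proof (cases "i \<in> J")
          case True
          then have "max t (q' i) = t" "t \<le> p i" using t by (auto simp: J_def)
          then show ?thesis using True by simp
        next
          case False
          show ?thesis
          proof (cases "p i \<le> \<tau>1")
            case True
            then show ?thesis using False t by (simp add: c_def le_max_iff_disj)
          next
            case n: False
            then have "\<tau>2 \<le> q' i" using a False \<tau>1(2) \<tau>2(2) by (auto simp: J_def)
            then show ?thesis using False n t a(3) by (simp add: c_def)
          qed
        qed
      qed
      have K0: "0 < K" unfolding K_def c_def q'_def using p q by (intro prod_pos) auto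
      have VK: "V t = K * t ^ card J" if t: "\<tau>1 \<le> t" "t \<le> \<tau>2" for t
      proof -
        have "V t = (\<Prod>i\<in>UNIV. if i \<in> J then t else c i)" unfolding V_def V_eq using fac[OF t]
            by simp
        also have "\<dots> = (\<Prod>i\<in>J. t) * K" unfolding K_def by (subst prod.If_cases) (auto simp: Compl_eq)
        finally show ?thesis by simp
      qed
      define k where "k = CARD('n) - card J"
      have cJ: "card J \<le> CARD('n)" by (rule card_mono) auto
      have G: "f t / t ^ CARD('n) * V t = K * (f t / t ^ k)" if t: "\<tau>1 \<le> t" "t \<le> \<tau>2" for t
      proof -
        have "t ^ CARD('n) = t ^ k * t ^ card J" using cJ by (simp add: k_def flip: power_add)
        then show ?thesis unfolding VK[OF t] using r1 t by simp
      qed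
      \<comment> \<open>For \<open>k = 0\<close> monotonicity permits moving left, for
        \<open>k = d\<close> \<open>f_le_d\<close> permits moving right; in between, the
        comparability with \<open>r ^ k\<close> decides the direction.\<close>
      have "f \<tau>2 / \<tau>2 ^ k \<le> f r / r ^ k \<or> f \<tau>1 / \<tau>1 ^ k \<le> f r / r ^ k"
      proof -
        consider "k = 0" | "k = CARD('n)" | "1 \<le> k" "k < CARD('n)" using cJ by (force simp: k_def)
        then show ?thesis
        proof cases
          case 1
          then show ?thesis using f_mono[OF r1, of r] \<tau>1 by simp
        next
          case 2
          then show ?thesis using f_le_d[OF r(1), of \<tau>2] \<tau>2 by simp
        next
          case 3
          then show ?thesis using f_cmp[OF 3] r(1) r1 \<tau>1(2) \<tau>2(2) by (metis less_imp_le)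
        qed
      qed
      then show ?thesis
      proof
        assume "f \<tau>2 / \<tau>2 ^ k \<le> f r / r ^ k"
        then have "K * (f \<tau>2 / \<tau>2 ^ k) \<le> K * (f r / r ^ k)" using K0 by (intro mult_left_mono) auto
        moreover have "\<tau>1 \<le> \<tau>2" "\<tau>1 \<le> r" "r \<le> \<tau>2" using \<tau>1(2) \<tau>2(2) by auto
        ultimately show ?thesis using G[of \<tau>2] G[of r] \<tau>2(1) by (intro bexI[of _ \<tau>2]) simp_all
      next
        assume "f \<tau>1 / \<tau>1 ^ k \<le> f r / r ^ k"
        then have "K * (f \<tau>1 / \<tau>1 ^ k) \<le> K * (f r / r ^ k)" using K0 by (intro mult_left_mono) auto
        moreover have "\<tau>1 \<le> \<tau>2" "\<tau>1 \<le> r" "r \<le> \<tau>2" using \<tau>1(2) \<tau>2(2) by auto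
        ultimately show ?thesis using G[of \<tau>1] G[of r] \<tau>1(1) by (intro bexI[of _ \<tau>1]) simp_all
      qed
    qed
  qed
  then show ?thesis using A(1) unfolding V_def by blast
qed

text \<open>Factor by factor: the two expressions without \<open>C\<close> can differ only where
  \<open>q i > p i\<close>, and there \<open>q i \<le> C * p i\<close> costs a factor
  \<open>C\<close>. In the application \<open>C\<close> is a bound for all \<open>\<psi> i n\<close>
  with \<open>1 \<le> n\<close>.\<close>

lemma scale_term_le:
  fixes p q :: "'n :: finite \<Rightarrow> real"
  assumes p: "\<And>i. 0 < p i" and q: "\<And>i. 0 < q i" "\<And>i. q i \<le> C * p i" and C: "1 \<le> C" and \<tau>: "0 < \<tau>"
      and f: "0 \<le> f \<tau>"
  shows "f \<tau> * (\<Prod>i\<in>{i. p i \<le> \<tau>}. p i / \<tau>) * (\<Prod>i\<in>{i. \<tau> \<le> q i}. q i / \<tau>) \<le>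
    C ^ CARD('n) * (f \<tau> / \<tau> ^ CARD('n) * (\<Prod>i\<in>UNIV. min (p i) (max \<tau> (q i))))"
proof -
  let ?g = "\<lambda>i. (if p i \<le> \<tau> then p i / \<tau> else 1) * (if \<tau> \<le> q i then q i / \<tau> else 1)"
  have g: "0 \<le> ?g i \<and> ?g i \<le> C * min (p i) (max \<tau> (q i)) / \<tau>" for i
  proof -
    have a: "p i * q i \<le> \<tau> * (C * p i)" if "p i \<le> \<tau>"
      using mult_mono[OF that q(2)[of i]] p[of i] q(1)[of i] \<tau> by simp
    have b: "x \<le> C * x" if "0 \<le> x" for x using mult_right_mono[OF C that] by simp
    show ?thesis
    proof (cases "p i \<le> \<tau>")
      case True
      show ?thesis
      proof (cases "\<tau> \<le> q i")
        case q: True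
        then have "min (p i) (max \<tau> (q i)) = p i" using True by simp
        moreover have "p i * q i / (\<tau> * \<tau>) \<le> \<tau> * (C * p i) / (\<tau> * \<tau>)"
          using a[OF True] \<tau> by (intro divide_right_mono) auto
        ultimately show ?thesis using True q \<tau> p[of i] assms(2)[of i] by (simp add: less_imp_le)
      next
        case q: False
        then have "min (p i) (max \<tau> (q i)) = p i" using True by simp
        then show ?thesis using True q \<tau> p[of i] b[of "p i"]
            by (simp add: less_imp_le divide_right_mono)
      qed
    next
      case False
      show ?thesis
      proof (cases "\<tau> \<le> q i")
        case True
        have "q i \<le> C * min (p i) (q i)"
          using q(2)[of i] b[of "q i"] q(1)[of i] by (auto simp: min_def)
        then show ?thesis using True False \<tau> q(1)[of i] by (simp add: less_imp_le divide_right_mono)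
      next
        case q: False
        then have "min (p i) (max \<tau> (q i)) = \<tau>" using False by simp
        then show ?thesis using False q \<tau> C by simp
      qed
    qed
  qed
  have "(\<Prod>i\<in>{i. p i \<le> \<tau>}. p i / \<tau>) * (\<Prod>i\<in>{i. \<tau> \<le> q i}. q i / \<tau>) = (\<Prod>i\<in>UNIV. ?g i)"
    by (simp add: prod.distrib prod.If_cases)
  also have "\<dots> \<le> (\<Prod>i\<in>UNIV. C * min (p i) (max \<tau> (q i)) / \<tau>)"
    using g by (intro prod_mono) blast
  also have "\<dots> = C ^ CARD('n) * (\<Prod>i\<in>UNIV. min (p i) (max \<tau> (q i))) / \<tau> ^ CARD('n)"
    by (simp add: prod.distrib prod_dividef)
  finally have "f \<tau> * ((\<Prod>i\<in>{i. p i \<le> \<tau>}. p i / \<tau>) * (\<Prod>i\<in>{i. \<tau> \<le> q i}. q i / \<tau>)) \<le>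
     f \<tau> * (C ^ CARD('n) * (\<Prod>i\<in>UNIV. min (p i) (max \<tau> (q i))) / \<tau> ^ CARD('n))"
    using f by (rule mult_left_mono)
  then show ?thesis by (simp add: mult_ac)
qed

text \<open>Integrality of \<open>b\<close> enters here: \<open>b * frac y\<close> and
  \<open>b * y\<close> differ by an integer, so reducing modulo 1 once at the end has the same
  effect as at every step.\<close>

lemma beta_map_iterate:
  assumes "b \<in> \<int>" "x \<in> {0..<1}"
  shows "(beta_map b ^^ n) x = frac (b ^ n * x)"
proof (induction n)
  case 0
  then show ?case using assms(2) by (simp add: frac_eq)
next
  case (Suc n)
  obtain z :: int where z: "b = of_int z" using assms(1) by (elim Ints_cases)
  have eq: "b * frac y = b * y - of_int (z * \<lfloor>y\<rfloor>)" for y by (simp add: z frac_def algebra_simps)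
  have "frac (b * frac y) = frac (b * y)" for y
    unfolding eq by (simp only: frac_def floor_diff_of_int of_int_diff)
  then show ?case using Suc by (simp add: beta_map_def mult.assoc)
qed

lemma frac_in_cell:
  assumes "0 < (M :: nat)" "k / M \<le> x" "x < (real k + 1) / M"
  shows "frac (real M * x) = real M * x - k"
proof -
  have "real k \<le> M * x" "M * x < real k + 1"
    using assms by (simp_all add: divide_le_eq less_divide_eq mult.commute)
  then have "\<lfloor>M * x\<rfloor> = int k" by (intro floor_unique) auto
  then show ?thesis by (simp add: frac_def)
qed

text \<open>In each cell, the map \<open>x \<mapsto> M x - k - h x\<close> runs from a nonpositive value to a value that is almost
  nonnegative, so it is small somewhere and stays small on an interval of comparable length.\<close>

lemma exists_target_interval:
  assumes M: "0 < (M :: nat)" and k: "k < M" and h: "L-lipschitz_on {0..<1} h"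
      "h ` {0..<1} \<subseteq> {0..1}" and \<psi>: "0 < \<psi>"
  shows "\<exists>u. k / M \<le> u \<and> u + 1 / (4 * (1 + L)) * (min 1 \<psi> / M) < (real k + 1) / M \<and>
    (\<forall>x\<in>{u..u + 1 / (4 * (1 + L)) * (min 1 \<psi> / M)}. \<bar>frac (real M * x) - h x\<bar> < \<psi>)"
proof -
  have L: "0 \<le> L" using h(1) by (rule lipschitz_on_nonneg)
  define \<phi> where "\<phi> = min 1 \<psi>"
  have \<phi>: "0 < \<phi>" "\<phi> \<le> 1" "\<phi> \<le> \<psi>" using \<psi> by (auto simp: \<phi>_def)
  \<comment> \<open>With this length the function \<open>g\<close> below varies by at most
    \<open>\<phi> / 4\<close> on the interval, as its Lipschitz constant is at most
    \<open>M + L \<le> (1 + L) * M\<close>.\<close>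
  define len where "len = 1 / (4 * (1 + L)) * (\<phi> / M)"
  have len: "0 < len" "len \<le> 1 / (4 * M)" "(M + L) * len \<le> \<phi> / 4"
  proof -
    show "0 < len" using \<phi> M L by (simp add: len_def)
    have "1 / (4 * (1 + L)) * (\<phi> / M) \<le> 1 / 4 * (1 / M)"
      using \<phi> M L by (intro mult_mono divide_right_mono) (auto simp: divide_simps)
    then show "len \<le> 1 / (4 * M)" by (simp add: len_def)
    have "M + L \<le> (1 + L) * M" using M L mult_left_mono[of 1 "real M" L]
        by (simp add: algebra_simps)
    then have "(M + L) * len \<le> (1 + L) * M * len" using \<open>0 < len\<close> by (intro mult_right_mono) auto
    also have "\<dots> = \<phi> / 4"
    proof -
      have "A * m * (1 / (4 * A) * (\<phi> / m)) = \<phi> / 4" if "A \<noteq> 0" "m \<noteq> 0" for A m :: real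
        using that by (simp add: field_simps)
      from this[of "1 + L" "real M"] show ?thesis unfolding len_def using M L by linarith
    qed
    finally show "(M + L) * len \<le> \<phi> / 4" .
  qed
  define l where "l = k / real M"
  define R where "R = (real k + 1) / M"
  have lR: "R = l + 1 / M" "0 \<le> l" "R \<le> 1"
  proof -
    have "real k + 1 \<le> M" using k by linarith
    then show "R \<le> 1" using M by (simp add: R_def divide_le_eq)
  qed (simp_all add: l_def R_def add_divide_distrib)
  have Mp: "0 < 1 / real M" using M by simp
  have cell: "x \<in> {0..<1}" if "l \<le> x" "x < R" for x using that lR by auto
  define g where "g x = real M * x - k - h x" for x :: real
  have g_lip: "\<bar>g x - g y\<bar> \<le> (M + L) * \<bar>x - y\<bar>" if "l \<le> x" "x < R" "l \<le> y" "y < R" for x y :: real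
  proof -
    have "\<bar>h x - h y\<bar> \<le> L * \<bar>x - y\<bar>"
        using lipschitz_onD[OF h(1) cell[OF that(1,2)] cell[OF that(3,4)]]
        by (simp add: dist_real_def)
    moreover have "g x - g y = M * (x - y) - (h x - h y)" by (simp add: g_def algebra_simps)
    moreover have "\<bar>M * (x - y)\<bar> = M * \<bar>x - y\<bar>" by (simp add: abs_mult)
    ultimately show ?thesis by (simp add: distrib_right)
  qed
  \<comment> \<open>The point stays short of the right end, which for the last cell is outside the
    domain of \<open>h\<close>; the value of \<open>g\<close> at it is still at least
    \<open>- \<phi> / 4\<close> because \<open>h \<le> 1\<close>.\<close>
  define x1 where "x1 = R - \<phi> / (4 * M)"
  have f4: "\<phi> / (4 * M) \<le> 1 / M" "0 < \<phi> / (4 * M)" using \<phi> M by (auto simp: divide_simps)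
  have x1: "l \<le> x1" "x1 < R" unfolding x1_def using f4 lR(1) Mp by linarith+
  have gl: "g l \<le> 0"
  proof -
    have "l < R" using lR(1) Mp by linarith
    then have "h l \<in> {0..1}" using h(2) cell[of l] by blast
    moreover have "M * l = k" using M by (simp add: l_def)
    ultimately show ?thesis by (simp add: g_def)
  qed
  have gx1: "- \<phi> / 4 \<le> g x1"
  proof -
    have "h x1 \<in> {0..1}" using h(2) cell[OF x1] by blast
    moreover have "M * x1 = k + 1 - \<phi> / 4" using M by (simp add: x1_def R_def right_diff_distrib)
    ultimately show ?thesis by (simp add: g_def)
  qed
  have "\<exists>x0. l \<le> x0 \<and> x0 < R \<and> \<bar>g x0\<bar> \<le> \<phi> / 4"
  proof (cases "g x1 \<le> 0")
    case True
    then show ?thesis using x1 gx1 by (intro exI[of _ x1]) auto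
  next
    case False
    have "continuous_on {l..x1} h"
      by (rule continuous_on_subset[OF lipschitz_on_continuous_on[OF h(1)]]) (use cell x1 in auto)
    then have "continuous_on {l..x1} g" unfolding g_def by (intro continuous_intros)
    then obtain x0 where "l \<le> x0" "x0 \<le> x1" "g x0 = 0"
      using IVT'[of g l 0 x1] gl False x1 by auto
    then show ?thesis using x1 \<phi> by (intro exI[of _ x0]) auto
  qed
  then obtain x0 where x0: "l \<le> x0" "x0 < R" "\<bar>g x0\<bar> \<le> \<phi> / 4" by blast
  \<comment> \<open>The interval starts at \<open>x0\<close> if it then fits into the cell, and ends
    at \<open>x0\<close> otherwise.\<close>
  have "\<exists>u. l \<le> u \<and> u + len < R \<and> (\<forall>x\<in>{u..u + len}. \<bar>x - x0\<bar> \<le> len)"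
  proof (cases "x0 + len < R")
    case True
    then show ?thesis using x0 by (intro exI[of _ x0]) auto
  next
    case False
    have "len + len \<le> 1 / M" using len(2) Mp by (simp add: field_simps)
    then have "l \<le> x0 - len" using False lR(1) by linarith
    then show ?thesis using x0 by (intro exI[of _ "x0 - len"]) auto
  qed
  then obtain u where u: "l \<le> u" "u + len < R" "\<And>x. x \<in> {u..u + len} \<Longrightarrow> \<bar>x - x0\<bar> \<le> len" by blast
  have "\<bar>frac (real M * x) - h x\<bar> < \<psi>" if x: "x \<in> {u..u + len}" for x
  proof -
    have xc: "l \<le> x" "x < R" using x u by auto
    have "frac (real M * x) - h x = g x" using frac_in_cell[OF M, of k x] xc
        by (simp add: g_def l_def R_def)
    moreover have "\<bar>g x - g x0\<bar> \<le> (M + L) * len"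
      using g_lip[OF xc x0(1,2)] u(3)[OF x] L
          by (meson mult_left_mono order_trans add_nonneg_nonneg of_nat_0_le_iff)
    ultimately show ?thesis using x0(3) len(3) \<phi> by linarith
  qed
  with u show ?thesis unfolding l_def R_def len_def \<phi>_def by blast
qed

text \<open>If the truncated terms were summable they would tend to 0, so the truncation would be
  inactive from some index on.\<close>

lemma not_summable_min:
  fixes b :: "nat \<Rightarrow> real"
  assumes "\<not> summable b" "\<And>n. 0 \<le> b n" "\<And>n. min 1 (b n) \<le> b' n"
  shows "\<not> summable b'"
proof
  assume "summable b'"
  then have s: "summable (\<lambda>n. min 1 (b n))"
    by (rule summable_comparison_test'[where N = 0]) (use assms in simp)
  then have "(\<lambda>n. min 1 (b n)) \<longlonglongrightarrow> 0" by (rule summable_LIMSEQ_zero)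
  then have "eventually (\<lambda>n. min 1 (b n) < 1) sequentially" by (rule order_tendstoD) simp
  then have "eventually (\<lambda>n. min 1 (b n) = b n) sequentially"
      by eventually_elim (simp add: min_def split: if_splits)
  from summable_cong[OF this] s assms(1) show False by simp
qed

section \<open>The shrinking target problem\<close>

locale shrinking_targets =
  fixes \<beta> :: "'n :: finite \<Rightarrow> real" and \<psi> :: "'n \<Rightarrow> nat \<Rightarrow> real" and h :: "'n \<Rightarrow> real \<Rightarrow> real"
    and f :: "real \<Rightarrow> real" and L :: real
  assumes beta_gt_1: "\<And>i. 1 < \<beta> i"
    and beta_int: "\<And>i. \<beta> i \<in> \<int>"
    and h_lipschitz: "\<And>i. L-lipschitz_on {0..<1} (h i)"
    and h_range: "\<And>i. h i ` {0..<1} \<subseteq> {0..1}"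
    and psi_pos: "\<And>i n. 1 \<le> n \<Longrightarrow> 0 < \<psi> i n"
    and psi_bounded: "\<And>i. \<exists>C. \<forall>n\<ge>1. \<psi> i n \<le> C"
    and f_dim: "dimension_function f"
    and f_le_d: "f \<preceq> (\<lambda>r. r powr real CARD('n))"
    and f_cmp: "\<And>k::nat. 1 \<le> k \<Longrightarrow> k \<le> CARD('n) - 1 \<Longrightarrow>
      (\<lambda>r. r powr real k) \<preceq> f \<or> f \<preceq> (\<lambda>r. r powr real k)"
begin

lemma L_nonneg: "0 \<le> L"
  using h_lipschitz lipschitz_on_nonneg by blast

lemma f_mono: "0 \<le> r \<Longrightarrow> r \<le> s \<Longrightarrow> f r \<le> f s"
  using f_dim unfolding dimension_function_def by (auto simp: mono_on_def)

lemma f_nonneg: "0 \<le> r \<Longrightarrow> 0 \<le> f r"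
  using f_mono[of 0 r] f_dim by (simp add: dimension_function_def)

lemma f_le_power:
  assumes "f \<preceq> (\<lambda>r. r powr real k)" "0 < r" "r \<le> s"
  shows "f s / s ^ k \<le> f r / r ^ k"
proof (cases "r = s")
  case False
  then have "f s / s powr k \<le> f r / r powr k" using assms unfolding dim_le_def by simp
  then show ?thesis using assms by (simp add: powr_realpow)
qed simp

text \<open>\<open>base\<close> is the integer \<open>\<beta> i\<close> as a natural number, as
  needed for counting cells. The truncation by 1 in \<open>q\<close> keeps the box sides at most the
  cell sides, and \<open>c\<close> is the fraction provided by
  \<open>exists_target_interval\<close>.\<close>

definition "base i = nat \<lfloor>\<beta> i\<rfloor>"
definition "M i n = base i ^ n"
definition "p i n = 1 / real (M i n)"
definition "q i n = min 1 (\<psi> i n) / real (M i n)"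
definition "c = 1 / (4 * (1 + L))"

lemma base: "\<beta> i = real (base i)" "2 \<le> base i"
proof -
  obtain z :: int where z: "\<beta> i = of_int z" using beta_int[of i] by (elim Ints_cases)
  with beta_gt_1[of i] have "1 < z" by simp
  then show "\<beta> i = real (base i)" "2 \<le> base i" by (simp_all add: base_def z)
qed

lemma M_pos: "0 < M i n" using base(2)[of i] by (simp add: M_def)

lemma beta_power: "\<beta> i ^ n = real (M i n)" by (simp add: M_def base(1))

definition "good_left i n k u \<longleftrightarrow> k / M i n \<le> u \<and> u + c * q i n < (real k + 1) / M i n \<and>
  (\<forall>x\<in>{u..u + c * q i n}. \<bar>frac (real (M i n) * x) - h i x\<bar> < \<psi> i n)"

definition "left i n k = (SOME u. good_left i n k u)"

lemma good_left:
  assumes "1 \<le> n" "k < M i n"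
  shows "good_left i n k (left i n k)"
proof -
  have "\<exists>u. good_left i n k u"
    using exists_target_interval[OF M_pos assms(2) h_lipschitz[of i] h_range
        psi_pos[OF assms(1), of i]]
    unfolding good_left_def c_def q_def .
  then show ?thesis unfolding left_def by (rule someI_ex)
qed

sublocale comb_system left M p q c
proof (rule comb_system.intro)
  fix n i assume n: "1 \<le> (n :: nat)"
  have c: "0 < c" "c \<le> 1" using L_nonneg by (auto simp: c_def divide_le_eq)
  have q: "0 < q i n" "q i n \<le> p i n" using psi_pos[OF n, of i] M_pos[of i n]
      by (auto simp: q_def p_def intro!: divide_right_mono)
  have cell: "k / M i n \<le> left i n k \<and> left i n k + c * q i n \<le> (real k + 1) / M i n" if "k < M i n"
      for k :: nat
    using good_left[OF n that] unfolding good_left_def by (simp add: less_imp_le)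
  have "0 < c * q i n" "c * q i n \<le> q i n" using c q by simp_all
  with cell q(2) M_pos[of i n] show "comb (left i n) (M i n) (p i n) (c * q i n) (q i n)"
    by (auto simp: comb_def p_def)
next
  fix m n :: nat and i assume mn: "1 \<le> m" "m \<le> n"
  have "M i n = M i m * base i ^ (n - m)" using mn by (simp add: M_def flip: power_add)
  moreover have "(2 :: nat) ^ (n - m) \<le> base i ^ (n - m)" using base(2) by (intro power_mono) auto
  ultimately have "M i m * 2 ^ (n - m) \<le> M i n" by simp
  then have "1 / real (M i n) \<le> 1 / real (M i m * 2 ^ (n - m))"
    using M_pos[of i m] M_pos[of i n]
        by (intro divide_left_mono) (simp_all only: of_nat_le_iff, simp_all)
  then show "p i n \<le> p i m / 2 ^ (n - m)" by (simp add: p_def)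
qed

lemma target_subset:
  assumes n: "1 \<le> n" and x: "x \<in> target n"
  shows "x $ i \<in> {0..<1} \<and> \<bar>(beta_map (\<beta> i) ^^ n) (x $ i) - h i (x $ i)\<bar> < \<psi> i n"
proof -
  have "x $ i \<in> fat (left i n) (M i n) (c * q i n) 0" using x by (simp add: fatten_def)
  then obtain k where k: "k < M i n" "x $ i \<in> {left i n k..left i n k + c * q i n}"
      by (auto simp: fat_def)
  have g: "k / M i n \<le> left i n k" "left i n k + c * q i n < (real k + 1) / M i n"
    "\<bar>frac (real (M i n) * x $ i) - h i (x $ i)\<bar> < \<psi> i n"
    using good_left[OF n k(1)] k(2) unfolding good_left_def by auto
  have "0 \<le> k / M i n" by simp
  moreover have "(real k + 1) / M i n \<le> 1"
  proof -
    have "real k + 1 \<le> M i n" using k(1) by linarith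
    then show ?thesis using M_pos[of i n] by (simp add: divide_le_eq)
  qed
  ultimately have x01: "x $ i \<in> {0..<1}" using g k(2)
      by (simp only: atLeastAtMost_iff atLeastLessThan_iff) linarith
  with g(3) show ?thesis by (simp add: beta_map_iterate[OF beta_int x01] beta_power)
qed

lemma psi_uniform_bound:
  obtains C where "1 \<le> C" "\<And>i n. 1 \<le> n \<Longrightarrow> \<psi> i n \<le> C"
proof -
  obtain b where b: "\<And>i n. 1 \<le> n \<Longrightarrow> \<psi> i n \<le> b i" using psi_bounded by metis
  have "b i \<le> Max (insert 1 (range b))" for i by (rule Max_ge) auto
  with b have "\<psi> i n \<le> Max (insert 1 (range b))" if "1 \<le> n" for i n using that
      by (meson order_trans)
  then show thesis by (intro that[of "Max (insert 1 (range b))"]) (auto intro: Max_ge)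
qed

lemma K1_eq: "K1 \<beta> n \<tau> = {i. p i n \<le> \<tau>}" and K2_eq: "K2 \<beta> \<psi> n \<tau> = {i. \<tau> \<le> \<psi> i n * p i n}"
  and scales_eq: "scales \<beta> \<psi> n = range (\<lambda>i. p i n) \<union> range (\<lambda>i. \<psi> i n * p i n)"
  by (simp_all add: K1_def K2_def scales_def p_def beta_power)

definition "scale_term n \<tau> =
    f \<tau> * (\<Prod>i\<in>{i. p i n \<le> \<tau>}. p i n / \<tau>) * (\<Prod>i\<in>{i. \<tau> \<le> \<psi> i n * p i n}. \<psi> i n * p i n / \<tau>)"

lemma s_seq_eq: "s_seq \<beta> \<psi> f n = Min (scale_term n ` scales \<beta> \<psi> n)"
  unfolding s_seq_def scale_term_def[abs_def] K1_eq K2_eq by (simp add: p_def beta_power)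

lemma scales_finite: "finite (scales \<beta> \<psi> n)" "scales \<beta> \<psi> n \<noteq> {}"
  by (auto simp: scales_eq)

lemma scales_pos: "1 \<le> n \<Longrightarrow> \<tau> \<in> scales \<beta> \<psi> n \<Longrightarrow> 0 < \<tau>"
  using psi_pos M_pos by (auto simp: scales_eq p_def)

lemma scale_term_nonneg: "1 \<le> n \<Longrightarrow> 0 < \<tau> \<Longrightarrow> 0 \<le> scale_term n \<tau>"
  unfolding scale_term_def using f_nonneg[of \<tau>] psi_pos[of n] M_pos
  by (intro mult_nonneg_nonneg prod_nonneg) (auto simp: p_def less_imp_le)

lemma s_seq_nonneg: "1 \<le> n \<Longrightarrow> 0 \<le> s_seq \<beta> \<psi> f n"
  unfolding s_seq_eq using scales_finite scales_pos scale_term_nonneg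
  by (subst Min_ge_iff) auto

text \<open>The truncation in \<open>q\<close> is invisible here because of the outer minimum with
  \<open>p i n\<close>.\<close>

lemma volume_eq: "volume n r = (\<Prod>i\<in>UNIV. min (p i n) (max r (\<psi> i n * p i n)))"
proof -
  have "min (p i n) (max r (q i n)) = min (p i n) (max r (\<psi> i n * p i n))" for i
  proof -
    have "q i n = min (p i n) (\<psi> i n * p i n)"
      using M_pos[of i n] by (auto simp: q_def p_def min_def divide_le_cancel)
    then show ?thesis by (auto simp: min_def max_def)
  qed
  then show ?thesis by (simp add: volume_def)
qed

lemma critical_term_nonneg: "0 \<le> s_seq \<beta> \<psi> f (Suc n) * (\<Prod>i\<in>UNIV. \<beta> i ^ Suc n)"
  using s_seq_nonneg[of "Suc n"]
      by (intro mult_nonneg_nonneg prod_nonneg zero_le_power) (simp_all add: base(1))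

lemma critical_series_infinite:
  assumes "critical_series \<beta> \<psi> f = \<infinity>"
  shows "\<not> summable (\<lambda>n. s_seq \<beta> \<psi> f (Suc n) * (\<Prod>i\<in>UNIV. \<beta> i ^ Suc n))"
proof
  assume "summable (\<lambda>n. s_seq \<beta> \<psi> f (Suc n) * (\<Prod>i\<in>UNIV. \<beta> i ^ Suc n))"
  from ennreal_suminf_neq_top[OF this critical_term_nonneg] assms show False
    unfolding critical_series_def infinity_ennreal_def by (rule notE)
qed

text \<open>The intermediate value theorem between the smallest \<open>q i n\<close>, where the
  volume is that of a box, and the largest \<open>p i n\<close>, where it is that of a cell.\<close>

lemma exists_scale_of_volume:
  assumes n: "1 \<le> n" and s: "(\<Prod>i\<in>UNIV. q i n) \<le> s" "s \<le> (\<Prod>i\<in>UNIV. p i n)"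
  shows "\<exists>a. 0 < a \<and> (\<exists>i. a \<le> p i n) \<and> volume n a = s"
proof -
  define a0 where "a0 = Min (range (\<lambda>i. q i n))"
  define a1 where "a1 = Max (range (\<lambda>i. p i n))"
  have a0: "a0 \<in> range (\<lambda>i. q i n)" "\<And>i. a0 \<le> q i n" unfolding a0_def by (auto intro: Min_in Min_le)
  have a1: "a1 \<in> range (\<lambda>i. p i n)" "\<And>i. p i n \<le> a1" unfolding a1_def by (auto intro: Max_in Max_ge)
  have pos: "0 < a0" using a0(1) q_pos[OF n] by auto
  have le: "a0 \<le> a1" using a0(2) q_le[OF n] a1(2) by (meson order_trans)
  have v0: "volume n a0 = (\<Prod>i\<in>UNIV. q i n)"
    unfolding volume_def using a0(2) q_le[OF n]
        by (intro prod.cong) (auto simp: max_absorb2 min_absorb2)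
  have v1: "volume n a1 = (\<Prod>i\<in>UNIV. p i n)"
    unfolding volume_def using a1(2) by (intro prod.cong) (auto simp: min_absorb1 le_max_iff_disj)
  have "continuous_on {a0..a1} (volume n)"
    unfolding volume_def[abs_def] by (intro continuous_intros)
  then obtain a where a: "a0 \<le> a" "a \<le> a1" "volume n a = s"
    using IVT'[of "volume n" a0 s a1] s v0 v1 le by auto
  then show ?thesis using pos a1(1) by (intro exI[of _ a]) auto
qed

end

text \<open>Dividing by \<open>f\<close>, as in \<open>power_le_f\<close>, needs \<open>f\<close> to
  be positive; an identically vanishing \<open>f\<close> is treated by
  \<open>critical_series_eq_0\<close>.\<close>

locale nonzero_shrinking_targets = shrinking_targets \<beta> \<psi> h f L
  for \<beta> :: "'n :: finite \<Rightarrow> real" and \<psi> :: "'n \<Rightarrow> nat \<Rightarrow> real" and h :: "'n \<Rightarrow> real \<Rightarrow> real"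
    and f :: "real \<Rightarrow> real" and L :: real +
  assumes f_nonzero: "\<exists>r>0. f r \<noteq> 0"
begin

text \<open>Monotonicity carries positivity to larger \<open>r\<close>, and the nonincreasing
  quotient \<open>f r / r ^ d\<close> carries it to smaller \<open>r\<close>.\<close>

lemma f_pos:
  assumes "0 < r"
  shows "0 < f r"
proof -
  obtain t where t: "0 < t" "f t \<noteq> 0" using f_nonzero by blast
  then have ft: "0 < f t" using f_nonneg[of t] by simp
  show ?thesis
  proof (cases "t \<le> r")
    case True
    then show ?thesis using f_mono[of t r] ft t by simp
  next
    case False
    then have "f t / t ^ CARD('n) \<le> f r / r ^ CARD('n)" using f_le_power[OF f_le_d assms, of t]
        by simp
    moreover have "0 < f t / t ^ CARD('n)" using ft t by simp
    ultimately have "0 < f r / r ^ CARD('n)" by linarith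
    then show ?thesis using assms by (simp add: zero_less_divide_iff)
  qed
qed

lemma power_le_f:
  assumes "(\<lambda>r. r powr real k) \<preceq> f" "0 < r" "r \<le> s"
  shows "f r / r ^ k \<le> f s / s ^ k"
proof (cases "r = s")
  case False
  then have "s powr k / f s \<le> r powr k / f r" using assms unfolding dim_le_def by simp
  then have "s ^ k / f s \<le> r ^ k / f r" using assms by (simp add: powr_realpow)
  then show ?thesis using f_pos[of r] f_pos[of s] assms by (simp add: field_simps)
qed simp

text \<open>\<open>exists_optimal_scale\<close> moves an arbitrary \<open>r\<close> to one of the
  finitely many scales, and \<open>scale_term_le\<close> compares the two forms of the expression
  there. This is what makes \<open>volume_le\<close> available at all radii.\<close>

lemma s_seq_le_volume:
  assumes C: "1 \<le> C" "\<And>i n. 1 \<le> n \<Longrightarrow> \<psi> i n \<le> C" and n: "1 \<le> n" and r: "0 < r" "r \<le> p i0 n"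
  shows "s_seq \<beta> \<psi> f n \<le> C ^ CARD('n) * (f r / r ^ CARD('n) * volume n r)"
proof -
  have p: "0 < p i n" for i using M_pos by (simp add: p_def)
  have q: "0 < \<psi> i n * p i n" "\<psi> i n * p i n \<le> C * p i n" for i
    using psi_pos[OF n] p C(2)[OF n] by (auto intro: mult_right_mono simp: less_imp_le)
  have "\<exists>\<tau>\<in>range (\<lambda>i. p i n) \<union> range (\<lambda>i. \<psi> i n * p i n). f \<tau> / \<tau> ^ CARD('n) *
      (\<Prod>i\<in>UNIV. min (p i n) (max \<tau> (\<psi> i n * p i n)))
    \<le> f r / r ^ CARD('n) * (\<Prod>i\<in>UNIV. min (p i n) (max r (\<psi> i n * p i n)))"
  proof (rule exists_optimal_scale)
    show "(\<forall>r s. 0 < r \<longrightarrow> r \<le> s \<longrightarrow> f s / s ^ k \<le> f r / r ^ k) \<or>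
        (\<forall>r s. 0 < r \<longrightarrow> r \<le> s \<longrightarrow> f r / r ^ k \<le> f s / s ^ k)"
      if "1 \<le> k" "k < CARD('n)" for k
    proof -
      have "k \<le> CARD('n) - 1" using that by simp
      from f_cmp[OF that(1) this] show ?thesis using f_le_power power_le_f by blast
    qed
  qed (use p q r f_pos f_mono f_le_power[OF f_le_d] in \<open>auto simp: less_imp_le\<close>)
  then obtain \<tau> where \<tau>: "\<tau> \<in> scales \<beta> \<psi> n"
      "f \<tau> / \<tau> ^ CARD('n) * volume n \<tau> \<le> f r / r ^ CARD('n) * volume n r"
    unfolding scales_eq volume_eq by blast
  have "s_seq \<beta> \<psi> f n \<le> scale_term n \<tau>" unfolding s_seq_eq using \<tau>(1) scales_finite
      by (intro Min_le) auto
  also have "\<dots> \<le> C ^ CARD('n) * (f \<tau> / \<tau> ^ CARD('n) * volume n \<tau>)"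
    unfolding scale_term_def volume_eq using scales_pos[OF n \<tau>(1)]
    by (intro scale_term_le p q C(1) f_nonneg) auto
  also have "\<dots> \<le> C ^ CARD('n) * (f r / r ^ CARD('n) * volume n r)"
    using \<tau>(2) C(1) by (intro mult_left_mono) auto
  finally show ?thesis .
qed

lemma exists_target_density:
  assumes div: "critical_series \<beta> \<psi> f = \<infinity>" and \<epsilon>: "0 < \<epsilon>" and \<delta>: "0 < \<delta>"
  shows "\<exists>\<sigma> I. finite I \<and> (\<forall>n\<in>I. N \<le> n) \<and> continuous_on UNIV \<sigma> \<and> (\<forall>x. 0 \<le> \<sigma> x) \<and>
      (\<forall>x. \<sigma> x \<noteq> 0 \<longrightarrow> x \<in> (\<Union>n\<in>I. target n)) \<and>
      (\<forall>x r. 0 < r \<longrightarrow> (\<integral>\<^sup>+y. ennreal (\<sigma> y) * indicator (max_cball x r) y \<partial>lborel) \<le> ennreal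
          (ball_const * (r ^ CARD('n) + \<epsilon> * f r))) \<and>
      (\<forall>s. (\<forall>i. 0 \<le> s i \<and> s i + \<delta> \<le> 1) \<longrightarrow> ennreal (mass_const * \<delta> ^ CARD('n)) \<le>
        (\<integral>\<^sup>+y. ennreal (\<sigma> y) * indicator (box_product (\<lambda>i. {s i + \<delta> / 4..s i + 3 * \<delta> / 4})) y
            \<partial>lborel))"
proof -
  obtain C where C: "1 \<le> C" "\<And>i n. 1 \<le> n \<Longrightarrow> \<psi> i n \<le> C" by (rule psi_uniform_bound) (rule that)
  have Cd: "0 < C ^ CARD('n)" using C by simp
  define S where "S n = s_seq \<beta> \<psi> f n" for n
  \<comment> \<open>The volume that \<open>a n\<close> shall have: a multiple of
    \<open>\<epsilon> * S n\<close>, clamped to the interval in which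
    \<open>exists_scale_of_volume\<close> finds a scale.\<close>
  define z where "z n = max (\<Prod>i\<in>UNIV. q i n) (min (\<Prod>i\<in>UNIV. p i n) (\<epsilon> / C ^ CARD('n) * S n))" for n
  have pq: "(\<Prod>i\<in>UNIV. q i n) \<le> (\<Prod>i\<in>UNIV. p i n)" if "1 \<le> n" for n
    using q_le[OF that] q_pos[OF that] by (intro prod_mono) (auto simp: less_imp_le)
  have "\<exists>a. 1 \<le> n \<longrightarrow> 0 < a \<and> (\<exists>i. a \<le> p i n) \<and> volume n a = z n" for n
    using exists_scale_of_volume[of n "z n"] pq[of n] by (auto simp: z_def)
  then obtain a where a: "\<And>n. 1 \<le> n \<Longrightarrow> 0 < a n \<and> (\<exists>i. a n \<le> p i n) \<and> volume n (a n) = z n" by metis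
  define \<Theta> where "\<Theta> r = 1 + \<epsilon> * (f r / r ^ CARD('n))" for r
  have W: "weighted_combs left M p q c a \<Theta>"
  proof
    show "0 < a n" "\<exists>i. a n \<le> p i n" if "1 \<le> n" for n using a[OF that] by auto
    show \<Theta>1: "1 \<le> \<Theta> r" if "0 < r" for r using f_pos[OF that] \<epsilon> that by (simp add: \<Theta>_def)
    show "volume n (a n) \<le> \<Theta> r * volume n r" if n: "1 \<le> n" and r: "0 < r" for n r
    proof -
      have V: "0 < volume n r" using volume_pos[OF n] .
      have q_vol: "(\<Prod>i\<in>UNIV. q i n) \<le> volume n r"
        unfolding volume_def using q_pos[OF n] q_le[OF n]
            by (intro prod_mono) (auto simp: less_imp_le)
      have one: "volume n r \<le> \<Theta> r * volume n r" using \<Theta>1[OF r] V by simp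
      \<comment> \<open>If \<open>r\<close> is at most some cell side,
        \<open>s_seq_le_volume\<close> applies; beyond all of them \<open>volume n r\<close> is
        already that of the cell.\<close>
      have "min (\<Prod>i\<in>UNIV. p i n) (\<epsilon> / C ^ CARD('n) * S n) \<le> \<Theta> r * volume n r"
      proof (cases "\<exists>i. r \<le> p i n")
        case True
        then obtain i where i: "r \<le> p i n" by blast
        have "S n \<le> C ^ CARD('n) * (f r / r ^ CARD('n) * volume n r)"
          unfolding S_def by (rule s_seq_le_volume[OF C n r i])
        then have "\<epsilon> / C ^ CARD('n) * S n \<le>
            \<epsilon> / C ^ CARD('n) * (C ^ CARD('n) * (f r / r ^ CARD('n) * volume n r))"
          using \<epsilon> Cd by (intro mult_left_mono) auto
        also have "\<dots> = \<epsilon> * (f r / r ^ CARD('n)) * volume n r" using less_imp_neq[OF Cd, symmetric]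
            by simp
        also have "\<dots> \<le> \<Theta> r * volume n r" unfolding \<Theta>_def using V by (intro mult_right_mono) auto
        finally show ?thesis by simp
      next
        case False
        then have "volume n r = (\<Prod>i\<in>UNIV. p i n)"
          unfolding volume_def by (intro prod.cong)
              (auto simp: not_le min_absorb1 le_max_iff_disj less_imp_le)
        then show ?thesis using one by simp
      qed
      then show ?thesis using a[OF n] q_vol one by (simp add: z_def)
    qed
    \<comment> \<open>Clamping from above truncates the proportion at 1, which
      \<open>not_summable_min\<close> tolerates; \<open>\<epsilon>\<close> only rescales the
      series.\<close>
    have le: "min 1 (\<epsilon> / C ^ CARD('n) * (S (Suc n) * (\<Prod>i\<in>UNIV. \<beta> i ^ Suc n))) \<le>
        proportion (Suc n) (a (Suc n))" for n
    proof -
      let ?P = "\<Prod>i\<in>UNIV. p i (Suc n)"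
      have P: "0 < ?P" using p_pos[of "Suc n"] by (intro prod_pos) auto
      have Pb: "(\<Prod>i\<in>UNIV. \<beta> i ^ Suc n) = 1 / ?P"
          by (simp add: p_def beta_power prod_dividef del: power_Suc)
      have "min 1 (\<epsilon> / C ^ CARD('n) * (S (Suc n) * (1 / ?P))) =
          min ?P (\<epsilon> / C ^ CARD('n) * S (Suc n)) / ?P"
      proof -
        have "min 1 (e * (x * (1 / P))) = min P (e * x) / P" if "0 < P" for e x P :: real
          using that by (simp add: min_divide_distrib_right)
        from this[OF P] show ?thesis .
      qed
      also have "\<dots> \<le> z (Suc n) / ?P" using P by (intro divide_right_mono) (auto simp: z_def)
      also have "\<dots> = proportion (Suc n) (a (Suc n))" using a[of "Suc n"]
          by (simp add: proportion_eq)
      finally show ?thesis unfolding Pb .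
    qed
    have ns: "\<not> summable (\<lambda>n. \<epsilon> / C ^ CARD('n) * (S (Suc n) * (\<Prod>i\<in>UNIV. \<beta> i ^ Suc n)))"
    proof -
      have "\<epsilon> / C ^ CARD('n) \<noteq> 0" using \<epsilon> C(1) by auto
      then show ?thesis using critical_series_infinite[OF div] unfolding S_def
          by (simp only: summable_cmult_iff) simp
    qed
    have nn: "0 \<le> \<epsilon> / C ^ CARD('n) * (S (Suc n) * (\<Prod>i\<in>UNIV. \<beta> i ^ Suc n))" for n
      unfolding S_def using \<epsilon> Cd by (intro mult_nonneg_nonneg[OF _ critical_term_nonneg]) simp
    show "\<not> summable (\<lambda>n. proportion (Suc n) (a (Suc n)))"
      by (rule not_summable_min[OF ns nn le])
  qed
  interpret weighted_combs left M p q c a \<Theta> by (rule W)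
  obtain \<sigma> :: "real ^ 'n \<Rightarrow> real" and I where \<sigma>: "finite I" "\<And>n. n \<in> I \<Longrightarrow> N \<le> n \<and> 1 \<le> n"
    "continuous_on UNIV \<sigma>" "\<And>x. 0 \<le> \<sigma> x" "\<And>x. \<sigma> x \<noteq> 0 \<Longrightarrow> x \<in> (\<Union>n\<in>I. target n)"
    "\<And>x r. 0 < r \<Longrightarrow> (\<integral>\<^sup>+y. ennreal (\<sigma> y) * indicator (max_cball x r) y \<partial>lborel) \<le>
        ennreal (ball_const * (\<Theta> r * r ^ CARD('n)))"
    "\<And>s. \<forall>i. 0 \<le> s i \<and> s i + \<delta> \<le> 1 \<Longrightarrow> ennreal (mass_const * \<delta> ^ CARD('n)) \<le>
      (\<integral>\<^sup>+y. ennreal (\<sigma> y) * indicator (box_product (\<lambda>i. {s i + \<delta> / 4..s i + 3 * \<delta> / 4})) y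
          \<partial>lborel)"
    by (rule exists_density[OF \<delta>]) (rule that)
  have \<Theta>_eq: "\<Theta> r * r ^ CARD('n) = r ^ CARD('n) + \<epsilon> * f r" if "0 < r" for r
    using that by (simp add: \<Theta>_def distrib_right)
  show ?thesis
  proof (intro exI[of _ \<sigma>] exI[of _ I] conjI ballI allI impI)
    show "(\<integral>\<^sup>+y. ennreal (\<sigma> y) * indicator (max_cball x r) y \<partial>lborel) \<le>
        ennreal (ball_const * (r ^ CARD('n) + \<epsilon> * f r))"
      if "0 < r" for x r
      using \<sigma>(6)[OF that, of x] unfolding \<Theta>_eq[OF that] .
  qed (use \<sigma> in blast)+
qed

end

section \<open>The convergence case\<close>

lemma exists_interval_cover:
  fixes a l \<tau> :: real
  assumes "0 \<le> l" "0 < \<tau>"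
  shows "\<exists>Z. finite Z \<and> real (card Z) \<le> l / \<tau> + 1 \<and> {a..a + l} \<subseteq> (\<Union>z\<in>Z. {z - \<tau> / 2..z + \<tau> / 2})"
proof -
  define K where "K = nat \<lfloor>l / \<tau>\<rfloor>"
  have lt: "0 \<le> l / \<tau>" using assms by simp
  define Z where "Z = (\<lambda>j. a + \<tau> / 2 + real j * \<tau>) ` {..K}"
  have "card Z \<le> card {..K}" unfolding Z_def by (rule card_image_le) simp
  then have "real (card Z) \<le> real K + 1" by simp
  also have "real K \<le> l / \<tau>" using lt by (simp add: K_def)
  finally have "real (card Z) \<le> l / \<tau> + 1" by simp
  moreover have "{a..a + l} \<subseteq> (\<Union>z\<in>Z. {z - \<tau> / 2..z + \<tau> / 2})"
  proof
    fix x assume x: "x \<in> {a..a + l}"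
    define j where "j = nat \<lfloor>(x - a) / \<tau>\<rfloor>"
    have xa: "0 \<le> (x - a) / \<tau>" using x assms by simp
    have "(x - a) / \<tau> \<le> l / \<tau>" using x assms by (intro divide_right_mono) auto
    then have "j \<le> K" unfolding j_def K_def by (intro nat_mono floor_mono)
    moreover have "real j \<le> (x - a) / \<tau>" "(x - a) / \<tau> < real j + 1" using xa unfolding j_def
        by linarith+
    then have "real j * \<tau> \<le> x - a" "x - a < (real j + 1) * \<tau>" using assms
        by (simp_all add: pos_le_divide_eq pos_divide_less_eq)
    then have "x \<in> {a + \<tau> / 2 + real j * \<tau> - \<tau> / 2..a + \<tau> / 2 + real j * \<tau> + \<tau> / 2}"
      by (simp add: distrib_right)
    ultimately show "x \<in> (\<Union>z\<in>Z. {z - \<tau> / 2..z + \<tau> / 2})" unfolding Z_def by blast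
  qed
  ultimately show ?thesis by (intro exI[of _ Z]) (simp add: Z_def)
qed

context shrinking_targets begin

definition "solutions n =
    {x :: real ^ 'n. \<forall>i. x $ i \<in> {0..<1} \<and> \<bar>(beta_map (\<beta> i) ^^ n) (x $ i) - h i (x $ i)\<bar> < \<psi> i n}"

text \<open>If \<open>p i n \<le> \<tau>\<close>, the whole unit interval is covered. Otherwise each
  cell is treated separately: \<open>2 * L \<le> 2 ^ n \<le> M i n\<close> makes
  \<open>M i n * y - h i y\<close> expand distances at least by the factor \<open>M i n / 2\<close>,
  so the solutions in a cell lie within \<open>4 * \<psi> i n * p i n\<close> of any one of
  them.\<close>

lemma exists_coordinate_cover:
  assumes n: "1 \<le> n" "2 * L \<le> 2 ^ n" and C: "1 \<le> C" "\<tau> \<le> C" and \<tau>: "0 < \<tau>"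
  shows "\<exists>Z. finite Z \<and> {y \<in> {0..<1}. \<bar>frac (real (M i n) * y) - h i y\<bar> < \<psi> i n} \<subseteq>
      (\<Union>z\<in>Z. {z - \<tau> / 2..z + \<tau> / 2}) \<and>
    real (card Z) \<le> (9 + C) *
        (M i n * ((if p i n \<le> \<tau> then p i n / \<tau> else 1) *
        (if \<tau> \<le> \<psi> i n * p i n then \<psi> i n * p i n / \<tau> else 1)))"
proof -
  let ?S = "{y \<in> {0..<1}. \<bar>frac (real (M i n) * y) - h i y\<bar> < \<psi> i n}"
  let ?a = "if p i n \<le> \<tau> then p i n / \<tau> else 1" and ?b =
      "if \<tau> \<le> \<psi> i n * p i n then \<psi> i n * p i n / \<tau> else 1"
  let ?M = "real (M i n)" and ?q = "\<psi> i n * p i n"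
  have Mp: "?M * p i n = 1" "0 < ?M" using M_pos[of i n] by (auto simp: p_def)
  have p0: "0 < p i n" using p_pos[OF n(1)] .
  have q0: "0 < ?q" using p0 psi_pos[OF n(1)] by simp
  have b1: "1 \<le> ?b" using \<tau> by simp
  show ?thesis
  proof (cases "p i n \<le> \<tau>")
    case True
    obtain Z where Z: "finite Z" "real (card Z) \<le> 1 / \<tau> + 1"
        "{0..0 + 1} \<subseteq> (\<Union>z\<in>Z. {z - \<tau> / 2..z + \<tau> / 2})"
      using exists_interval_cover[of 1 \<tau> 0] \<tau> by auto
    \<comment> \<open>The bound \<open>\<tau> \<le> C\<close> absorbs the one interval in excess of
      \<open>1 / \<tau>\<close>.\<close>
    have "1 \<le> C / \<tau>" using C \<tau> by simp
    then have "real (card Z) \<le> 1 / \<tau> + C / \<tau>" using Z(2) by linarith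
    also have "\<dots> \<le> (9 + C) / \<tau>" using \<tau> by (simp flip: add_divide_distrib add: divide_right_mono)
    also have "\<dots> = (9 + C) * (?M * (?a * 1))" using True Mp by (simp add: field_simps)
    also have "\<dots> \<le> (9 + C) * (?M * (?a * ?b))"
      using b1 C Mp p0 \<tau> True by (intro mult_left_mono) auto
    finally show ?thesis using Z(1,3) by (intro exI[of _ Z]) auto
  next
    case False
    have cell: "\<exists>Z. finite Z \<and> real (card Z) \<le> 9 * ?b \<and>
        {y \<in> ?S. k / ?M \<le> y \<and> y < (real k + 1) / ?M} \<subseteq> (\<Union>z\<in>Z. {z - \<tau> / 2..z + \<tau> / 2})" for k :: nat
    proof (cases "{y \<in> ?S. k / ?M \<le> y \<and> y < (real k + 1) / ?M} = {}")
      case True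
      then show ?thesis using b1 by (intro exI[of _ "{}"]) auto
    next
      case ne: False
      then obtain y0 where y0: "y0 \<in> ?S" "k / ?M \<le> y0" "y0 < (real k + 1) / ?M" by blast
      have near: "\<bar>y - y0\<bar> \<le> 4 * ?q" if y: "y \<in> ?S" "k / ?M \<le> y" "y < (real k + 1) / ?M" for y
      proof -
        have "\<bar>?M * y - k - h i y\<bar> < \<psi> i n" "\<bar>?M * y0 - k - h i y0\<bar> < \<psi> i n"
          using y y0 frac_in_cell[OF M_pos, of k i n] by auto
        moreover have "\<bar>h i y - h i y0\<bar> \<le> L * \<bar>y - y0\<bar>"
          using lipschitz_onD[OF h_lipschitz, of y y0 i] y(1) y0(1) by (simp add: dist_real_def)
        moreover have "L * \<bar>y - y0\<bar> \<le> ?M / 2 * \<bar>y - y0\<bar>"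
        proof (rule mult_right_mono)
          have "(2 :: nat) ^ n \<le> M i n" unfolding M_def using base(2) by (intro power_mono) auto
          then have "(2 :: real) ^ n \<le> ?M" by (metis of_nat_le_iff of_nat_numeral of_nat_power)
          with n(2) show "L \<le> ?M / 2" by linarith
        qed simp
        moreover have "?M * \<bar>y - y0\<bar> = \<bar>?M * y - ?M * y0\<bar>"
            by (simp add: abs_mult flip: right_diff_distrib)
        moreover have "?M * \<bar>y - y0\<bar> = 2 * (?M / 2 * \<bar>y - y0\<bar>)" by simp
        ultimately have "?M * \<bar>y - y0\<bar> \<le> 4 * \<psi> i n" by linarith
        then have "p i n * (?M * \<bar>y - y0\<bar>) \<le> p i n * (4 * \<psi> i n)" using p0
            by (intro mult_left_mono) auto
        moreover have "p i n * (?M * \<bar>y - y0\<bar>) = (?M * p i n) * \<bar>y - y0\<bar>" by (simp only: ac_simps)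
        moreover have "p i n * (4 * \<psi> i n) = 4 * ?q" by (simp only: ac_simps)
        ultimately show ?thesis unfolding Mp(1) by simp
      qed
      obtain Z where Z: "finite Z" "real (card Z) \<le> 8 * ?q / \<tau> + 1"
          "{y0 - 4 * ?q..y0 - 4 * ?q + 8 * ?q} \<subseteq> (\<Union>z\<in>Z. {z - \<tau> / 2..z + \<tau> / 2})"
        using exists_interval_cover[of "8 * ?q" \<tau> "y0 - 4 * ?q"] \<tau> q0 by auto
      have "8 * ?q / \<tau> + 1 \<le> 9 * ?b"
      proof (cases "\<tau> \<le> ?q")
        case True
        then have "1 \<le> ?q / \<tau>" using \<tau> by simp
        then show ?thesis using True by simp
      next
        case False
        then have "?q / \<tau> \<le> 1" using \<tau> by simp
        then show ?thesis using False by simp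
      qed
      moreover have "{y \<in> ?S. k / ?M \<le> y \<and> y < (real k + 1) / ?M} \<subseteq>
          {y0 - 4 * ?q..y0 - 4 * ?q + 8 * ?q}"
      proof
        fix y assume "y \<in> {y \<in> ?S. k / ?M \<le> y \<and> y < (real k + 1) / ?M}"
        then have "\<bar>y - y0\<bar> \<le> 4 * ?q" using near by blast
        then show "y \<in> {y0 - 4 * ?q..y0 - 4 * ?q + 8 * ?q}"
            by (simp only: atLeastAtMost_iff) linarith
      qed
      ultimately show ?thesis using Z by (intro exI[of _ Z]) auto
    qed
    have "\<exists>Z. \<forall>k :: nat. finite (Z k) \<and> real (card (Z k)) \<le> 9 * ?b \<and>
        {y \<in> ?S. k / ?M \<le> y \<and> y < (real k + 1) / ?M} \<subseteq> (\<Union>z\<in>Z k. {z - \<tau> / 2..z + \<tau> / 2})"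
      by (intro choice allI cell)
    then obtain Z where "\<forall>k :: nat. finite (Z k) \<and> real (card (Z k)) \<le> 9 * ?b \<and>
        {y \<in> ?S. k / ?M \<le> y \<and> y < (real k + 1) / ?M} \<subseteq>
            (\<Union>z\<in>Z k. {z - \<tau> / 2..z + \<tau> / 2})" by (rule exE)
    then have Z: "\<And>k. finite (Z k)" "\<And>k. real (card (Z k)) \<le> 9 * ?b"
      "\<And>k :: nat. {y \<in> ?S. k / ?M \<le> y \<and> y < (real k + 1) / ?M} \<subseteq> (\<Union>z\<in>Z k. {z - \<tau> / 2..z + \<tau> / 2})"
      by (simp_all only:)
    let ?Z = "\<Union>k<M i n. Z k"
    have "card ?Z \<le> (\<Sum>k<M i n. card (Z k))" by (rule card_UN_le) simp
    then have "real (card ?Z) \<le> (\<Sum>k<M i n. real (card (Z k)))" by (metis of_nat_le_iff of_nat_sum)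
    also have "\<dots> \<le> (\<Sum>k<M i n. 9 * ?b)" by (intro sum_mono Z(2))
    also have "\<dots> = 9 * (?M * (?a * ?b))" using False by simp
    also have "\<dots> \<le> (9 + C) * (?M * (?a * ?b))" using C b1 False by (intro mult_right_mono) auto
    finally have card: "real (card ?Z) \<le> (9 + C) * (?M * (?a * ?b))" .
    have "?S \<subseteq> (\<Union>z\<in>?Z. {z - \<tau> / 2..z + \<tau> / 2})"
    proof
      fix y assume y: "y \<in> ?S"
      define k where "k = nat \<lfloor>y * ?M\<rfloor>"
      have y01: "0 \<le> y" "y < 1" using y by auto
      then have "0 \<le> y * ?M" by simp
      then have k: "real k \<le> y * ?M" "y * ?M < real k + 1" unfolding k_def by linarith+
      have "y * ?M < 1 * ?M" using y01 Mp by (intro mult_strict_right_mono) auto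
      with k have "real k < ?M" by linarith
      then have "k < M i n" by simp
      moreover have "k / ?M \<le> y" "y < (real k + 1) / ?M" using k Mp
          by (simp_all add: pos_divide_le_eq pos_less_divide_eq)
      with y Z(3)[of k] have "y \<in> (\<Union>z\<in>Z k. {z - \<tau> / 2..z + \<tau> / 2})" by blast
      ultimately show "y \<in> (\<Union>z\<in>?Z. {z - \<tau> / 2..z + \<tau> / 2})" by blast
    qed
    with Z(1) card show ?thesis by (intro exI[of _ ?Z]) auto
  qed
qed

text \<open>Products of coordinate covers, with the \<open>\<tau>\<close> attaining the minimum in
  \<open>s_seq\<close>; the two case distinctions in the coordinate count become the products over
  \<open>K1\<close> and \<open>K2\<close>. As the scale is at most \<open>C / 2 ^ n\<close>, the
  covers become arbitrarily fine.\<close>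

lemma exists_solutions_cover:
  assumes n: "1 \<le> n" "2 * L \<le> 2 ^ n" and C: "1 \<le> C" "\<And>i n. 1 \<le> n \<Longrightarrow> \<psi> i n \<le> C"
  shows "\<exists>\<B>. \<B> \<in> ball_covers (C / 2 ^ n) (solutions n) \<and>
    (\<Sum>\<^sub>\<infinity>B\<in>\<B>. ennreal (f (max_diameter B))) \<le> ennreal
        ((9 + C) ^ CARD('n) * (s_seq \<beta> \<psi> f n * (\<Prod>i\<in>UNIV. \<beta> i ^ n)))"
proof -
  have "s_seq \<beta> \<psi> f n \<in> scale_term n ` scales \<beta> \<psi> n"
    unfolding s_seq_eq using scales_finite by (intro Min_in) auto
  then obtain \<tau> where \<tau>s: "\<tau> \<in> scales \<beta> \<psi> n" "s_seq \<beta> \<psi> f n = scale_term n \<tau>" by blast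
  have \<tau>: "0 < \<tau>" using scales_pos[OF n(1) \<tau>s(1)] .
  have p2: "p i n \<le> 1 / 2 ^ n" for i
  proof -
    have "(2 :: nat) ^ n \<le> M i n" unfolding M_def using base(2) by (intro power_mono) auto
    then have "(2 :: real) ^ n \<le> real (M i n)" by (metis of_nat_le_iff of_nat_numeral of_nat_power)
    then show ?thesis unfolding p_def by (intro divide_left_mono) (auto simp: M_pos)
  qed
  have \<tau>_le: "\<tau> \<le> C / 2 ^ n"
  proof -
    obtain i where "\<tau> = p i n \<or> \<tau> = \<psi> i n * p i n" using \<tau>s(1) by (auto simp: scales_eq)
    moreover have "p i n \<le> C * p i n" "\<psi> i n * p i n \<le> C * p i n" 
      using C(1) C(2)[OF n(1)] p_pos[OF n(1), of i]
          by (auto intro: mult_right_mono simp: less_imp_le)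
    moreover have "C * p i n \<le> C * (1 / 2 ^ n)" using p2[of i] C by (intro mult_left_mono) auto
    ultimately show ?thesis by auto
  qed
  have "C / 2 ^ n \<le> C / 1" using C by (intro divide_left_mono) auto
  with \<tau>_le have \<tau>C: "\<tau> \<le> C" by simp
  let ?a = "\<lambda>i. if p i n \<le> \<tau> then p i n / \<tau> else 1" and ?b =
      "\<lambda>i. if \<tau> \<le> \<psi> i n * p i n then \<psi> i n * p i n / \<tau> else 1"
  have "\<exists>Z. \<forall>i. finite (Z i) \<and> {y \<in> {0..<1}. \<bar>frac (real (M i n) * y) - h i y\<bar> < \<psi> i n} \<subseteq>
      (\<Union>z\<in>Z i. {z - \<tau> / 2..z + \<tau> / 2}) \<and>
    real (card (Z i)) \<le> (9 + C) * (M i n * (?a i * ?b i))"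
    by (intro choice allI exists_coordinate_cover n C(1) \<tau>C \<tau>)
  then obtain Z where Z: "\<And>i. finite (Z i)"
    "\<And>i. {y \<in> {0..<1}. \<bar>frac (real (M i n) * y) - h i y\<bar> < \<psi> i n} \<subseteq>
        (\<Union>z\<in>Z i. {z - \<tau> / 2..z + \<tau> / 2})"
    "\<And>i. real (card (Z i)) \<le> (9 + C) * (M i n * (?a i * ?b i))" by blast
  define \<B> where "\<B> = (\<lambda>z. max_cball ((\<chi> i. z i) :: real ^ 'n) (\<tau> / 2)) ` (PiE UNIV Z)"
  have fin: "finite \<B>" unfolding \<B>_def using Z(1) by (intro finite_imageI finite_PiE) auto
  have diam: "max_diameter B = \<tau>" if "B \<in> \<B>" for B using that \<tau>
      by (auto simp: \<B>_def max_diameter_max_cball)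
  have "\<B> \<in> ball_covers (C / 2 ^ n) (solutions n)"
    unfolding ball_covers_def
  proof (intro CollectI conjI ballI)
    show "countable \<B>" using fin by (rule countable_finite)
    fix B assume B: "B \<in> \<B>"
    then obtain z where "B = max_cball (\<chi> i. z i) (\<tau> / 2)" unfolding \<B>_def by blast
    then show "\<exists>x r. 0 < r \<and> B = max_cball x r" using \<tau>
        by (intro exI[of _ "\<chi> i. z i"] exI[of _ "\<tau> / 2"]) simp
    show "max_diameter B \<le> C / 2 ^ n" using diam[OF B] \<tau>_le by simp
  next
    show "solutions n \<subseteq> \<Union>\<B>"
    proof
      fix x assume x: "x \<in> solutions n"
      have "\<exists>z\<in>Z i. x $ i \<in> {z - \<tau> / 2..z + \<tau> / 2}" for i
      proof -
        have x01: "x $ i \<in> {0..<1}" and "\<bar>(beta_map (\<beta> i) ^^ n) (x $ i) - h i (x $ i)\<bar> < \<psi> i n"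
          using x by (simp_all add: solutions_def)
        then have "\<bar>frac (real (M i n) * x $ i) - h i (x $ i)\<bar> < \<psi> i n"
          by (simp add: beta_map_iterate[OF beta_int x01] beta_power)
        with x01 have "x $ i \<in> {y \<in> {0..<1}. \<bar>frac (real (M i n) * y) - h i y\<bar> < \<psi> i n}" by simp
        with Z(2)[of i] show ?thesis by blast
      qed
      then obtain z where z: "\<And>i. z i \<in> Z i" "\<And>i. x $ i \<in> {z i - \<tau> / 2..z i + \<tau> / 2}" by metis
      have "x \<in> max_cball (\<chi> i. z i) (\<tau> / 2)"
        unfolding max_cball_eq using z(2) by simp
      moreover have "max_cball (\<chi> i. z i) (\<tau> / 2) \<in> \<B>" unfolding \<B>_def using z(1)
          by (intro imageI) auto
      ultimately show "x \<in> \<Union>\<B>" by blast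
    qed
  qed
  moreover have "(\<Sum>\<^sub>\<infinity>B\<in>\<B>. ennreal (f (max_diameter B))) \<le>
      ennreal ((9 + C) ^ CARD('n) * (s_seq \<beta> \<psi> f n * (\<Prod>i\<in>UNIV. \<beta> i ^ n)))"
  proof -
    have "(\<Sum>\<^sub>\<infinity>B\<in>\<B>. ennreal (f (max_diameter B))) = (\<Sum>B\<in>\<B>. ennreal (f \<tau>))"
      using fin diam by (simp add: infsum_finite)
    also have "\<dots> = ennreal (real (card \<B>) * f \<tau>)"
      using f_nonneg[of \<tau>] \<tau> by (simp add: ennreal_mult ennreal_of_nat_eq_real_of_nat)
    also have "\<dots> \<le> ennreal ((9 + C) ^ CARD('n) * (s_seq \<beta> \<psi> f n * (\<Prod>i\<in>UNIV. \<beta> i ^ n)))"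
    proof (rule ennreal_leI)
      have "card \<B> \<le> card (PiE UNIV Z)" unfolding \<B>_def using Z(1)
          by (intro card_image_le finite_PiE) auto
      also have "\<dots> = (\<Prod>i\<in>UNIV. card (Z i))" by (rule card_PiE) simp
      finally have "real (card \<B>) \<le> (\<Prod>i\<in>UNIV. real (card (Z i)))"
          by (metis of_nat_le_iff of_nat_prod)
      also have "\<dots> \<le> (\<Prod>i\<in>UNIV. (9 + C) * (M i n * (?a i * ?b i)))" using Z(3)
          by (intro prod_mono) auto
      also have "\<dots> = (9 + C) ^ CARD('n) *
          ((\<Prod>i\<in>UNIV. \<beta> i ^ n) * ((\<Prod>i\<in>UNIV. ?a i) * (\<Prod>i\<in>UNIV. ?b i)))"
        by (simp only: prod.distrib prod_constant beta_power)
      finally have "real (card \<B>) * f \<tau> \<le>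
          (9 + C) ^ CARD('n) * ((\<Prod>i\<in>UNIV. \<beta> i ^ n) * ((\<Prod>i\<in>UNIV. ?a i) * (\<Prod>i\<in>UNIV. ?b i))) * f \<tau>"
        using f_nonneg[of \<tau>] \<tau> by (intro mult_right_mono) auto
      also have "\<dots> = (9 + C) ^ CARD('n) * (scale_term n \<tau> * (\<Prod>i\<in>UNIV. \<beta> i ^ n))"
        by (simp add: scale_term_def prod.If_cases)
      finally show "real (card \<B>) * f \<tau> \<le> (9 + C) ^ CARD('n) * (s_seq \<beta> \<psi> f n * (\<Prod>i\<in>UNIV. \<beta> i ^ n))"
        unfolding \<tau>s(2) .
    qed
    finally show ?thesis .
  qed
  ultimately show ?thesis by blast
qed

lemma ball_covers_mono: "\<eta> \<le> \<eta>' \<Longrightarrow> ball_covers \<eta> A \<subseteq> ball_covers \<eta>' A"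
  by (auto simp: ball_covers_def)

lemma W_set_subset: "W_set \<beta> \<psi> h \<subseteq> (\<Union>n. solutions (n + N))"
proof
  fix x assume x: "x \<in> W_set \<beta> \<psi> h"
  let ?I = "{n. 1 \<le> n \<and> (\<forall>i. \<bar>(beta_map (\<beta> i) ^^ n) (x $ i) - h i (x $ i)\<bar> < \<psi> i n)}"
  have "infinite ?I" using x by (simp add: W_set_def)
  then obtain n where "N \<le> n" "n \<in> ?I" by (meson infinite_nat_iff_unbounded_le)
  then have "x \<in> solutions (n - N + N)" using x by (simp add: W_set_def solutions_def)
  then show "x \<in> (\<Union>n. solutions (n + N))" by blast
qed

theorem hausdorff_measure_W_set_eq_0:
  assumes "critical_series \<beta> \<psi> f < \<infinity>"
  shows "hausdorff_measure f (W_set \<beta> \<psi> h) = 0"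
proof -
  obtain C where C: "1 \<le> C" "\<And>i n. 1 \<le> n \<Longrightarrow> \<psi> i n \<le> C" by (rule psi_uniform_bound) (rule that)
  define t where "t n = (9 + C) ^ CARD('n) * (s_seq \<beta> \<psi> f (Suc n) * (\<Prod>i\<in>UNIV. \<beta> i ^ Suc n))" for n
  have t0: "0 \<le> t n" for n unfolding t_def using C
      by (intro mult_nonneg_nonneg[OF _ critical_term_nonneg]) simp
  have "summable (\<lambda>n. s_seq \<beta> \<psi> f (Suc n) * (\<Prod>i\<in>UNIV. \<beta> i ^ Suc n))"
    using assms unfolding critical_series_def
        by (intro summable_suminf_not_top critical_term_nonneg) simp
  then have summable: "summable t" unfolding t_def by (rule summable_mult)
  have "hausdorff_content f \<eta> (W_set \<beta> \<psi> h) = 0" if \<eta>: "0 < \<eta>" for \<eta>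
  proof -
    have le: "hausdorff_content f \<eta> (W_set \<beta> \<psi> h) \<le> ennreal e" if e: "0 < e" for e
    proof -
      obtain N1 where N1: "\<And>n. N1 \<le> n \<Longrightarrow> norm (\<Sum>i. t (i + n)) < e"
        using suminf_exist_split[OF e summable] by blast
      \<comment> \<open>Serves both requirements on late levels: expansion despite the Lipschitz
        constant, and diameters of at most \<open>\<eta>\<close>.\<close>
      obtain N2 where N2: "max (2 * L) (C / \<eta>) < 2 ^ N2"
          using real_arch_pow[of 2 "max (2 * L) (C / \<eta>)"] by auto
      \<comment> \<open>\<open>t k\<close> belongs to level \<open>k + 1\<close>, so the tail of
        \<open>t\<close> from \<open>max N1 N2\<close> on belongs to the levels from
        \<open>N\<close> on.\<close>
      define N where "N = Suc (max N1 N2)"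
      have big: "2 * L \<le> 2 ^ (n + N)" "C / 2 ^ (n + N) \<le> \<eta>" for n
      proof -
        have "(2 :: real) ^ N2 \<le> 2 ^ (n + N)" by (intro power_increasing) (auto simp: N_def)
        with N2 have "2 * L \<le> 2 ^ (n + N)" "C / \<eta> \<le> 2 ^ (n + N)" by linarith+
        then show "2 * L \<le> 2 ^ (n + N)" "C / 2 ^ (n + N) \<le> \<eta>"
          using \<eta> by (simp_all add: pos_divide_le_eq mult.commute)
      qed
      have "\<exists>\<B>. \<B> \<in> ball_covers \<eta> (solutions (n + N)) \<and> (\<Sum>\<^sub>\<infinity>B\<in>\<B>. ennreal (f (max_diameter B))) \<le>
          ennreal (t (n + max N1 N2))" for n
        using exists_solutions_cover[OF _ big(1) C, of n] ball_covers_mono[OF big(2)[of n], of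
            "solutions (n + N)"]
        unfolding t_def by (simp add: N_def del: power_Suc) blast
      then obtain \<B> where \<B>: "\<And>n. \<B> n \<in> ball_covers \<eta> (solutions (n + N))"
        "\<And>n. (\<Sum>\<^sub>\<infinity>B\<in>\<B> n. ennreal (f (max_diameter B))) \<le> ennreal (t (n + max N1 N2))" by metis
      have "hausdorff_content f \<eta> (W_set \<beta> \<psi> h) \<le> (\<Sum>n. ennreal (t (n + max N1 N2)))"
        by (rule hausdorff_content_UN_le[OF \<B>(1) W_set_subset \<B>(2)])
      also have "\<dots> = ennreal (\<Sum>n. t (n + max N1 N2))"
        using t0 summable by (intro suminf_ennreal2) (auto simp: summable_iff_shift)
      also have "\<dots> \<le> ennreal e" using N1[OF max.cobounded1, of N2] by (intro ennreal_leI) simp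
      finally show ?thesis .
    qed
    have "hausdorff_content f \<eta> (W_set \<beta> \<psi> h) \<le> 0"
    proof (rule ennreal_le_epsilon)
      fix e :: real assume "0 < e"
      from le[OF this] show "hausdorff_content f \<eta> (W_set \<beta> \<psi> h) \<le> 0 + ennreal e" by simp
    qed
    then show ?thesis by simp
  qed
  then have "(SUP \<eta>\<in>{0<..}. hausdorff_content f \<eta> (W_set \<beta> \<psi> h)) \<le> 0" by (intro SUP_least) auto
  then show ?thesis unfolding hausdorff_measure_eq_SUP by simp
qed

end

text \<open>If \<open>\<sigma>\<close> exceeded \<open>K\<close> near \<open>x\<close>, a small ball
  of radius \<open>r\<close>, whose volume is \<open>(2 * r) ^ d\<close>, would have mass at least
  \<open>K * (2 * r) ^ d\<close>, which is more than \<open>K * r ^ d\<close>.\<close>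

lemma continuous_le_if_average_le:
  fixes \<sigma> :: "real ^ 'n \<Rightarrow> real"
  assumes cont: "continuous_on UNIV \<sigma>" and "0 < K"
    and le: "\<And>r. 0 < r \<Longrightarrow> (\<integral>\<^sup>+y. ennreal (\<sigma> y) * indicator (max_cball x r) y \<partial>lborel) \<le>
        ennreal (K * r ^ CARD('n))"
  shows "\<sigma> x \<le> K"
proof (rule ccontr)
  assume "\<not> \<sigma> x \<le> K"
  then have gt: "K < \<sigma> x" by simp
  have "open {y. K < \<sigma> y}" using cont by (intro open_Collect_less continuous_intros)
  with gt obtain e where e: "0 < e" "\<And>y. dist y x < e \<Longrightarrow> K < \<sigma> y" by (auto simp: open_dist)
  define r where "r = e / (2 * real CARD('n))"
  have r: "0 < r" "r * CARD('n) < e" using e(1) by (simp_all add: r_def)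
  have "max_cball x r \<subseteq> {y. K < \<sigma> y}"
  proof
    fix y assume y: "y \<in> max_cball x r"
    have "dist y x \<le> (\<Sum>i\<in>UNIV. \<bar>(y - x) $ i\<bar>)" unfolding dist_norm by (rule norm_le_l1_cart)
    also have "\<dots> \<le> (\<Sum>i\<in>(UNIV :: 'n set). r)" using y by (intro sum_mono) (simp add: mem_max_cball)
    also have "\<dots> < e" using r by (simp add: mult.commute)
    finally show "y \<in> {y. K < \<sigma> y}" using e(2) by simp
  qed
  then have "(\<integral>\<^sup>+y. ennreal K * indicator (max_cball x r) y \<partial>lborel) \<le>
      (\<integral>\<^sup>+y. ennreal (\<sigma> y) * indicator (max_cball x r) y \<partial>lborel)"
    by (intro nn_integral_mono) (auto simp: indicator_def intro!: ennreal_leI)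
  also have "\<dots> \<le> ennreal (K * r ^ CARD('n))" by (rule le[OF r(1)])
  finally have "ennreal (K * (2 * r) ^ CARD('n)) \<le> ennreal (K * r ^ CARD('n))"
    using r \<open>0 < K\<close> by (simp add: nn_integral_cmult emeasure_max_cball flip: ennreal_mult)
  then have "K * (2 * r) ^ CARD('n) \<le> K * r ^ CARD('n)" using r \<open>0 < K\<close>
      by (simp add: ennreal_le_iff)
  then have "(2 * r) ^ CARD('n) \<le> r ^ CARD('n)" using \<open>0 < K\<close> by simp
  moreover have "r ^ CARD('n) < (2 * r) ^ CARD('n)" using r by (intro power_strict_mono) auto
  ultimately show False by simp
qed

section \<open>The divergence case: infinite measure or full Lebesgue measure\<close>

context nonzero_shrinking_targets begin

lemma limsup_target_subset: "(\<Inter>N. \<Union>n\<in>{N..}. target n) \<subseteq> W_set \<beta> \<psi> h"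
proof
  fix x assume "x \<in> (\<Inter>N. \<Union>n\<in>{N..}. target n)"
  then have often: "\<exists>n\<ge>N. x \<in> target n" for N by auto
  have "\<exists>n\<ge>N. 1 \<le> n \<and> (\<forall>i. \<bar>(beta_map (\<beta> i) ^^ n) (x $ i) - h i (x $ i)\<bar> < \<psi> i n)" for N
  proof -
    \<comment> \<open>Level 0 is avoided, as \<open>target_subset\<close> says nothing about
      it.\<close>
    obtain n where "max 1 N \<le> n" "x \<in> target n" using often by blast
    with target_subset[of n x] show ?thesis by auto
  qed
  moreover have "x $ i \<in> {0..<1}" for i
  proof -
    obtain n where "1 \<le> n" "x \<in> target n" using often by blast
    with target_subset[of n x i] show ?thesis by blast
  qed
  ultimately show "x \<in> W_set \<beta> \<psi> h"
    unfolding W_set_def infinite_nat_iff_unbounded_le by blast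
qed

lemma W_set_le_cube: "W_set \<beta> \<psi> h \<subseteq> (unit_cube :: (real ^ 'n) set)"
  by (auto simp: W_set_def unit_cube_def less_imp_le)

text \<open>As \<open>f r / r ^ d\<close> is nonincreasing, unboundedness means that it tends to
  infinity at 0, which is \<open>f_dominates\<close>.\<close>

lemma hausdorff_measure_eq_top:
  assumes div: "critical_series \<beta> \<psi> f = \<infinity>" and unbounded: "\<And>K. \<exists>r>0. K < f r / r ^ CARD('n)"
  shows "hausdorff_measure f (W_set \<beta> \<psi> h) = top"
proof -
  have dom: "\<exists>r0>0. \<forall>r. 0 < r \<longrightarrow> r \<le> r0 \<longrightarrow> K * r ^ CARD('n) \<le> f r" for K
  proof -
    obtain r0 where r0: "0 < r0" "K < f r0 / r0 ^ CARD('n)" using unbounded by blast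
    have "K * r ^ CARD('n) \<le> f r" if "0 < r" "r \<le> r0" for r
    proof -
      have "K \<le> f r / r ^ CARD('n)" using f_le_power[OF f_le_d that] r0(2) by linarith
      then show ?thesis using that by (simp add: pos_le_divide_eq)
    qed
    with r0(1) show ?thesis by blast
  qed
  have U: "ubiquitous_targets target f ball_const mass_const"
    by (rule ubiquitous_targets.intro)
      (use closed_fatten f_mono f_pos dom const_pos exists_target_density[OF div] in \<open>auto simp:
          less_imp_le\<close>)
  interpret ubiquitous_targets target f ball_const mass_const by (rule U)
  have "limsup_set \<subseteq> W_set \<beta> \<psi> h" unfolding limsup_set_def by (rule limsup_target_subset)
  then have "hausdorff_measure f limsup_set \<le> hausdorff_measure f (W_set \<beta> \<psi> h)"
      by (rule hausdorff_measure_mono)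
  then show ?thesis unfolding hausdorff_measure_limsup_set by (simp add: top_unique)
qed

text \<open>With \<open>\<epsilon> = 1\<close> the density is bounded by a constant
  \<open>K\<close>, so the targets of level at least \<open>N\<close> fill at least a fraction
  \<open>mass_const / K\<close> of every cube in the unit cube, whatever its size. By
  \<open>null_if_proportion_le\<close> their complement is null.\<close>

lemma emeasure_cube_minus_target:
  assumes div: "critical_series \<beta> \<psi> f = \<infinity>" and bounded: "\<And>r. 0 < r \<Longrightarrow> f r \<le> \<Lambda> * r ^ CARD('n)"
  shows "emeasure lborel (unit_cube - (\<Union>n\<in>{N..}. target n)) = 0"
proof (rule null_if_proportion_le)
  let ?U = "\<Union>n\<in>{N..}. target n"
  have "0 < f 1" "f 1 \<le> \<Lambda>" using f_pos[of 1] bounded[of 1] by auto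
  then have \<Lambda>: "0 < \<Lambda>" by linarith
  define K where "K = ball_const * (1 + \<Lambda>)"
  have K: "0 < K" using \<Lambda> const_pos by (simp add: K_def)
  define \<theta> where "\<theta> = max 0 (1 - mass_const / K)"
  show "unit_cube - ?U \<in> sets borel" by measurable
  show "unit_cube - ?U \<subseteq> unit_cube" by blast
  show "0 \<le> \<theta>" "\<theta> < 1" using K const_pos by (auto simp: \<theta>_def)
  fix s :: "'n \<Rightarrow> real" and \<delta> :: real assume \<delta>: "0 < \<delta>" and s: "\<And>i. 0 \<le> s i \<and> s i + \<delta> \<le> 1"
  let ?Q = "box_product (\<lambda>i. {s i..s i + \<delta>}) :: (real ^ 'n) set"
  have Q: "emeasure lborel ?Q = ennreal (\<delta> ^ CARD('n))" using \<delta> by (simp add: emeasure_box_interval)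
  obtain \<sigma> :: "real ^ 'n \<Rightarrow> real" and I where \<sigma>: "\<forall>n\<in>I. N \<le> n" "continuous_on UNIV \<sigma>"
    "\<forall>x. \<sigma> x \<noteq> 0 \<longrightarrow> x \<in> (\<Union>n\<in>I. target n)"
    "\<forall>x r. 0 < r \<longrightarrow> (\<integral>\<^sup>+y. ennreal (\<sigma> y) * indicator (max_cball x r) y \<partial>lborel) \<le>
        ennreal (ball_const * (r ^ CARD('n) + 1 * f r))"
    "\<forall>s. (\<forall>i. 0 \<le> s i \<and> s i + \<delta> \<le> 1) \<longrightarrow> ennreal (mass_const * \<delta> ^ CARD('n)) \<le>
        (\<integral>\<^sup>+y. ennreal (\<sigma> y) * indicator (box_product (\<lambda>i. {s i + \<delta> / 4..s i + 3 * \<delta> / 4})) y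
            \<partial>lborel)"
    using exists_target_density[OF div zero_less_one \<delta>, of N] by (elim exE conjE) (rule that)
  have \<sigma>_le: "\<sigma> x \<le> K" for x
  proof (rule continuous_le_if_average_le[OF \<sigma>(2)])
    fix r :: real assume r: "0 < r"
    have "ball_const * (r ^ CARD('n) + 1 * f r) \<le> ball_const * (r ^ CARD('n) + \<Lambda> * r ^ CARD('n))"
      using bounded[OF r] const_pos by (intro mult_left_mono) auto
    also have "\<dots> = K * r ^ CARD('n)" by (simp add: K_def algebra_simps)
    finally show "(\<integral>\<^sup>+y. ennreal (\<sigma> y) * indicator (max_cball x r) y \<partial>lborel) \<le>
        ennreal (K * r ^ CARD('n))"
      using \<sigma>(4) r by (meson ennreal_leI order_trans)
  qed (use K in simp)
  have "ennreal (mass_const * \<delta> ^ CARD('n)) \<le>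
      (\<integral>\<^sup>+y. ennreal (\<sigma> y) * indicator (box_product (\<lambda>i. {s i + \<delta> / 4..s i + 3 * \<delta> / 4})) y
          \<partial>lborel)"
    using \<sigma>(5) s by blast
  also have "\<dots> \<le> (\<integral>\<^sup>+y. ennreal K * indicator (?Q \<inter> ?U) y \<partial>lborel)"
  proof (rule nn_integral_mono)
    fix y :: "real ^ 'n"
    have sub: "box_product (\<lambda>i. {s i + \<delta> / 4..s i + 3 * \<delta> / 4}) \<subseteq> ?Q"
    proof
      fix z assume z: "z \<in> box_product (\<lambda>i. {s i + \<delta> / 4..s i + 3 * \<delta> / 4})"
      have "s i \<le> z $ i \<and> z $ i \<le> s i + \<delta>" for i
      proof -
        have "s i + \<delta> / 4 \<le> z $ i \<and> z $ i \<le> s i + 3 * \<delta> / 4" using z by simp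
        then show ?thesis using \<delta> by linarith
      qed
      then show "z \<in> ?Q" by simp
    qed
    show "ennreal (\<sigma> y) * indicator (box_product (\<lambda>i. {s i + \<delta> / 4..s i + 3 * \<delta> / 4})) y \<le>
        ennreal K * indicator (?Q \<inter> ?U) y"
    proof (cases "\<sigma> y = 0 \<or> y \<notin> box_product (\<lambda>i. {s i + \<delta> / 4..s i + 3 * \<delta> / 4})")
      case True
      then show ?thesis by (elim disjE) (simp_all del: mem_box_product)
    next
      case False
      then have "y \<in> (\<Union>n\<in>I. target n)" "y \<in> ?Q" using sub \<sigma>(3)
          by (simp_all add: subset_iff del: mem_box_product)
      with \<sigma>(1) have "y \<in> ?Q \<inter> ?U" by blast
      with False \<sigma>_le[of y] show ?thesis by (simp add: ennreal_leI del: mem_box_product)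
    qed
  qed
  also have "\<dots> = ennreal K * emeasure lborel (?Q \<inter> ?U)"
      by (rule nn_integral_cmult_indicator) measurable
  finally have lower: "ennreal (mass_const * \<delta> ^ CARD('n)) \<le>
      ennreal K * emeasure lborel (?Q \<inter> ?U)" .
  have fin: "emeasure lborel (?Q \<inter> ?U) \<le> ennreal (\<delta> ^ CARD('n))"
    unfolding Q[symmetric] by (rule emeasure_mono) auto
  then obtain e where e: "emeasure lborel (?Q \<inter> ?U) = ennreal e" "0 \<le> e"
    by (cases "emeasure lborel (?Q \<inter> ?U)") (auto simp: top_unique)
  have "mass_const * \<delta> ^ CARD('n) \<le> K * e"
    using lower K e \<delta> const_pos by (simp add: ennreal_le_iff flip: ennreal_mult)
  then have "mass_const / K * \<delta> ^ CARD('n) \<le> e" using K by (simp add: pos_divide_le_eq mult.commute)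
  then have "\<delta> ^ CARD('n) - e \<le> (1 - mass_const / K) * \<delta> ^ CARD('n)"
      by (simp add: left_diff_distrib)
  also have "\<dots> \<le> \<theta> * \<delta> ^ CARD('n)" using \<delta> by (intro mult_right_mono) (auto simp: \<theta>_def)
  finally have le: "\<delta> ^ CARD('n) - e \<le> \<theta> * \<delta> ^ CARD('n)" .
  have "emeasure lborel ((unit_cube - ?U) \<inter> ?Q) \<le> emeasure lborel (?Q - ?Q \<inter> ?U)"
    by (rule emeasure_mono) (auto simp del: mem_box_product)
  also have "\<dots> = ennreal (\<delta> ^ CARD('n)) - ennreal e"
    using Q e by (subst emeasure_Diff) auto
  also have "\<dots> = ennreal (\<delta> ^ CARD('n) - e)" using e by (simp add: ennreal_minus)
  also have "\<dots> \<le> ennreal (\<theta> * \<delta> ^ CARD('n))" using le by (rule ennreal_leI)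
  also have "\<dots> = ennreal \<theta> * emeasure lborel ?Q" unfolding Q
      by (rule ennreal_mult) (use \<delta> in \<open>auto simp: \<theta>_def\<close>)
  finally show "emeasure lborel ((unit_cube - ?U) \<inter> ?Q) \<le> ennreal \<theta> * emeasure lborel ?Q" .
qed

theorem hausdorff_measure_W_set_eq_cube:
  assumes div: "critical_series \<beta> \<psi> f = \<infinity>"
  shows "hausdorff_measure f (W_set \<beta> \<psi> h) = hausdorff_measure f (unit_cube :: (real ^ 'n) set)"
proof (cases "\<forall>K. \<exists>r>0. K < f r / r ^ CARD('n)")
  case True
  then have "hausdorff_measure f (W_set \<beta> \<psi> h) = top" by (intro hausdorff_measure_eq_top div) blast
  with hausdorff_measure_mono[OF W_set_le_cube, of f] show ?thesis by (simp add: top_unique)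
next
  case False
  then obtain \<Lambda> where "\<not> (\<exists>r>0. \<Lambda> < f r / r ^ CARD('n))" by blast
  then have "f r / r ^ CARD('n) \<le> \<Lambda>" if "0 < r" for r using that not_less by blast
  then have \<Lambda>: "f r \<le> \<Lambda> * r ^ CARD('n)" if "0 < r" for r using that by (simp add: pos_divide_le_eq)
  have "0 < f 1" "f 1 \<le> \<Lambda>" using f_pos[of 1] \<Lambda>[of 1] by auto
  then have \<Lambda>0: "0 \<le> \<Lambda>" by linarith
  let ?G = "\<Inter>N. \<Union>n\<in>{N..}. target n"
  have "unit_cube - ?G = (\<Union>N. unit_cube - (\<Union>n\<in>{N..}. target n))" by blast
  moreover have "emeasure lborel (\<Union>N. unit_cube - (\<Union>n\<in>{N..}. target n)) = 0"
    using emeasure_cube_minus_target[OF div \<Lambda>] by (intro emeasure_UN_eq_0) auto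
  ultimately have "emeasure lborel (unit_cube - ?G) = 0" by simp
  then have "hausdorff_measure f (unit_cube :: (real ^ 'n) set) \<le> hausdorff_measure f ?G"
    by (rule hausdorff_measure_cube_le_of_null[OF _ _ \<Lambda> \<Lambda>0, rotated]) measurable
  also have "\<dots> \<le> hausdorff_measure f (W_set \<beta> \<psi> h)"
      by (intro hausdorff_measure_mono limsup_target_subset)
  finally show ?thesis using hausdorff_measure_mono[OF W_set_le_cube, of f]
      by (rule antisym[rotated])
qed

end

text \<open>Divergence therefore forces \<open>f\<close> to be nonzero at some positive point, which
  is the hypothesis of \<open>nonzero_shrinking_targets\<close>.\<close>

lemma (in shrinking_targets) critical_series_eq_0:
  assumes "\<And>r. 0 < r \<Longrightarrow> f r = 0"
  shows "critical_series \<beta> \<psi> f = 0"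
proof -
  have "s_seq \<beta> \<psi> f (Suc n) = 0" for n
  proof -
    have "s_seq \<beta> \<psi> f (Suc n) \<in> scale_term (Suc n) ` scales \<beta> \<psi> (Suc n)"
      unfolding s_seq_eq using scales_finite by (intro Min_in) auto
    then show ?thesis using scales_pos[of "Suc n"] assms by (auto simp: scale_term_def)
  qed
  then show ?thesis by (simp add: critical_series_def)
qed

theorem theorem1p2:
  fixes \<beta> :: "'n :: {finite, linorder} \<Rightarrow> real"
    and \<psi> :: "'n \<Rightarrow> nat \<Rightarrow> real"
    and h :: "'n \<Rightarrow> real \<Rightarrow> real"
    and f :: "real \<Rightarrow> real"
    and L :: real
  assumes beta_gt_1: "\<And>i. 1 < \<beta> i"
    and beta_mono: "mono \<beta>"
    and beta_int: "\<And>i. \<beta> i \<in> \<int>"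
    and h_lipschitz: "\<And>i. L-lipschitz_on {0..<1} (h i)"
    and h_range: "\<And>i. h i ` {0..<1} \<subseteq> {0..1}"
    and psi_pos: "\<And>i n. 1 \<le> n \<Longrightarrow> 0 < \<psi> i n"
    and psi_bounded: "\<And>i. \<exists>C. \<forall>n\<ge>1. \<psi> i n \<le> C"
    and f_dim: "dimension_function f"
    and f_le_d: "f \<preceq> (\<lambda>r. r powr real CARD('n))"
    and f_cmp: "\<And>k::nat. 1 \<le> k \<Longrightarrow> k \<le> CARD('n) - 1 \<Longrightarrow>
      (\<lambda>r. r powr real k) \<preceq> f \<or> f \<preceq> (\<lambda>r. r powr real k)"
  shows "(critical_series \<beta> \<psi> f < \<infinity> \<longrightarrow> hausdorff_measure f (W_set \<beta> \<psi> h) = 0) \<and>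
      (critical_series \<beta> \<psi> f = \<infinity> \<longrightarrow>
        hausdorff_measure f (W_set \<beta> \<psi> h) =
        hausdorff_measure f {x :: (real, 'n) vec. \<forall>i. x $ i \<in> {0..1}})"
proof -
  have S: "shrinking_targets \<beta> \<psi> h f L"
    by (rule shrinking_targets.intro) fact+
  interpret shrinking_targets \<beta> \<psi> h f L by (rule S)
  show ?thesis
  proof (intro conjI impI)
    assume div: "critical_series \<beta> \<psi> f = \<infinity>"
    have "\<exists>r>0. f r \<noteq> 0"
    proof (rule ccontr)
      assume "\<not> ?thesis"
      then have "critical_series \<beta> \<psi> f = 0" by (intro critical_series_eq_0) auto
      with div show False by simp
    qed
    then have "nonzero_shrinking_targets \<beta> \<psi> h f L"
      by (intro nonzero_shrinking_targets.intro S nonzero_shrinking_targets_axioms.intro)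
    from nonzero_shrinking_targets.hausdorff_measure_W_set_eq_cube[OF this div]
    show "hausdorff_measure f (W_set \<beta> \<psi> h) =
        hausdorff_measure f {x :: (real, 'n) vec. \<forall>i. x $ i \<in> {0..1}}"
      unfolding unit_cube_def .
  qed (rule hausdorff_measure_W_set_eq_0)
qed

end
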